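(* Let $P$ be a finite poset with $n$ elements, $n\geq 3$. Then the order complex $\Delta(\hat{\mathcal O}(P))$ is homotopy equivalent to a wedge of $e_C(P)$ spheres of dimension $n-3$.
   Context: For a poset $(P,\leq)$ and an equivalence relation $\rho$ on $P$, a $\rho$-sequence is a sequence $x_0,\dots,x_m\in P$ such that for each $i\in\{1,\dots,m\}$ either $(x_{i-1},x_i)\in\rho$ or $x_{i-1}<x_i$; if moreover $x_0=x_m$ it is a $\rho$-circle. $\rho$ is an order-congruence if for every $\rho$-circle $x_0,\dots,x_m$ all the classes $\rho[x_0],\dots,\rho[x_m]$ coincide (equivalently, $\rho$ is the kernel of some order-preserving map from $P$ to a poset). An order-preserving partition of $P$ is the partition $P/\rho$ into classes of an order-congruence $\rho$. $\mathcal O(P)$ denotes the set of all order-preserving partitions of $P$ ordered by refinement; its bottom element is the partition into singletons and its top element is the one-block partition, and $\hat{\mathcal O}(P)$ is $\mathcal O(P)$ with these two elements removed. For a finite poset $Q$, $\Delta(Q)$ is the order complex: the abstract simplicial complex of all chains of $Q$. A linear extension of an $n$-element poset $P$ is an order-preserving bijection $f\colon P\to\{0,\dots,n-1\}$ (usual order on the codomain). For a linear extension $f$, define the action $\oplus_f\colon P\times\mathbb Z_n\to P$ by $x\oplus_f k=f^{-1}(f(x)\oplus k)$, where $\oplus$ is addition modulo $n$. Two linear extensions $f,g$ are cyclically equivalent if $\oplus_f=\oplus_g$; an equivalence class of this relation is a cyclic extension of $P$, and $e_C(P)$ denotes the number of cyclic extensions of $P$. A wedge of $k$ spheres of dimension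 $d$ is the space obtained from $k$ copies of $\mathbb S^d$ by identifying one chosen point on each. *)

theory Defs
  imports "HOL-Analysis.Analysis"
begin

text \<open>
  A finite poset is given by a carrier set \<open>P\<close> and a relation \<open>r\<close> with
  \<open>partial_order_on P r\<close>; here \<open>(x, y) \<in> r\<close> means \<open>x \<le> y\<close>.
\<close>

section \<open>Order-preserving partitions\<close>

text \<open>The sequence is \<open>x 0, \<dots>, x m\<close>; values of \<open>x\<close> beyond \<open>m\<close> are irrelevant.\<close>

definition rho_sequence ::
    "'a set \<Rightarrow> 'a rel \<Rightarrow> 'a rel \<Rightarrow> nat \<Rightarrow> (nat \<Rightarrow> 'a) \<Rightarrow> bool" where
  "rho_sequence P r \<rho> m x \<longleftrightarrow>
     (\<forall>i\<le>m. x i \<in> P) \<and>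
     (\<forall>i\<in>{1..m}. (x (i - 1), x i) \<in> \<rho> \<or>
                  ((x (i - 1), x i) \<in> r \<and> x (i - 1) \<noteq> x i))"

definition rho_circle ::
    "'a set \<Rightarrow> 'a rel \<Rightarrow> 'a rel \<Rightarrow> nat \<Rightarrow> (nat \<Rightarrow> 'a) \<Rightarrow> bool" where
  "rho_circle P r \<rho> m x \<longleftrightarrow> rho_sequence P r \<rho> m x \<and> x 0 = x m"

definition order_congruence :: "'a set \<Rightarrow> 'a rel \<Rightarrow> 'a rel \<Rightarrow> bool" where
  "order_congruence P r \<rho> \<longleftrightarrow>
     equiv P \<rho> \<and>
     (\<forall>m x. rho_circle P r \<rho> m x \<longrightarrow> (\<forall>i\<le>m. \<forall>j\<le>m. \<rho> `` {x i} = \<rho> `` {x j}))"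

definition op_partitions :: "'a set \<Rightarrow> 'a rel \<Rightarrow> 'a set set set" where
  "op_partitions P r = {P // \<rho> | \<rho>. order_congruence P r \<rho>}"

definition proper_op_partitions :: "'a set \<Rightarrow> 'a rel \<Rightarrow> 'a set set set" where
  "proper_op_partitions P r = op_partitions P r - {(\<lambda>x. {x}) ` P, {P}}"

definition refinement_order :: "'a set \<Rightarrow> 'a set set rel" where
  "refinement_order P = {(\<pi>, \<sigma>). refines P \<pi> \<sigma>}"


section \<open>Order complex and geometric realization\<close>

definition order_complex :: "'v set \<Rightarrow> 'v rel \<Rightarrow> 'v set set" where
  "order_complex Q s = {C. C \<subseteq> Q \<and> finite C \<and> C \<in> Chains s}"

text \<open>
  Points are given by barycentric coordinates. The topology is that of pointwise
  convergence of the coordinates, which for a finite complex is the usual Euclidean (weak)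
  topology. The empty face contributes no point, since the coordinates sum to 1.
\<close>

definition geometric_realization :: "'v set set \<Rightarrow> ('v \<Rightarrow> real) topology" where
  "geometric_realization K =
     subtopology (powertop_real UNIV)
       {t. (\<forall>v. 0 \<le> t v) \<and> {v. t v \<noteq> 0} \<in> K \<and> sum t {v. t v \<noteq> 0} = 1}"


section \<open>Wedges of spheres\<close>

text \<open>
  The wedge of pointed spaces \<open>(X i, b i)\<close> for \<open>i \<in> I\<close> is the quotient of their disjoint sum
  in which all base points are identified; \<open>None\<close> is the common base point, and
  \<open>Some (i, x)\<close> is the point \<open>x \<noteq> b i\<close> of the \<open>i\<close>-th summand. For empty \<open>I\<close> it is a single point.
\<close>

definition wedge_proj :: "('i \<Rightarrow> 'a) \<Rightarrow> 'i \<times> 'a \<Rightarrow> ('i \<times> 'a) option" where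
  "wedge_proj b = (\<lambda>(i, x). if x = b i then None else Some (i, x))"

definition wedge_sum ::
    "'i set \<Rightarrow> ('i \<Rightarrow> 'a topology) \<Rightarrow> ('i \<Rightarrow> 'a) \<Rightarrow> ('i \<times> 'a) option topology" where
  "wedge_sum I X b =
     topology (\<lambda>U. U \<subseteq> insert None (wedge_proj b ` topspace (sum_topology X I)) \<and>
       openin (sum_topology X I) {p \<in> topspace (sum_topology X I). wedge_proj b p \<in> U})"

lemma istopology_wedge_sum:
  "istopology (\<lambda>U. U \<subseteq> insert None (wedge_proj b ` topspace (sum_topology X I)) \<and>
     openin (sum_topology X I) {p \<in> topspace (sum_topology X I). wedge_proj b p \<in> U})"
proof -
  let ?T = "topspace (sum_topology X I)"
  have 1: "{p \<in> ?T. wedge_proj b p \<in> S \<inter> T} =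
      {p \<in> ?T. wedge_proj b p \<in> S} \<inter> {p \<in> ?T. wedge_proj b p \<in> T}" for S T
    by blast
  have 2: "{p \<in> ?T. wedge_proj b p \<in> \<Union>\<K>} = (\<Union>K\<in>\<K>. {p \<in> ?T. wedge_proj b p \<in> K})" for \<K>
    by blast
  show ?thesis
    unfolding istopology_def 1 2 by blast
qed

lemma openin_wedge_sum:
  "openin (wedge_sum I X b) U \<longleftrightarrow>
     U \<subseteq> insert None (wedge_proj b ` topspace (sum_topology X I)) \<and>
     openin (sum_topology X I) {p \<in> topspace (sum_topology X I). wedge_proj b p \<in> U}"
  unfolding wedge_sum_def topology_inverse'[OF istopology_wedge_sum] ..

lemma topspace_wedge_sum:
  "topspace (wedge_sum I X b) = insert None (wedge_proj b ` topspace (sum_topology X I))"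
    (is "_ = ?S")
proof
  show "topspace (wedge_sum I X b) \<subseteq> ?S"
    using openin_topspace[of "wedge_sum I X b"] unfolding openin_wedge_sum by blast
  have "{p \<in> topspace (sum_topology X I). wedge_proj b p \<in> ?S} = topspace (sum_topology X I)"
    by blast
  then have "openin (wedge_sum I X b) ?S"
    unfolding openin_wedge_sum by (metis openin_topspace order_refl)
  then show "?S \<subseteq> topspace (wedge_sum I X b)"
    by (rule openin_subset)
qed

lemma quotient_map_wedge_proj:
  assumes "i \<in> I" "b i \<in> topspace (X i)"
  shows "quotient_map (sum_topology X I) (wedge_sum I X b) (wedge_proj b)"
proof -
  have "(i, b i) \<in> topspace (sum_topology X I)"
    using assms by simp
  moreover have "wedge_proj b (i, b i) = None"
    by (simp add: wedge_proj_def)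
  ultimately have "None \<in> wedge_proj b ` topspace (sum_topology X I)"
    by (metis imageI)
  then have *: "insert None (wedge_proj b ` topspace (sum_topology X I)) =
      wedge_proj b ` topspace (sum_topology X I)"
    by (rule insert_absorb)
  show ?thesis
    unfolding quotient_map_def topspace_wedge_sum openin_wedge_sum * by blast
qed

text \<open>The base point of \<open>nsphere d\<close> is the first standard unit vector.\<close>

definition wedge_of_spheres :: "nat \<Rightarrow> nat \<Rightarrow> (nat \<times> (nat \<Rightarrow> real)) option topology" where
  "wedge_of_spheres k d =
     wedge_sum {..<k} (\<lambda>_. nsphere d) (\<lambda>_ j. if j = 0 then 1 else 0)"


section \<open>Cyclic extensions\<close>

text \<open>
  Linear extensions are taken in the extensional function space, so that two of
  them are equal iff they agree on \<open>P\<close>.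
\<close>

definition linear_extensions :: "'a set \<Rightarrow> 'a rel \<Rightarrow> ('a \<Rightarrow> nat) set" where
  "linear_extensions P r =
     {f \<in> extensional P. bij_betw f P {0..<card P} \<and>
                         monotone_on P (\<lambda>x y. (x, y) \<in> r) (\<le>) f}"

text \<open>\<open>\<int>\<^sub>n\<close> is represented by \<open>{0..<n}\<close> with addition modulo \<open>n\<close>.\<close>

definition cyclic_action :: "'a set \<Rightarrow> ('a \<Rightarrow> nat) \<Rightarrow> 'a \<times> nat \<Rightarrow> 'a" where
  "cyclic_action P f =
     (\<lambda>(x, k)\<in>P \<times> {0..<card P}. inv_into P f ((f x + k) mod card P))"

definition cyclic_equivalence :: "'a set \<Rightarrow> 'a rel \<Rightarrow> ('a \<Rightarrow> nat) rel" where
  "cyclic_equivalence P r =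
     {(f, g). f \<in> linear_extensions P r \<and> g \<in> linear_extensions P r \<and>
              cyclic_action P f = cyclic_action P g}"

definition cyclic_extensions :: "'a set \<Rightarrow> 'a rel \<Rightarrow> ('a \<Rightarrow> nat) set set" where
  "cyclic_extensions P r = linear_extensions P r // cyclic_equivalence P r"

definition num_cyclic_extensions :: "'a set \<Rightarrow> 'a rel \<Rightarrow> nat" where
  "num_cyclic_extensions P r = card (cyclic_extensions P r)"

end

theory Submission
  imports Defs
begin

text \<open>
  Let \<open>x\<close> be a minimal element of \<open>P\<close>. The complements of the coatom \<open>{x} | P - {x}\<close> in the
  lattice of order-preserving partitions are the atoms that merge \<open>x\<close> with a single \<open>z\<close> which
  covers \<open>x\<close> or is incomparable to it. The partitions that are not complements form a collapsible
  complex, since \<open>w \<ge> w \<and> s \<le> s\<close> for the coatom \<open>s\<close>, and the link of such an atom is the complex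
  of the smaller poset \<open>P / {x, z}\<close>. A cyclic extension of \<open>P\<close> in which \<open>z\<close> is the successor of
  \<open>x\<close> amounts to a cyclic extension of \<open>P / {x, z}\<close>. By induction, after removal of \<open>e\<^sub>C(P)\<close>
  maximal chains of \<open>n - 2\<close> elements the order complex becomes collapsible. The remaining contractible
  subcomplex can be shrunk to a point, and each removed simplex then becomes a sphere of
  dimension \<open>n - 3\<close>.
\<close>

section \<open>Collapsible complexes of chains\<close>

text \<open>Homotopy enters only at the end. The induction carries purely combinatorial data: a set
  of maximal chains whose removal leaves a collapsible complex. This avoids the suspensions and
  iterated homotopy equivalences of the usual homotopy complementation formula, and it keeps an
  exact count of the chains. Since the empty chain counts as a face, the induction can start with
  two elements, where the empty chain is the only face, is critical, and leaves the void complex.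

  Congruences are treated as relations, so that refinement is inclusion and meet is intersection.
  Minimality of \<open>x\<close> serves three purposes: it makes \<open>{x} | P - {x}\<close>
  order-preserving, it restricts the new relations in \<open>P / {x, z}\<close> to one kind, and it
  lets \<open>x\<close> move from the end of a linear extension to its start.

  In the geometric part the sphere coordinates and the extension of a contraction from the
  subcomplex to the whole complex are both written down explicitly in barycentric coordinates; least
  coordinates serve as continuous bump functions.\<close>

text \<open>
  A step removes all faces containing \<open>R\<close>, whose link is a cone with apex \<open>s\<close>. The case
  \<open>R = {}\<close> discards a whole cone together with the empty face, so that collapses of links can
  be joined with a vertex uniformly.
\<close>

inductive collapsible :: "'v set set \<Rightarrow> bool" where
  void: "collapsible {}"
| step: "s \<notin> R \<Longrightarrow> (\<And>T. T \<in> K \<Longrightarrow> R \<subseteq> T \<Longrightarrow> insert s T \<in> K) \<Longrightarrow>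
    collapsible {T \<in> K. \<not> R \<subseteq> T} \<Longrightarrow> collapsible K"

lemma collapsible_image:
  assumes "collapsible K" and "inj_on \<phi> V" and "\<Union>K \<subseteq> V"
  shows "collapsible ((`) \<phi> ` K)"
  using assms
proof (induction rule: collapsible.induct)
  case void
  then show ?case by (simp add: collapsible.void)
next
  case (step s R K)
  let ?K = "{T \<in> K. \<not> R \<subseteq> T}"
  have IH: "collapsible ((`) \<phi> ` ?K)"
    using step by blast
  show ?case
  \<comment> \<open>A vacuous step may name vertices outside \<open>V\<close>, where nothing is
    known about \<open>\<phi>\<close>. Otherwise a face containing \<open>R\<close> places both
    \<open>R\<close> and \<open>s\<close> inside \<open>V\<close>.\<close>
  proof (cases "\<exists>T\<in>K. R \<subseteq> T")
    case False
    then have "?K = K" by blast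
    with IH show ?thesis by simp
  next
    case True
    then have R: "R \<subseteq> V" and s: "s \<in> V"
      using step.prems(2) step.hyps(2) by blast+
    have sub: "\<phi> ` R \<subseteq> \<phi> ` T \<longleftrightarrow> R \<subseteq> T" if "T \<in> K" for T
      using that step.prems R by (meson Sup_le_iff image_mono inj_on_image_subset_iff)
    show ?thesis
    proof (rule collapsible.step[of "\<phi> s" "\<phi> ` R"])
      show "\<phi> s \<notin> \<phi> ` R"
        using step.hyps(1) step.prems(1) R s by (meson inj_on_image_mem_iff)
      show "insert (\<phi> s) T' \<in> (`) \<phi> ` K" if T': "T' \<in> (`) \<phi> ` K" "\<phi> ` R \<subseteq> T'" for T'
      proof -
        obtain T where T: "T \<in> K" "T' = \<phi> ` T" using T'(1) by blast
        then have "R \<subseteq> T" using T'(2) sub by simp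
        with T(1) have "insert s T \<in> K" by (rule step.hyps(2))
        then have "\<phi> ` insert s T \<in> (`) \<phi> ` K" by (rule imageI)
        with T(2) show ?thesis by simp
      qed
      have "{T' \<in> (`) \<phi> ` K. \<not> \<phi> ` R \<subseteq> T'} = (`) \<phi> ` ?K"
        by (auto simp: sub)
      with IH show "collapsible {T' \<in> (`) \<phi> ` K. \<not> \<phi> ` R \<subseteq> T'}" by simp
    qed
  qed
qed

text \<open>A collapse of the link of \<open>y\<close> lifts to the star of \<open>y\<close> by joining each removed face with \<open>y\<close>.\<close>

lemma collapsible_vertex:
  assumes "collapsible J" and "J = {T. y \<notin> T \<and> insert y T \<in> K}" and "collapsible {T \<in> K. y \<notin> T}"
  shows "collapsible K"
  using assms
proof (induction arbitrary: K rule: collapsible.induct)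
  case void
  have "y \<notin> T" if "T \<in> K" for T
    using void(1) that by (metis (mono_tags, lifting) Diff_iff empty_iff insertI1 insert_Diff mem_Collect_eq)
  then have "{T \<in> K. y \<notin> T} = K" by blast
  with void show ?case by simp
next
  case (step s R J)
  show ?case
  proof (cases "\<exists>T\<in>J. R \<subseteq> T")
    case False
    then have "{T \<in> J. \<not> R \<subseteq> T} = J" by blast
    with step show ?thesis by simp
  next
    case True
    then obtain T0 where "T0 \<in> J" "R \<subseteq> T0" by blast
    \<comment> \<open>\<open>T0\<close> and \<open>insert s T0\<close> both lie in the link, whose
      faces avoid \<open>y\<close>.\<close>
    with step.hyps(2) step.prems(1) have y: "y \<notin> R" "s \<noteq> y" by blast+
    let ?K = "{T \<in> K. \<not> insert y R \<subseteq> T}"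
    show ?thesis
    proof (rule collapsible.step[of s "insert y R"])
      show "s \<notin> insert y R"
        using y step.hyps(1) by simp
      show "insert s T \<in> K" if "T \<in> K" "insert y R \<subseteq> T" for T
      proof -
        have "T - {y} \<in> J" "R \<subseteq> T - {y}"
          using that y step.prems(1) by (auto simp: insert_absorb)
        then have "insert s (T - {y}) \<in> J"
          by (rule step.hyps(2))
        then have "insert y (insert s (T - {y})) \<in> K"
          using step.prems(1) by blast
        moreover have "insert y (insert s (T - {y})) = insert s T"
          using that by blast
        ultimately show ?thesis by simp
      qed
      have "{T \<in> J. \<not> R \<subseteq> T} = {T. y \<notin> T \<and> insert y T \<in> ?K}"
        using step.prems(1) y by auto
      moreover have "{T \<in> ?K. y \<notin> T} = {T \<in> K. y \<notin> T}"
        by blast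
      ultimately show "collapsible ?K"
        using step.IH step.prems(2) by simp
    qed
  qed
qed

text \<open>No face contains two elements of \<open>Y\<close>, so deleting the star of one of them
  leaves the links of the others unchanged, and the stars can be collapsed one after
  another.\<close>

lemma collapsible_vertices:
  assumes "finite Y" and "\<And>y T. y \<in> Y \<Longrightarrow> T \<in> K \<Longrightarrow> y \<in> T \<Longrightarrow> T \<inter> Y = {y}"
    and "\<And>y. y \<in> Y \<Longrightarrow> collapsible {T. y \<notin> T \<and> insert y T \<in> K}"
    and "collapsible {T \<in> K. T \<inter> Y = {}}"
  shows "collapsible K"
  using assms
proof (induction arbitrary: K rule: finite_induct)
  case empty
  then show ?case by simp
next
  case (insert y Y)
  show ?case
  proof (rule collapsible_vertex[OF _ refl])
    show "collapsible {T. y \<notin> T \<and> insert y T \<in> K}"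
      using insert.prems(2) by blast
    show "collapsible {T \<in> K. y \<notin> T}"
    proof (rule insert.IH)
      show "T \<inter> Y = {y'}" if "y' \<in> Y" "T \<in> {T \<in> K. y \<notin> T}" "y' \<in> T" for y' T
        using insert.prems(1)[of y' T] that by blast
      show "collapsible {T. y' \<notin> T \<and> insert y' T \<in> {T \<in> K. y \<notin> T}}" if y': "y' \<in> Y" for y'
      proof -
        have "y \<notin> insert y' T" if "insert y' T \<in> K" for T
          using insert.prems(1)[OF _ that, of y'] y' insert.hyps(2) by auto
        then have "{T. y' \<notin> T \<and> insert y' T \<in> {T \<in> K. y \<notin> T}} = {T. y' \<notin> T \<and> insert y' T \<in> K}"
          by blast
        then show ?thesis
          using insert.prems(2) y' by simp
      qed
      have "{T \<in> {T \<in> K. y \<notin> T}. T \<inter> Y = {}} = {T \<in> K. T \<inter> insert y Y = {}}"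
        by blast
      then show "collapsible {T \<in> {T \<in> K. y \<notin> T}. T \<inter> Y = {}}"
        using insert.prems(3) by simp
    qed
  qed
qed

text \<open>The order complex of a family of sets under inclusion. It is applied to equivalence
  relations, for which inclusion is refinement of the partitions.\<close>

definition flags :: "'b set set \<Rightarrow> 'b set set set" where
  "flags Q = {C. C \<subseteq> Q \<and> finite C \<and> (\<forall>a\<in>C. \<forall>b\<in>C. a \<subseteq> b \<or> b \<subseteq> a)}"

lemma flags_embedding:
  assumes "\<And>a b. a \<in> Q \<Longrightarrow> b \<in> Q \<Longrightarrow> \<phi> a \<subseteq> \<phi> b \<longleftrightarrow> a \<subseteq> b"
  shows "flags (\<phi> ` Q) = (`) \<phi> ` flags Q"
proof (intro subset_antisym subsetI)
  fix C assume "C \<in> flags (\<phi> ` Q)"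
  then have C: "C \<subseteq> \<phi> ` Q" "finite C" "\<forall>a\<in>C. \<forall>b\<in>C. a \<subseteq> b \<or> b \<subseteq> a"
    by (auto simp: flags_def)
  obtain D where D: "D \<subseteq> Q" "finite D" "C = \<phi> ` D"
    using finite_subset_image[OF C(2,1)] by blast
  moreover have "a \<subseteq> b \<or> b \<subseteq> a" if "a \<in> D" "b \<in> D" for a b
  proof -
    have "\<phi> a \<subseteq> \<phi> b \<or> \<phi> b \<subseteq> \<phi> a" "a \<in> Q" "b \<in> Q" using that C(3) D(1,3) by auto
    then show ?thesis using assms[of a b] assms[of b a] by simp
  qed
  ultimately have "D \<in> flags Q"
    by (simp add: flags_def)
  with D(3) show "C \<in> (`) \<phi> ` flags Q" by blast
next
  fix C assume "C \<in> (`) \<phi> ` flags Q"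
  then obtain D where D: "C = \<phi> ` D" "D \<subseteq> Q" "finite D" "\<forall>a\<in>D. \<forall>b\<in>D. a \<subseteq> b \<or> b \<subseteq> a"
    by (auto simp: flags_def)
  have "\<phi> a \<subseteq> \<phi> b \<or> \<phi> b \<subseteq> \<phi> a" if "a \<in> D" "b \<in> D" for a b
  proof -
    have "a \<in> Q" "b \<in> Q" "a \<subseteq> b \<or> b \<subseteq> a" using that D(2,4) by auto
    then show ?thesis using assms[of a b] assms[of b a] by simp
  qed
  then show "C \<in> flags (\<phi> ` Q)"
    using D(1-3) by (simp add: flags_def image_mono)
qed

lemma finite_flags: "finite Q \<Longrightarrow> finite (flags Q)"
  by (rule finite_subset[of _ "Pow Q"]) (auto simp: flags_def)

text \<open>Take a minimal \<open>w\<close> not below \<open>s\<close>. Everything strictly below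
  \<open>w\<close> is below \<open>s\<close>, hence below \<open>w \<inter> s\<close>, so the link
  of \<open>w\<close> is a cone with apex \<open>w \<inter> s\<close> and \<open>w\<close> can be
  removed. Once no such \<open>w\<close> is left, \<open>s\<close> itself is an apex.\<close>

lemma collapsible_flags_meet:
  assumes "finite Q" and "s \<in> Q" and "\<And>w. w \<in> Q \<Longrightarrow> w \<inter> s \<in> Q"
  shows "collapsible (flags Q)"
  using assms
proof (induction "card {w \<in> Q. \<not> w \<subseteq> s}" arbitrary: Q)
  case 0
  then have below: "w \<subseteq> s" if "w \<in> Q" for w
    using that by auto
  have "{T \<in> flags Q. \<not> {} \<subseteq> T} = {}" by blast
  moreover have "insert s T \<in> flags Q" if "T \<in> flags Q" for T
    using that 0(3) below by (auto simp: flags_def)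
  ultimately show ?case
    by (rule_tac collapsible.step[of s "{}"]) (simp_all add: collapsible.void)
next
  case (Suc k)
  let ?N = "{w \<in> Q. \<not> w \<subseteq> s}"
  have "finite ?N" "?N \<noteq> {}"
    using Suc.prems(1) Suc.hyps(2) by (auto simp del: Collect_empty_eq)
  then obtain w where w: "w \<in> ?N" and min: "\<And>v. v \<in> ?N \<Longrightarrow> v \<subseteq> w \<Longrightarrow> w = v"
    using finite_has_minimal[of ?N] by blast
  have "insert (w \<inter> s) T \<in> flags Q" if T: "T \<in> flags Q" "{w} \<subseteq> T" for T
  proof -
    have "a \<subseteq> w \<inter> s \<or> w \<inter> s \<subseteq> a" if "a \<in> T" for a
    proof (cases "w \<subseteq> a")
      case False
      then have "a \<subseteq> w" "a \<noteq> w"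
        using T that by (auto simp: flags_def)
      moreover have "a \<in> Q"
        using T that by (auto simp: flags_def)
      ultimately have "a \<subseteq> s"
        using min by blast
      with \<open>a \<subseteq> w\<close> show ?thesis by blast
    qed blast
    moreover have "w \<inter> s \<in> Q" using w Suc.prems(3) by blast
    moreover have "T \<subseteq> Q" "finite T" "\<forall>a\<in>T. \<forall>b\<in>T. a \<subseteq> b \<or> b \<subseteq> a"
      using T(1) by (simp_all add: flags_def)
    ultimately show ?thesis
      by (simp add: flags_def) blast
  qed
  moreover have "w \<inter> s \<notin> {w}"
    using w by blast
  moreover have "{T \<in> flags Q. \<not> {w} \<subseteq> T} = flags (Q - {w})"
    by (auto simp: flags_def)
  moreover have "collapsible (flags (Q - {w}))"
  proof (rule Suc.hyps(1))
    have "{v \<in> Q - {w}. \<not> v \<subseteq> s} = ?N - {w}" by blast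
    then show "k = card {v \<in> Q - {w}. \<not> v \<subseteq> s}"
      using w Suc.hyps(2) \<open>finite ?N\<close> by simp
  qed (use Suc.prems w in auto)
  ultimately show ?case
    by (rule_tac collapsible.step[of "w \<inter> s" "{w}"]) auto
qed

text \<open>The elements of \<open>Y\<close> play the role of the complements of the coatom \<open>s\<close> in the homotopy
  complementation formula.\<close>

lemma collapsible_flags_complements:
  assumes fin: "finite L" and s: "s \<in> L" and Y: "Y \<subseteq> L"
    and meet: "\<And>w. w \<in> L \<Longrightarrow> w \<notin> Y \<Longrightarrow> w \<inter> s \<in> L"
    and ns: "\<And>y. y \<in> Y \<Longrightarrow> \<not> y \<subseteq> s"
    and atom: "\<And>y w. y \<in> Y \<Longrightarrow> w \<in> L \<Longrightarrow> w \<subseteq> y \<Longrightarrow> w = y"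
    and G: "\<And>y. y \<in> Y \<Longrightarrow> G y \<subseteq> flags {w \<in> L. y \<subset> w}"
    and coll: "\<And>y. y \<in> Y \<Longrightarrow> collapsible (flags {w \<in> L. y \<subset> w} - G y)"
    and k: "\<And>y F. y \<in> Y \<Longrightarrow> F \<in> G y \<Longrightarrow> card F = k"
    and max: "\<And>y F T. y \<in> Y \<Longrightarrow> F \<in> G y \<Longrightarrow> T \<in> flags {w \<in> L. y \<subset> w} \<Longrightarrow> F \<subseteq> T \<Longrightarrow> T = F"
  shows "\<exists>\<F>. \<F> \<subseteq> flags L \<and> card \<F> = (\<Sum>y\<in>Y. card (G y)) \<and>
      (\<forall>F\<in>\<F>. card F = Suc k \<and> (\<forall>T\<in>flags L. F \<subseteq> T \<longrightarrow> T = F)) \<and> collapsible (flags L - \<F>)"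
proof -
  \<comment> \<open>Each critical chain above \<open>y\<close> is extended by \<open>y\<close>
    itself, which accounts for the size \<open>Suc k\<close>.\<close>
  define \<F> where "\<F> = (\<Union>y\<in>Y. insert y ` G y)"
  have finY: "finite Y" using Y fin finite_subset by blast
  have link: "y \<notin> T \<and> insert y T \<in> flags L \<longleftrightarrow> T \<in> flags {w \<in> L. y \<subset> w}" if y: "y \<in> Y" for y T
  proof
    assume T: "y \<notin> T \<and> insert y T \<in> flags L"
    have "w \<in> L \<and> y \<subset> w" if "w \<in> T" for w
    proof -
      have "w \<in> L" "w \<noteq> y" "w \<subseteq> y \<or> y \<subseteq> w"
        using T that by (auto simp: flags_def)
      then show ?thesis using atom[OF y] by blast
    qed
    with T show "T \<in> flags {w \<in> L. y \<subset> w}"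
      by (auto simp: flags_def)
  next
    assume "T \<in> flags {w \<in> L. y \<subset> w}"
    then show "y \<notin> T \<and> insert y T \<in> flags L"
      using y Y by (auto simp: flags_def)
  qed
  have Gy: "y \<notin> F" "insert y F \<in> flags L" if "y \<in> Y" "F \<in> G y" for y F
    using G link that by blast+
  \<comment> \<open>Elements of \<open>Y\<close> are minimal in \<open>L\<close>, so two of them are
    comparable only if they are equal.\<close>
  have only: "T \<inter> Y = {y}" if "y \<in> Y" "T \<in> flags L" "y \<in> T" for y T
  proof -
    have "z = y" if "z \<in> T" "z \<in> Y" for z
      using that \<open>y \<in> Y\<close> \<open>T \<in> flags L\<close> \<open>y \<in> T\<close> atom[of y z] atom[of z y]
      unfolding flags_def by blast
    with that show ?thesis by blast
  qed
  have uniq: "y = y' \<and> F = F'"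
    if "y \<in> Y" "F \<in> G y" "y' \<in> Y" "insert y F = insert y' F'" "y' \<notin> F'" for y F y' F'
  proof -
    have "insert y F \<inter> Y = {y}"
      using only Gy that by blast
    moreover have "y' \<in> insert y F" using that(4) by blast
    ultimately have "y' = y" using that(3) by blast
    moreover have "y \<notin> F" by (rule Gy(1)[OF that(1,2)])
    ultimately show ?thesis using that(4,5) by (metis insert_ident)
  qed
  have "\<F> \<subseteq> flags L"
    unfolding \<F>_def using Gy by blast
  moreover have "card \<F> = (\<Sum>y\<in>Y. card (G y))"
  proof -
    have fG: "finite (G y)" if "y \<in> Y" for y
      using fin by (intro finite_subset[OF G[OF that]] finite_flags) simp
    have "card \<F> = (\<Sum>y\<in>Y. card (insert y ` G y))"
      unfolding \<F>_def
    proof (rule card_UN_disjoint)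
      have "y = y'" if a: "y \<in> Y" "y' \<in> Y" "F \<in> insert y ` G y" "F \<in> insert y' ` G y'" for y y' F
      proof -
        obtain F1 F2 where "F1 \<in> G y" "F2 \<in> G y'" "F = insert y F1" "F = insert y' F2"
          using a(3,4) by blast
        then show ?thesis
          using uniq[OF a(1) _ a(2), of F1 F2] Gy(1)[OF a(2), of F2] by simp
      qed
      then show "\<forall>y\<in>Y. \<forall>y'\<in>Y. y \<noteq> y' \<longrightarrow> insert y ` G y \<inter> insert y' ` G y' = {}"
        by (auto simp only: disjoint_iff)
    qed (use finY fG in auto)
    also have "\<dots> = (\<Sum>y\<in>Y. card (G y))"
    proof (intro sum.cong refl card_image inj_onI)
      fix y F F' assume y: "y \<in> Y" "F \<in> G y" "F' \<in> G y" "insert y F = insert y F'"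
      show "F = F'" using uniq[OF y(1,2,1,4) Gy(1)[OF y(1,3)]] by simp
    qed
    finally show ?thesis .
  qed
  moreover have "card F = Suc k \<and> (\<forall>T\<in>flags L. F \<subseteq> T \<longrightarrow> T = F)" if F: "F \<in> \<F>" for F
  proof -
    obtain y F0 where y: "y \<in> Y" "F0 \<in> G y" "F = insert y F0"
      using F unfolding \<F>_def by blast
    have "finite F0" using G y by (auto simp: flags_def)
    then have "card F = Suc k"
      using y Gy k by simp
    moreover have "T = F" if T: "T \<in> flags L" "F \<subseteq> T" for T
    proof -
      have "insert y (T - {y}) = T" using T y by blast
      then have "T - {y} \<in> flags {w \<in> L. y \<subset> w}"
        using link[OF y(1), of "T - {y}"] T by simp
      moreover have "F0 \<subseteq> T - {y}"
        using T y Gy by blast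
      ultimately have "T - {y} = F0"
        using max y by blast
      with T y show ?thesis by blast
    qed
    ultimately show ?thesis by blast
  qed
  moreover have "collapsible (flags L - \<F>)"
  proof (rule collapsible_vertices[OF finY])
    show "T \<inter> Y = {y}" if "y \<in> Y" "T \<in> flags L - \<F>" "y \<in> T" for y T
      using that only by blast
    show "collapsible {T. y \<notin> T \<and> insert y T \<in> flags L - \<F>}" if y: "y \<in> Y" for y
    proof -
      have "insert y T \<in> \<F> \<longleftrightarrow> T \<in> G y" if T: "y \<notin> T" for T
      proof
        assume "insert y T \<in> \<F>"
        then obtain y' F where F: "y' \<in> Y" "F \<in> G y'" "insert y' F = insert y T"
          unfolding \<F>_def by auto
        show "T \<in> G y" using uniq[OF F(1,2) y F(3) T] F(2) by simp
      qed (use y in \<open>auto simp: \<F>_def\<close>)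
      then have "{T. y \<notin> T \<and> insert y T \<in> flags L - \<F>} = flags {w \<in> L. y \<subset> w} - G y"
        using link[OF y] by blast
      then show ?thesis using coll[OF y] by simp
    qed
    \<comment> \<open>Every critical chain meets \<open>Y\<close>, so none of them is missing
      here.\<close>
    have "{T \<in> flags L - \<F>. T \<inter> Y = {}} = flags (L - Y)"
      by (auto simp: flags_def \<F>_def)
    moreover have "collapsible (flags (L - Y))"
      using fin s ns meet by (intro collapsible_flags_meet[where s = s]) auto
    ultimately show "collapsible {T \<in> flags L - \<F>. T \<inter> Y = {}}" by simp
  qed
  ultimately show ?thesis by blast
qed

section \<open>Order-congruences\<close>

text \<open>
  An order-congruence is the kernel of an order-preserving map, that is, the symmetric part of a
  preorder extending \<open>r\<close>.
\<close>

definition congruences :: "'a set \<Rightarrow> 'a rel \<Rightarrow> 'a rel set" where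
  "congruences P r = {t \<inter> t\<inverse> | t. preorder_on P t \<and> r \<subseteq> t}"

definition proper_congruences :: "'a set \<Rightarrow> 'a rel \<Rightarrow> 'a rel set" where
  "proper_congruences P r = congruences P r - {Id_on P, P \<times> P}"

lemma preorder_onI:
  assumes "t \<subseteq> P \<times> P" "\<And>a. a \<in> P \<Longrightarrow> (a, a) \<in> t"
    "\<And>a b c. (a, b) \<in> t \<Longrightarrow> (b, c) \<in> t \<Longrightarrow> (a, c) \<in> t"
  shows "preorder_on P t"
  using assms unfolding preorder_on_def refl_on_def trans_def by blast

lemma preorder_onE:
  assumes "preorder_on P t"
  obtains "t \<subseteq> P \<times> P" "\<And>a. a \<in> P \<Longrightarrow> (a, a) \<in> t"
    "\<And>a b c. (a, b) \<in> t \<Longrightarrow> (b, c) \<in> t \<Longrightarrow> (a, c) \<in> t"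
  using assms unfolding preorder_on_def refl_on_def trans_def by blast

lemma congruences_equiv: "w \<in> congruences P r \<Longrightarrow> equiv P w"
  unfolding congruences_def preorder_on_def equiv_def refl_on_def sym_def trans_def by blast

text \<open>Intersecting two preorders intersects their symmetric parts; thus intersection serves as
  the meet with the coatom.\<close>

lemma congruences_Int:
  assumes "w \<in> congruences P r" "v \<in> congruences P r"
  shows "w \<inter> v \<in> congruences P r"
proof -
  obtain t u where t: "w = t \<inter> t\<inverse>" "preorder_on P t" "r \<subseteq> t"
    and u: "v = u \<inter> u\<inverse>" "preorder_on P u" "r \<subseteq> u"
    using assms by (auto simp: congruences_def)
  have "preorder_on P (t \<inter> u)"
    using t u by (auto simp: preorder_on_def refl_on_def trans_def)
  moreover have "w \<inter> v = (t \<inter> u) \<inter> (t \<inter> u)\<inverse>"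
    using t u by auto
  ultimately show ?thesis
    using t u by (auto simp: congruences_def)
qed

lemma finite_congruences: "finite P \<Longrightarrow> finite (congruences P r)"
  using congruences_equiv[of _ P r] unfolding equiv_def
  by (intro finite_subset[of "congruences P r" "Pow (P \<times> P)"]) auto

text \<open>For a congruence, the transitive closure of \<open>\<rho> \<union> r\<close> is the
  required preorder: paths from \<open>a\<close> to \<open>b\<close> and back join to a circle
  through both. Conversely, along a circle the preorder ascends and returns to its start, so all
  members are equivalent.\<close>

lemma order_congruence_iff:
  assumes r: "r \<subseteq> P \<times> P"
  shows "order_congruence P r \<rho> \<longleftrightarrow> \<rho> \<in> congruences P r"
proof
  assume oc: "order_congruence P r \<rho>"
  note oc' = oc[unfolded order_congruence_def]
  have eq: "equiv P \<rho>"
    by (rule conjunct1[OF oc'])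
  have circ: "\<rho> `` {x i} = \<rho> `` {x j}" if "rho_circle P r \<rho> m x" "i \<le> m" "j \<le> m" for m x i j
    using conjunct2[OF oc'] that by blast
  have sub: "\<rho> \<subseteq> P \<times> P" using eq by (auto simp: equiv_def)
  define t where "t = (\<rho> \<union> r)\<^sup>+"
  have tP: "t \<subseteq> P \<times> P"
    unfolding t_def using sub r by (intro trancl_subset_Sigma) auto
  have "preorder_on P t"
    using tP eq unfolding t_def by (auto simp: preorder_on_def equiv_def refl_on_def)
  moreover have "\<rho> = t \<inter> t\<inverse>"
  proof (intro subset_antisym subrelI)
    show "(a, b) \<in> t \<inter> t\<inverse>" if "(a, b) \<in> \<rho>" for a b
      using that eq unfolding t_def equiv_def by (auto dest: symD)
    show "(a, b) \<in> \<rho>" if ab: "(a, b) \<in> t \<inter> t\<inverse>" for a b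
    proof -
      have P: "a \<in> P" "b \<in> P" using ab tP by auto
      obtain k l where k: "(a, b) \<in> (\<rho> \<union> r) ^^ k" and l: "(b, a) \<in> (\<rho> \<union> r) ^^ l"
        using ab unfolding t_def by (metis IntD1 IntD2 converse_iff trancl_power)
      obtain f where f: "f 0 = a" "f k = b" "\<And>i. i < k \<Longrightarrow> (f i, f (Suc i)) \<in> \<rho> \<union> r"
        using k unfolding relpow_fun_conv by blast
      obtain g where g: "g 0 = b" "g l = a" "\<And>i. i < l \<Longrightarrow> (g i, g (Suc i)) \<in> \<rho> \<union> r"
        using l unfolding relpow_fun_conv by blast
      \<comment> \<open>The two paths are concatenated at index \<open>k\<close>, where
        \<open>f k = b = g 0\<close>.\<close>
      define x where "x = (\<lambda>i. if i \<le> k then f i else g (i - k))"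
      have st: "(x i, x (Suc i)) \<in> \<rho> \<union> r" if "i < k + l" for i
      proof (cases "i < k")
        case False
        have xx: "x i = g (i - k)" "x (Suc i) = g (Suc (i - k))"
          using False f(2) g(1) by (auto simp: x_def Suc_diff_le)
        show ?thesis using g(3)[of "i - k"] that False unfolding xx by simp
      qed (use f in \<open>simp add: x_def\<close>)
      have x0: "x 0 = a" "x (k + l) = a" "x k = b"
        using f g by (auto simp: x_def)
      have inP: "x i \<in> P" if "i \<le> k + l" for i
      proof (cases i)
        case 0
        then show ?thesis using x0 P by simp
      next
        case (Suc j)
        then show ?thesis using st[of j] that sub r by auto
      qed
      have "(x (i - 1), x i) \<in> \<rho> \<or> (x (i - 1), x i) \<in> r \<and> x (i - 1) \<noteq> x i"
        if i: "i \<in> {1..k + l}" for i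
      proof -
        have "(x (i - 1), x i) \<in> \<rho> \<union> r"
          using st[of "i - 1"] i by auto
        \<comment> \<open>Steps by \<open>r\<close> have to be strict; one with equal endpoints
          counts as a step by \<open>\<rho>\<close> instead.\<close>
        moreover have "(x i, x i) \<in> \<rho>"
          using inP[of i] i eq by (auto simp: equiv_def refl_on_def)
        ultimately show ?thesis by auto
      qed
      then have "rho_circle P r \<rho> (k + l) x"
        using inP x0 by (simp add: rho_circle_def rho_sequence_def)
      then have "\<rho> `` {x 0} = \<rho> `` {x k}"
        by (rule circ) simp_all
      then show ?thesis
        unfolding x0 using eq P(2) by (rule eq_equiv_class)
    qed
  qed
  moreover have "r \<subseteq> t" unfolding t_def by auto
  ultimately show "\<rho> \<in> congruences P r"
    by (auto simp: congruences_def)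
next
  assume \<rho>: "\<rho> \<in> congruences P r"
  then have eq: "equiv P \<rho>" by (rule congruences_equiv)
  obtain t where t: "preorder_on P t" "r \<subseteq> t" "\<rho> = t \<inter> t\<inverse>"
    using \<rho> by (auto simp: congruences_def)
  have tr: "(a, b) \<in> t \<Longrightarrow> (b, c) \<in> t \<Longrightarrow> (a, c) \<in> t" for a b c
    using t by (auto elim: preorder_onE)
  have "\<rho> `` {x i} = \<rho> `` {x j}" if circ: "rho_circle P r \<rho> m x" and i: "i \<le> m" and j: "j \<le> m" for m x i j
  proof -
    have st: "(x i, x (Suc i)) \<in> t" if "i < m" for i
    proof -
      have "Suc i \<in> {1..m}" using that by simp
      then have "(x (Suc i - 1), x (Suc i)) \<in> \<rho> \<or> (x (Suc i - 1), x (Suc i)) \<in> r"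
        using circ unfolding rho_circle_def rho_sequence_def by blast
      with t show ?thesis by auto
    qed
    have xP: "x i \<in> P" if "i \<le> m" for i
      using circ that by (auto simp: rho_circle_def rho_sequence_def)
    have up: "(x i, x k) \<in> t" if "i \<le> k" "k \<le> m" for i k
      using that
    proof (induction rule: dec_induct)
      case base
      then show ?case using t xP by (auto elim: preorder_onE)
    next
      case (step k)
      then show ?case using st tr by (metis Suc_leD Suc_le_eq)
    qed
    have "x 0 = x m" using circ by (simp add: rho_circle_def)
    \<comment> \<open>From \<open>x i\<close> one ascends to \<open>x m = x 0\<close> and from there
      to \<open>x j\<close>.\<close>
    then have all: "(x i, x j) \<in> t" if "i \<le> m" "j \<le> m" for i j
      using up[of i m] up[of 0 j] that tr by auto
    then have "(x i, x j) \<in> \<rho>" using i j t by auto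
    with eq show ?thesis by (rule equiv_class_eq)
  qed
  with eq show "order_congruence P r \<rho>"
    unfolding order_congruence_def by blast
qed

section \<open>Identifying a minimal element with another element\<close>

definition least_merge :: "'a set \<Rightarrow> 'a \<Rightarrow> 'a \<Rightarrow> 'a rel" where
  "least_merge P x z = Id_on P \<union> {(x, z), (z, x)}"

text \<open>
  The order of the poset obtained by identifying \<open>x\<close>, assumed minimal, with \<open>z\<close>; the merged
  element is represented by \<open>z\<close>.
\<close>

definition quotient_order :: "'a set \<Rightarrow> 'a rel \<Rightarrow> 'a \<Rightarrow> 'a \<Rightarrow> 'a rel" where
  "quotient_order P r x z =
     {(a, b). a \<in> P - {x} \<and> b \<in> P - {x} \<and> ((a, b) \<in> r \<or> (a, z) \<in> r \<and> (x, b) \<in> r)}"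

text \<open>For minimal \<open>x\<close> these are the covers of \<open>x\<close> and the elements
  incomparable to \<open>x\<close>: nothing can lie between two incomparable elements, so one
  condition describes both kinds.\<close>

definition mergeable :: "'a set \<Rightarrow> 'a rel \<Rightarrow> 'a \<Rightarrow> 'a set" where
  "mergeable P r x = {z \<in> P - {x}. \<not> (\<exists>c\<in>P - {x, z}. (x, c) \<in> r \<and> (c, z) \<in> r)}"

text \<open>The preimage of \<open>\<rho>\<close> under the map that sends \<open>x\<close> to
  \<open>z\<close> and fixes the other elements; it is applied to preorders as well as to
  equivalence relations.\<close>

definition pull_rel :: "'a set \<Rightarrow> 'a \<Rightarrow> 'a \<Rightarrow> 'a rel \<Rightarrow> 'a rel" where
  "pull_rel P x z \<rho> =
     {(a, b). a \<in> P \<and> b \<in> P \<and> (if a = x then z else a, if b = x then z else b) \<in> \<rho>}"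

lemma pull_rel_subset_iff:
  assumes "\<rho> \<subseteq> (P - {x}) \<times> (P - {x})"
  shows "pull_rel P x z \<rho> \<subseteq> pull_rel P x z \<sigma> \<longleftrightarrow> \<rho> \<subseteq> \<sigma>"
proof
  assume sub: "pull_rel P x z \<rho> \<subseteq> pull_rel P x z \<sigma>"
  show "\<rho> \<subseteq> \<sigma>"
  proof (rule subrelI)
    fix a b assume ab: "(a, b) \<in> \<rho>"
    then have "a \<in> P - {x}" "b \<in> P - {x}" using assms by auto
    with ab have "(a, b) \<in> pull_rel P x z \<rho>" by (auto simp: pull_rel_def)
    with sub have "(a, b) \<in> pull_rel P x z \<sigma>" by blast
    with \<open>a \<in> P - {x}\<close> \<open>b \<in> P - {x}\<close> show "(a, b) \<in> \<sigma>" by (auto simp: pull_rel_def)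
  qed
qed (auto simp: pull_rel_def)

locale minimal_element =
  fixes P :: "'a set" and r :: "'a rel" and x :: 'a
  assumes po: "partial_order_on P r" and x: "x \<in> P" and min: "\<And>a. (a, x) \<in> r \<Longrightarrow> a = x"
begin

lemma rP: "(a, b) \<in> r \<Longrightarrow> a \<in> P \<and> b \<in> P"
  using partial_order_onD(4)[OF po] by blast

lemma r_refl: "a \<in> P \<Longrightarrow> (a, a) \<in> r"
  by (rule refl_onD[OF partial_order_onD(1)[OF po]])

lemmas r_trans = transD[OF partial_order_onD(2)[OF po]]

lemmas r_antisym = antisymD[OF partial_order_onD(3)[OF po]]

lemma mergeable_between: "z \<in> mergeable P r x \<Longrightarrow> (x, c) \<in> r \<Longrightarrow> (c, z) \<in> r \<Longrightarrow> c = x \<or> c = z"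
  using rP[of x c] unfolding mergeable_def by blast

lemma pull_rel_Id_on:
  assumes z: "z \<in> P - {x}"
  shows "pull_rel P x z (Id_on (P - {x})) = least_merge P x z"
proof -
  have "(a, b) \<in> pull_rel P x z (Id_on (P - {x})) \<longleftrightarrow> (a, b) \<in> least_merge P x z" for a b
    using z x by (cases "a = x"; cases "b = x") (auto simp: pull_rel_def least_merge_def Id_on_iff)
  then show ?thesis by auto
qed

text \<open>As nothing else lies below \<open>x\<close>, merging adds only the detours from
  \<open>a \<le> z\<close> to \<open>x \<le> b\<close>. A cycle that uses a detour has both its
  members between \<open>x\<close> and \<open>z\<close>, so mergeability makes both equal to
  \<open>z\<close>.\<close>

lemma partial_order_quotient_order:
  assumes z: "z \<in> mergeable P r x"
  shows "partial_order_on (P - {x}) (quotient_order P r x z)"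
proof -
  have "preorder_on (P - {x}) (quotient_order P r x z)"
  proof (rule preorder_onI)
    fix a b c
    assume "(a, b) \<in> quotient_order P r x z" "(b, c) \<in> quotient_order P r x z"
    then show "(a, c) \<in> quotient_order P r x z"
      unfolding quotient_order_def by (blast intro: r_trans)
  qed (auto simp: quotient_order_def r_refl)
  moreover have "a = b" if ab: "(a, b) \<in> quotient_order P r x z" "(b, a) \<in> quotient_order P r x z" for a b
  proof -
    have ne: "a \<noteq> x" "b \<noteq> x" and
      "(a, b) \<in> r \<or> (a, z) \<in> r \<and> (x, b) \<in> r" "(b, a) \<in> r \<or> (b, z) \<in> r \<and> (x, a) \<in> r"
      using ab by (auto simp: quotient_order_def)
    then consider "(a, b) \<in> r" "(b, a) \<in> r" | "(x, a) \<in> r" "(a, z) \<in> r" "(x, b) \<in> r" "(b, z) \<in> r"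
      by (blast intro: r_trans)
    then show ?thesis
    proof cases
      case 2
      then show ?thesis
        using mergeable_between[OF z, of a] mergeable_between[OF z, of b] ne by simp
    qed (rule r_antisym)
  qed
  ultimately show ?thesis
    unfolding partial_order_on_def antisym_def by blast
qed

text \<open>Correspondence theorem for the quotient: a preorder in which \<open>x\<close> and
  \<open>z\<close> are equivalent is determined by its restriction to \<open>P - {x}\<close>, and
  the restrictions that occur are the preorders containing the quotient order.\<close>

lemma congruences_above_merge:
  assumes z: "z \<in> P - {x}"
  shows "{w \<in> congruences P r. least_merge P x z \<subseteq> w} =
    pull_rel P x z ` congruences (P - {x}) (quotient_order P r x z)" (is "?L = ?R")
proof (intro subset_antisym subsetI)
  fix w assume "w \<in> ?L"
  then obtain t where t: "w = t \<inter> t\<inverse>" "preorder_on P t" "r \<subseteq> t" and xz: "(x, z) \<in> t" "(z, x) \<in> t"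
    by (auto simp: congruences_def least_merge_def)
  have tP: "t \<subseteq> P \<times> P" and tr: "\<And>a b c. (a, b) \<in> t \<Longrightarrow> (b, c) \<in> t \<Longrightarrow> (a, c) \<in> t"
    and tref: "\<And>a. a \<in> P \<Longrightarrow> (a, a) \<in> t"
    using t(2) by (auto elim: preorder_onE)
  define u where "u = t \<inter> (P - {x}) \<times> (P - {x})"
  have "preorder_on (P - {x}) u"
  proof (rule preorder_onI)
    fix a b c
    assume "(a, b) \<in> u" "(b, c) \<in> u"
    then show "(a, c) \<in> u"
      unfolding u_def by (blast intro: tr)
  qed (auto simp: u_def tref)
  moreover have "quotient_order P r x z \<subseteq> u"
  proof (rule subrelI)
    fix a b
    assume "(a, b) \<in> quotient_order P r x z"
    then have ab: "a \<in> P - {x}" "b \<in> P - {x}" "(a, b) \<in> t \<or> (a, z) \<in> t \<and> (x, b) \<in> t"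
      using t(3) by (auto simp: quotient_order_def)
    then have "(a, b) \<in> t"
      using tr[of a z b] tr[OF xz(2), of b] by blast
    with ab show "(a, b) \<in> u" by (simp add: u_def)
  qed
  ultimately have "u \<inter> u\<inverse> \<in> congruences (P - {x}) (quotient_order P r x z)"
    by (auto simp: congruences_def)
  moreover have "w = pull_rel P x z (u \<inter> u\<inverse>)"
  proof -
    \<comment> \<open>\<open>p\<close> chooses representatives. Each element is equivalent to its
      representative under \<open>t\<close>, so \<open>t\<close> can be read off from
      \<open>u\<close>.\<close>
    define p where "p a = (if a = x then z else a)" for a
    have p: "(a, p a) \<in> t" "(p a, a) \<in> t" "p a \<in> P - {x}" if "a \<in> P" for a
      using that xz z tref by (auto simp: p_def)
    have iff: "(p a, p b) \<in> t \<longleftrightarrow> (a, b) \<in> t" if "a \<in> P" "b \<in> P" for a b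
      using tr[OF tr[OF p(1)[OF that(1)]] p(2)[OF that(2)]]
        tr[OF tr[OF p(2)[OF that(1)]] p(1)[OF that(2)]] by blast
    have "(a, b) \<in> w \<longleftrightarrow> (a, b) \<in> pull_rel P x z (u \<inter> u\<inverse>)" for a b
    proof (cases "a \<in> P \<and> b \<in> P")
      case True
      then show ?thesis
        using iff[of a b] iff[of b a] p(3)[of a] p(3)[of b]
        unfolding t(1) pull_rel_def u_def by (simp add: p_def)
    next
      case False
      then show ?thesis
        using tP unfolding t(1) pull_rel_def by auto
    qed
    then show ?thesis by auto
  qed
  ultimately show "w \<in> ?R" by blast
next
  fix w assume "w \<in> ?R"
  then obtain u where u: "preorder_on (P - {x}) u" "quotient_order P r x z \<subseteq> u"
    "w = pull_rel P x z (u \<inter> u\<inverse>)"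
    by (auto simp: congruences_def)
  have uref: "\<And>a. a \<in> P - {x} \<Longrightarrow> (a, a) \<in> u"
    and utr: "\<And>a b c. (a, b) \<in> u \<Longrightarrow> (b, c) \<in> u \<Longrightarrow> (a, c) \<in> u"
    using u(1) by (auto elim: preorder_onE)
  let ?t = "pull_rel P x z u"
  have "preorder_on P ?t"
  proof (rule preorder_onI)
    fix a b c
    assume "(a, b) \<in> ?t" "(b, c) \<in> ?t"
    then show "(a, c) \<in> ?t"
      unfolding pull_rel_def by (blast intro: utr)
  qed (use z uref in \<open>auto simp: pull_rel_def\<close>)
  moreover have "r \<subseteq> ?t"
  proof (rule subrelI)
    fix a b assume ab: "(a, b) \<in> r"
    \<comment> \<open>If \<open>a = x\<close>, the detour \<open>z \<le> z\<close>,
      \<open>x \<le> b\<close> provides the pair; \<open>b = x\<close> forces \<open>a = x\<close>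
      by minimality.\<close>
    have "(if a = x then z else a, if b = x then z else b) \<in> quotient_order P r x z"
      using ab rP[OF ab] z min r_refl by (auto simp: quotient_order_def)
    with u(2) rP[OF ab] show "(a, b) \<in> ?t" by (auto simp: pull_rel_def)
  qed
  moreover have "w = ?t \<inter> ?t\<inverse>"
    unfolding u(3) by (auto simp: pull_rel_def)
  moreover have "least_merge P x z \<subseteq> w"
    unfolding u(3) using z uref x by (auto simp: least_merge_def pull_rel_def)
  ultimately show "w \<in> ?L"
    by (auto simp: congruences_def)
qed

text \<open>An element strictly between would be forced into the block of \<open>x\<close> and
  \<open>z\<close>. If there is none, the quotient is a poset, its equality is a congruence, and the
  preimage of equality is the merge.\<close>

lemma least_merge_congruence:
  assumes z: "z \<in> P - {x}"
  shows "least_merge P x z \<in> congruences P r \<longleftrightarrow> z \<in> mergeable P r x"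
proof
  assume "least_merge P x z \<in> congruences P r"
  then obtain t where t: "least_merge P x z = t \<inter> t\<inverse>" "preorder_on P t" "r \<subseteq> t"
    by (auto simp: congruences_def)
  have tr: "\<And>a b c. (a, b) \<in> t \<Longrightarrow> (b, c) \<in> t \<Longrightarrow> (a, c) \<in> t"
    using t(2) by (auto elim: preorder_onE)
  have zx: "(z, x) \<in> t" using t(1) by (auto simp: least_merge_def)
  have "c = x \<or> c = z" if "(x, c) \<in> r" "(c, z) \<in> r" for c
  proof -
    have "(x, c) \<in> t \<inter> t\<inverse>"
      using that t(3) tr[OF _ zx, of c] by auto
    then show ?thesis
      unfolding t(1)[symmetric] by (auto simp: least_merge_def)
  qed
  with z show "z \<in> mergeable P r x" by (auto simp: mergeable_def)
next
  assume m: "z \<in> mergeable P r x"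
  let ?q = "quotient_order P r x z"
  have po': "partial_order_on (P - {x}) ?q"
    by (rule partial_order_quotient_order[OF m])
  have "?q \<inter> ?q\<inverse> = Id_on (P - {x})"
  proof (intro subset_antisym subrelI)
    fix a b assume "(a, b) \<in> ?q \<inter> ?q\<inverse>"
    then show "(a, b) \<in> Id_on (P - {x})"
      using partial_order_onD(3,4)[OF po'] by (auto dest: antisymD)
  next
    fix a b assume "(a, b) \<in> Id_on (P - {x})"
    then show "(a, b) \<in> ?q \<inter> ?q\<inverse>"
      using refl_onD[OF partial_order_onD(1)[OF po']] by auto
  qed
  then have "Id_on (P - {x}) \<in> congruences (P - {x}) ?q"
    using po' by (auto simp: congruences_def partial_order_on_def)
  moreover have "pull_rel P x z (Id_on (P - {x})) = least_merge P x z"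
    by (rule pull_rel_Id_on[OF z])
  ultimately have "least_merge P x z \<in> pull_rel P x z ` congruences (P - {x}) ?q"
    by force
  then show "least_merge P x z \<in> congruences P r"
    unfolding congruences_above_merge[OF z, symmetric] by blast
qed

text \<open>Taking preimages sends equality to the merge and the full relation to the full relation,
  so the proper parts correspond. This identifies the link of the atom with the chains for the
  smaller poset.\<close>

lemma proper_congruences_above_merge:
  assumes z: "z \<in> P - {x}"
  shows "{w \<in> proper_congruences P r. least_merge P x z \<subset> w} =
    pull_rel P x z ` proper_congruences (P - {x}) (quotient_order P r x z)"
proof -
  let ?B = "{Id_on (P - {x}), (P - {x}) \<times> (P - {x})}"
  have "inj_on (pull_rel P x z) (Pow ((P - {x}) \<times> (P - {x})))"
  proof (rule inj_onI)
    fix \<rho> \<sigma>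
    assume \<rho>: "\<rho> \<in> Pow ((P - {x}) \<times> (P - {x}))" and \<sigma>: "\<sigma> \<in> Pow ((P - {x}) \<times> (P - {x}))"
      and eq: "pull_rel P x z \<rho> = pull_rel P x z \<sigma>"
    show "\<rho> = \<sigma>"
      using pull_rel_subset_iff[OF PowD[OF \<rho>], of z \<sigma>] pull_rel_subset_iff[OF PowD[OF \<sigma>], of z \<rho>]
      unfolding eq by simp
  qed
  moreover have "congruences (P - {x}) (quotient_order P r x z) \<union> ?B \<subseteq> Pow ((P - {x}) \<times> (P - {x}))"
    using congruences_equiv[of _ "P - {x}"] unfolding equiv_def by blast
  ultimately have "inj_on (pull_rel P x z) (congruences (P - {x}) (quotient_order P r x z) \<union> ?B)"
    by (rule inj_on_subset)
  then have "pull_rel P x z ` (congruences (P - {x}) (quotient_order P r x z) - ?B) =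
      pull_rel P x z ` congruences (P - {x}) (quotient_order P r x z) - pull_rel P x z ` ?B"
    by (rule inj_on_image_set_diff) auto
  also have "pull_rel P x z ` ?B = {least_merge P x z, P \<times> P}"
  proof -
    have "pull_rel P x z (Id_on (P - {x})) = least_merge P x z"
      by (rule pull_rel_Id_on[OF z])
    moreover have "pull_rel P x z ((P - {x}) \<times> (P - {x})) = P \<times> P"
      using z x by (auto simp: pull_rel_def)
    ultimately show ?thesis by simp
  qed
  also have "pull_rel P x z ` congruences (P - {x}) (quotient_order P r x z) =
      {w \<in> congruences P r. least_merge P x z \<subseteq> w}"
    using congruences_above_merge[OF z] by simp
  also have "\<dots> - {least_merge P x z, P \<times> P} = {w \<in> proper_congruences P r. least_merge P x z \<subset> w}"
  proof -
    have "\<not> least_merge P x z \<subset> Id_on P"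
      by (auto simp: least_merge_def)
    then show ?thesis by (auto simp: proper_congruences_def)
  qed
  finally show ?thesis by (simp add: proper_congruences_def)
qed

section \<open>The coatom splitting off a minimal element, and its complements\<close>

definition singleton_coatom :: "'a rel" where
  "singleton_coatom = {x} \<times> {x} \<union> (P - {x}) \<times> (P - {x})"

lemma singleton_coatom_congruence: "singleton_coatom \<in> congruences P r"
proof -
  \<comment> \<open>The preorder induced by the map onto a two-element chain that sends only
    \<open>x\<close> to the bottom.\<close>
  define t where "t = {(a, b). a \<in> P \<and> b \<in> P \<and> (a = x \<or> b \<noteq> x)}"
  have "preorder_on P t"
    by (rule preorder_onI) (auto simp: t_def)
  moreover have "r \<subseteq> t" using rP min by (auto simp: t_def)
  moreover have "singleton_coatom = t \<inter> t\<inverse>"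
    using x by (auto simp: t_def singleton_coatom_def)
  ultimately show ?thesis by (auto simp: congruences_def)
qed

text \<open>Away from \<open>x\<close> the relation is equality, and two further members of the
  class of \<open>x\<close> would be related to each other. Hence that class gains exactly one
  \<open>z\<close>.\<close>

lemma meet_coatom_Id:
  assumes w: "equiv P w" "w \<noteq> Id_on P" and meet: "w \<inter> singleton_coatom = Id_on P"
  obtains z where "z \<in> P - {x}" "w = least_merge P x z"
proof -
  have wP: "w \<subseteq> P \<times> P" and sym: "\<And>a b. (a, b) \<in> w \<Longrightarrow> (b, a) \<in> w"
    and tr: "\<And>a b c. (a, b) \<in> w \<Longrightarrow> (b, c) \<in> w \<Longrightarrow> (a, c) \<in> w" and ref: "Id_on P \<subseteq> w"
    using w(1) unfolding equiv_def refl_on_def sym_def trans_def by blast+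
  have diag: "a = b" if "(a, b) \<in> w" "a \<noteq> x" "b \<noteq> x" for a b
  proof -
    have "(a, b) \<in> w \<inter> singleton_coatom"
      using that wP by (auto simp: singleton_coatom_def)
    then show ?thesis using meet by auto
  qed
  obtain a b where ab: "(a, b) \<in> w" "a \<noteq> b"
    using w(2) ref wP by fast
  then obtain z where z: "(x, z) \<in> w" "z \<noteq> x"
    using diag sym by metis
  have zx: "(z, x) \<in> w" by (rule sym[OF z(1)])
  have "w = least_merge P x z"
  proof (rule subset_antisym)
    show "least_merge P x z \<subseteq> w"
      unfolding least_merge_def using ref z zx by blast
    show "w \<subseteq> least_merge P x z"
    proof (rule subrelI)
      fix a b assume ab: "(a, b) \<in> w"
      have "b = z" if "a = x" "b \<noteq> x"
        using diag[of z b] tr[OF sym[OF z(1)], of b] ab that z by auto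
      moreover have "a = z" if "b = x" "a \<noteq> x"
        using diag[of a z] tr[OF ab, of z] that z by auto
      ultimately show "(a, b) \<in> least_merge P x z"
        using ab diag wP by (auto simp: least_merge_def)
    qed
  qed
  with z wP that show thesis by blast
qed

lemma subset_least_merge:
  assumes w: "equiv P w" "w \<noteq> Id_on P" and sub: "w \<subseteq> least_merge P x z"
  shows "w = least_merge P x z"
proof -
  have "w \<subseteq> P \<times> P" and sym: "\<And>a b. (a, b) \<in> w \<Longrightarrow> (b, a) \<in> w" and ref: "Id_on P \<subseteq> w"
    using w(1) unfolding equiv_def refl_on_def sym_def by blast+
  obtain a b where "(a, b) \<in> w" "(a, b) \<notin> Id_on P"
    using w(2) ref by auto
  then have "(x, z) \<in> w" "(z, x) \<in> w"
    using sub sym by (auto simp: least_merge_def)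
  with ref sub show ?thesis by (auto simp: least_merge_def)
qed

end

section \<open>Counting cyclic extensions\<close>

text \<open>Linear extensions listed by increasing value. The condition is negative because
  incomparable elements may come in either order.\<close>

definition linear_arrangements :: "'a set \<Rightarrow> 'a rel \<Rightarrow> 'a list set" where
  "linear_arrangements P r = {xs. distinct xs \<and> set xs = P \<and> sorted_wrt (\<lambda>a b. (b, a) \<notin> r) xs}"

text \<open>Cyclic extensions, encoded as lists by cutting them open at \<open>p\<close>.\<close>

definition cyclic_arrangements :: "'a set \<Rightarrow> 'a rel \<Rightarrow> 'a \<Rightarrow> 'a list set" where
  "cyclic_arrangements P r p =
     {xs. \<exists>us vs. xs = us @ vs \<and> xs \<noteq> [] \<and> hd xs = p \<and> vs @ us \<in> linear_arrangements P r}"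

lemma cyclic_arrangementsI:
  assumes "vs @ p # us \<in> linear_arrangements P r"
  shows "p # us @ vs \<in> cyclic_arrangements P r p"
proof -
  have "p # us @ vs = (p # us) @ vs \<and> p # us @ vs \<noteq> [] \<and> hd (p # us @ vs) = p
      \<and> vs @ p # us \<in> linear_arrangements P r"
    using assms by simp
  then show ?thesis unfolding cyclic_arrangements_def by blast
qed

lemma finite_cyclic_arrangements:
  assumes "finite P"
  shows "finite (cyclic_arrangements P r p)"
proof (rule finite_subset)
  show "cyclic_arrangements P r p \<subseteq> {xs. set xs \<subseteq> P \<and> length xs = card P}"
  proof
    fix xs assume "xs \<in> cyclic_arrangements P r p"
    then obtain us vs where "xs = us @ vs" "distinct (vs @ us)" "set (vs @ us) = P"
      unfolding cyclic_arrangements_def linear_arrangements_def by blast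
    then show "xs \<in> {xs. set xs \<subseteq> P \<and> length xs = card P}"
      using distinct_card[of "vs @ us"] by auto
  qed
  show "finite {xs. set xs \<subseteq> P \<and> length xs = card P}"
    by (rule finite_lists_length_eq[OF assms])
qed

lemma card_quotient_kernel:
  "card (A // {(f, g). f \<in> A \<and> g \<in> A \<and> \<phi> f = \<phi> g}) = card (\<phi> ` A)"
proof -
  have "A // {(f, g). f \<in> A \<and> g \<in> A \<and> \<phi> f = \<phi> g} = (\<lambda>y. {g \<in> A. \<phi> g = y}) ` (\<phi> ` A)"
  proof -
    have "{(f, g). f \<in> A \<and> g \<in> A \<and> \<phi> f = \<phi> g} `` {f} = {g \<in> A. \<phi> g = \<phi> f}" if "f \<in> A" for f
      using that by auto
    then show ?thesis unfolding quotient_def by auto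
  qed
  moreover have "inj_on (\<lambda>y. {g \<in> A. \<phi> g = y}) (\<phi> ` A)"
  proof (rule inj_onI)
    fix u v assume u: "u \<in> \<phi> ` A" and eq: "{g \<in> A. \<phi> g = u} = {g \<in> A. \<phi> g = v}"
    then obtain g where "g \<in> {g \<in> A. \<phi> g = u}" by blast
    then have "\<phi> g = u" "\<phi> g = v" using eq by auto
    then show "u = v" by simp
  qed
  ultimately show ?thesis by (simp add: card_image)
qed

section \<open>Linear extensions as lists, cyclic extensions as orbits\<close>

definition value_list :: "'a set \<Rightarrow> ('a \<Rightarrow> nat) \<Rightarrow> 'a list" where
  "value_list P f = map (inv_into P f) [0..<card P]"

lemma length_value_list [simp]: "length (value_list P f) = card P"
  by (simp add: value_list_def)

lemma linear_extension_inv: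
  assumes "f \<in> linear_extensions P r"
  shows "a \<in> P \<Longrightarrow> f a < card P" and "a \<in> P \<Longrightarrow> inv_into P f (f a) = a"
    and "k < card P \<Longrightarrow> inv_into P f k \<in> P" and "k < card P \<Longrightarrow> f (inv_into P f k) = k"
proof -
  have b: "bij_betw f P {0..<card P}" using assms by (simp add: linear_extensions_def)
  show "a \<in> P \<Longrightarrow> f a < card P" using bij_betwE[OF b] by auto
  show "a \<in> P \<Longrightarrow> inv_into P f (f a) = a" using b by (simp add: bij_betw_def)
  show "k < card P \<Longrightarrow> inv_into P f k \<in> P"
    using b by (metis atLeastLessThan_iff bij_betw_def inv_into_into zero_le)
  show "k < card P \<Longrightarrow> f (inv_into P f k) = k"
    using b by (metis atLeastLessThan_iff bij_betw_def f_inv_into_f zero_le)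
qed

lemma value_list_linear_arrangement:
  assumes f: "f \<in> linear_extensions P r"
  shows "value_list P f \<in> linear_arrangements P r"
proof -
  note inv = linear_extension_inv[OF f]
  have "distinct (value_list P f)"
    unfolding value_list_def distinct_map
    using inv(4) by (auto intro!: inj_on_inverseI[of _ f])
  moreover have "set (value_list P f) = P"
  proof -
    have "a \<in> inv_into P f ` {0..<card P}" if "a \<in> P" for a
      using inv(1,2)[OF that] by (metis atLeastLessThan_iff image_eqI zero_le)
    then show ?thesis
      using inv(3) by (auto simp: value_list_def)
  qed
  moreover have "sorted_wrt (\<lambda>a b. (b, a) \<notin> r) (value_list P f)"
    unfolding sorted_wrt_iff_nth_less
  proof (intro allI impI notI)
    fix i j assume ij: "i < j" "j < length (value_list P f)"
      and "(value_list P f ! j, value_list P f ! i) \<in> r"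
    then have "(inv_into P f j, inv_into P f i) \<in> r"
      by (simp add: value_list_def)
    moreover have "monotone_on P (\<lambda>x y. (x, y) \<in> r) (\<le>) f"
      using f by (simp add: linear_extensions_def)
    ultimately have "f (inv_into P f j) \<le> f (inv_into P f i)"
      using inv(3)[of i] inv(3)[of j] ij monotone_onD by fastforce
    then show False using inv(4) ij by simp
  qed
  ultimately show ?thesis by (simp add: linear_arrangements_def)
qed

lemma value_list_surj:
  assumes ys: "ys \<in> linear_arrangements P r"
  obtains f where "f \<in> linear_extensions P r" "value_list P f = ys"
proof -
  have d: "distinct ys" "set ys = P" and srt: "sorted_wrt (\<lambda>a b. (b, a) \<notin> r) ys"
    using ys by (auto simp: linear_arrangements_def)
  have len: "length ys = card P" using d distinct_card by fastforce
  have b: "bij_betw ((!) ys) {0..<card P} P"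
    using bij_betw_nth[OF d(1)] d(2) len by (simp add: atLeast0LessThan)
  define f where "f = restrict (inv_into {0..<card P} ((!) ys)) P"
  have bf: "bij_betw f P {0..<card P}"
    unfolding f_def using bij_betw_inv_into[OF b] by simp
  have fnth: "f (ys ! i) = i" if "i < card P" for i
    using that b d(2) len nth_mem[of i ys] by (auto simp: f_def bij_betw_def)
  have nthf: "ys ! f a = a" "f a < card P" if "a \<in> P" for a
  proof -
    obtain i where "i < card P" "a = ys ! i" using \<open>a \<in> P\<close> d(2) len by (metis in_set_conv_nth)
    then show "ys ! f a = a" "f a < card P" using fnth by auto
  qed
  have "monotone_on P (\<lambda>x y. (x, y) \<in> r) (\<le>) f"
  proof (rule monotone_onI)
    fix a b assume ab: "a \<in> P" "b \<in> P" "(a, b) \<in> r"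
    show "f a \<le> f b"
    proof (rule ccontr)
      assume "\<not> f a \<le> f b"
      then have "(ys ! f a, ys ! f b) \<notin> r"
        using sorted_wrt_nth_less[OF srt, of "f b" "f a"] nthf ab len by simp
      with nthf ab show False by simp
    qed
  qed
  then have f: "f \<in> linear_extensions P r"
    using bf by (simp add: linear_extensions_def f_def)
  moreover have "value_list P f = ys"
  proof (rule nth_equalityI)
    show "value_list P f ! i = ys ! i" if "i < length (value_list P f)" for i
    proof -
      have i: "i < card P" using that by simp
      have "inv_into P f i = ys ! i"
        using linear_extension_inv(2)[OF f, of "ys ! i"] fnth[OF i] d(2) len i nth_mem by metis
      with i show ?thesis by (simp add: value_list_def)
    qed
  qed (simp add: len)
  ultimately show thesis by (rule that)
qed

definition action_orbit :: "'a set \<Rightarrow> 'a \<Rightarrow> ('a \<Rightarrow> nat) \<Rightarrow> 'a list" where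
  "action_orbit P p f = map (\<lambda>k. cyclic_action P f (p, k)) [0..<card P]"

lemma action_orbit_rotate:
  assumes "p \<in> P"
  shows "action_orbit P p f = rotate (f p) (value_list P f)"
  using assms by (intro nth_equalityI)
    (auto simp: action_orbit_def cyclic_action_def nth_rotate value_list_def)

text \<open>The action is transitive, so the orbit of one point, listed in order, determines it: if
  \<open>a\<close> is \<open>p\<close> shifted by \<open>k\<close>, then \<open>a\<close> shifted by
  \<open>j\<close> is \<open>p\<close> shifted by \<open>k + j\<close>.\<close>

lemma cyclic_action_eq_iff:
  assumes f: "f \<in> linear_extensions P r" and g: "g \<in> linear_extensions P r" and p: "p \<in> P"
  shows "cyclic_action P f = cyclic_action P g \<longleftrightarrow> action_orbit P p f = action_orbit P p g"
proof
  assume "action_orbit P p f = action_orbit P p g"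
  then have orb: "action_orbit P p f ! k = action_orbit P p g ! k" for k by simp
  have "action_orbit P p h ! k = inv_into P h ((h p + k) mod card P)" if "k < card P" for h k
    using that p by (simp add: action_orbit_def cyclic_action_def)
  then have eq: "inv_into P f ((f p + k) mod card P) = inv_into P g ((g p + k) mod card P)"
    if "k < card P" for k
    using that orb[of k] by simp
  show "cyclic_action P f = cyclic_action P g"
  proof
    fix y :: "'a \<times> nat"
    obtain a j where y: "y = (a, j)" by (cases y)
    show "cyclic_action P f y = cyclic_action P g y"
    proof (cases "a \<in> P \<and> j < card P")
      case True
      then have a: "a \<in> P" by simp
      then have n: "0 < card P" using linear_extension_inv(1)[OF f] by fastforce
      \<comment> \<open>The position of \<open>a\<close> relative to \<open>p\<close>, that is
        \<open>f a - f p\<close> modulo \<open>card P\<close>; subtracting from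
        \<open>card P\<close> first avoids truncated subtraction.\<close>
      define k where "k = (f a + (card P - f p)) mod card P"
      have k: "k < card P" using n by (simp add: k_def)
      have fp: "f p < card P" using linear_extension_inv(1)[OF f p] .
      have "(f p + k) mod card P = (f p + (f a + (card P - f p))) mod card P"
        unfolding k_def by (simp add: mod_add_right_eq)
      also have "f p + (f a + (card P - f p)) = f a + card P" using fp by simp
      finally have fk: "(f p + k) mod card P = f a"
        using linear_extension_inv(1)[OF f a] by simp
      have "a = inv_into P g ((g p + k) mod card P)"
        using eq[OF k] linear_extension_inv(2)[OF f a] unfolding fk by simp
      then have gk: "g a = (g p + k) mod card P"
        using linear_extension_inv(4)[OF g, of "(g p + k) mod card P"] n by simp
      have "(f a + j) mod card P = (f p + (k + j) mod card P) mod card P"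
        unfolding fk[symmetric] by (simp add: mod_simps add.assoc)
      moreover have "(g a + j) mod card P = (g p + (k + j) mod card P) mod card P"
        unfolding gk by (simp add: mod_simps add.assoc)
      ultimately show ?thesis
        using True eq[of "(k + j) mod card P"] n unfolding y cyclic_action_def by simp
    qed (auto simp: y cyclic_action_def)
  qed
qed (simp add: action_orbit_def)

text \<open>The orbit of \<open>p\<close> is the list of \<open>f\<close> rotated so that it starts
  with \<open>p\<close>. Since \<open>p\<close> is arbitrary, the cut can be made at
  \<open>x\<close> in \<open>P\<close> and at \<open>z\<close> in the quotient.\<close>

lemma num_cyclic_extensions_eq:
  assumes p: "p \<in> P"
  shows "num_cyclic_extensions P r = card (cyclic_arrangements P r p)"
proof -
  have "cyclic_equivalence P r = {(f, g). f \<in> linear_extensions P r \<and> g \<in> linear_extensions P r \<and>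
      action_orbit P p f = action_orbit P p g}"
    unfolding cyclic_equivalence_def using cyclic_action_eq_iff[OF _ _ p] by blast
  then have "num_cyclic_extensions P r = card (action_orbit P p ` linear_extensions P r)"
    unfolding num_cyclic_extensions_def cyclic_extensions_def by (simp add: card_quotient_kernel)
  also have "action_orbit P p ` linear_extensions P r = cyclic_arrangements P r p"
  proof (intro subset_antisym subsetI)
    fix xs assume "xs \<in> action_orbit P p ` linear_extensions P r"
    then obtain f where f: "f \<in> linear_extensions P r" and xs: "xs = rotate (f p) (value_list P f)"
      using action_orbit_rotate[OF p] by blast
    have fp: "f p < card P" using linear_extension_inv(1)[OF f p] .
    let ?v = "value_list P f"
    have "xs = drop (f p) ?v @ take (f p) ?v"
      unfolding xs using fp by (simp add: rotate_drop_take)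
    moreover have "take (f p) ?v @ drop (f p) ?v \<in> linear_arrangements P r"
      using value_list_linear_arrangement[OF f] by simp
    moreover have "xs \<noteq> []" using fp unfolding xs by (auto simp flip: length_0_conv)
    moreover have "hd xs = p"
    proof -
      have "hd xs = ?v ! f p"
        unfolding xs using fp by (subst hd_rotate_conv_nth) (auto simp flip: length_0_conv)
      also have "\<dots> = p"
        using fp linear_extension_inv(2)[OF f p] by (simp add: value_list_def)
      finally show ?thesis .
    qed
    ultimately show "xs \<in> cyclic_arrangements P r p"
      unfolding cyclic_arrangements_def by blast
  next
    fix xs assume "xs \<in> cyclic_arrangements P r p"
    then obtain us vs where xs: "xs = us @ vs" "xs \<noteq> []" "hd xs = p"
      and "vs @ us \<in> linear_arrangements P r"
      unfolding cyclic_arrangements_def by blast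
    then obtain f where f: "f \<in> linear_extensions P r" and v: "value_list P f = vs @ us"
      using value_list_surj by metis
    have len: "length (vs @ us) = card P"
      using v length_value_list by metis
    have ne: "vs @ us \<noteq> []" using xs by auto
    then have n: "0 < card P" using len by (metis length_greater_0_conv)
    have rot: "xs = rotate (length vs) (vs @ us)"
      unfolding xs by (simp add: rotate_append)
    \<comment> \<open>For empty \<open>us\<close> the length of \<open>vs\<close> is
      \<open>card P\<close> while \<open>p\<close> stands at position 0, hence the reduction modulo
      \<open>card P\<close>.\<close>
    have "p = (vs @ us) ! (length vs mod card P)"
      using hd_rotate_conv_nth[OF ne, of "length vs"] xs(3) unfolding rot len by simp
    also have "\<dots> = inv_into P f (length vs mod card P)"
      unfolding v[symmetric] using n by (simp add: value_list_def)
    finally have "f p = length vs mod card P"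
      using linear_extension_inv(4)[OF f] n by simp
    then have "xs = rotate (f p) (value_list P f)"
      unfolding v rot len[symmetric] by (metis rotate_conv_mod)
    then show "xs \<in> action_orbit P p ` linear_extensions P r"
      using f action_orbit_rotate[OF p] by (metis image_eqI)
  qed
  finally show ?thesis .
qed

section \<open>The recursion for cyclic extensions\<close>

context minimal_element
begin

text \<open>A relation present only in the quotient order comes from \<open>b \<le> z\<close> and
  \<open>x \<le> a\<close>. It respects the list, since \<open>a\<close> does not precede
  \<open>x\<close> and \<open>b\<close> does not follow \<open>z\<close>. Conversely,
  \<open>x\<close> can be inserted before \<open>z\<close>: nothing else lies below
  \<open>x\<close>, and whatever is above \<open>x\<close> is above \<open>z\<close> in the
  quotient.\<close>

lemma linear_arrangement_split:
  assumes "z \<noteq> x"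
  shows "vs @ x # z # us \<in> linear_arrangements P r \<longleftrightarrow>
    z \<in> mergeable P r x \<and> vs @ z # us \<in> linear_arrangements (P - {x}) (quotient_order P r x z)"
    (is "?L \<longleftrightarrow> ?R")
proof
  assume ?L
  then have d: "distinct (vs @ x # z # us)" and P: "set (vs @ x # z # us) = P"
    and s: "sorted_wrt (\<lambda>a b. (b, a) \<notin> r) (vs @ x # z # us)"
    by (auto simp: linear_arrangements_def)
  have vx: "(x, a) \<notin> r" if "a \<in> set vs" for a
    using s that by (simp add: sorted_wrt_append)
  have zu: "(b, z) \<notin> r" if "b \<in> set us" for b
    using s that by (simp add: sorted_wrt_append)
  have "z \<in> mergeable P r x"
    using assms P vx zu unfolding mergeable_def by auto
  moreover have "sorted_wrt (\<lambda>a b. (b, a) \<notin> quotient_order P r x z) (vs @ z # us)"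
  proof -
    have q: "(b, a) \<notin> quotient_order P r x z"
      if "(b, a) \<notin> r" "a \<in> set vs \<or> b \<in> set us" for a b
      using that vx zu by (auto simp: quotient_order_def)
    have "sorted_wrt (\<lambda>a b. (b, a) \<notin> quotient_order P r x z) vs"
      by (rule sorted_wrt_mono_rel[of _ "\<lambda>a b. (b, a) \<notin> r"]) (use q s in \<open>auto simp: sorted_wrt_append\<close>)
    moreover have "sorted_wrt (\<lambda>a b. (b, a) \<notin> quotient_order P r x z) us"
      by (rule sorted_wrt_mono_rel[of _ "\<lambda>a b. (b, a) \<notin> r"]) (use q s in \<open>auto simp: sorted_wrt_append\<close>)
    ultimately show ?thesis
      using q s by (auto simp: sorted_wrt_append)
  qed
  moreover have "distinct (vs @ z # us)" "set (vs @ z # us) = P - {x}"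
    using d P by auto
  ultimately show ?R by (simp add: linear_arrangements_def)
next
  assume R: ?R
  then have d: "distinct (vs @ z # us)" and P: "set (vs @ z # us) = P - {x}"
    and s: "sorted_wrt (\<lambda>a b. (b, a) \<notin> quotient_order P r x z) (vs @ z # us)"
    by (auto simp: linear_arrangements_def)
  have r: "(b, a) \<notin> r"
    if "(b, a) \<notin> quotient_order P r x z" "a \<in> set (vs @ z # us)" "b \<in> set (vs @ z # us)" for a b
    using that unfolding P by (auto simp: quotient_order_def)
  have s': "sorted_wrt (\<lambda>a b. (b, a) \<notin> r) (vs @ z # us)"
    by (rule sorted_wrt_mono_rel[OF _ s]) (rule r)
  have "(x, a) \<notin> r" if "a \<in> set vs" for a
  proof -
    have "(z, a) \<notin> quotient_order P r x z"
      using s that by (simp add: sorted_wrt_append)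
    moreover have "a \<in> P - {x}" "z \<in> P - {x}"
      using that P by auto
    ultimately show ?thesis
      using r_refl[of z] by (auto simp: quotient_order_def)
  qed
  moreover have "(b, x) \<notin> r" if "b \<in> set (z # us)" for b
    using that min P by auto
  ultimately have "sorted_wrt (\<lambda>a b. (b, a) \<notin> r) (vs @ x # z # us)"
    using s' by (simp add: sorted_wrt_append)
  moreover have "distinct (vs @ x # z # us)" "set (vs @ x # z # us) = P"
    using d P x by auto
  ultimately show ?L by (simp add: linear_arrangements_def)
qed

text \<open>Cutting a cyclic order at \<open>x\<close>: if \<open>x\<close> is the last element of a linear extension, then,
  \<open>x\<close> being minimal, it may as well be moved to the front.\<close>

lemma cyclic_arrangements_rec:
  assumes "card P \<ge> 2"
  shows "cyclic_arrangements P r x = (\<Union>z\<in>mergeable P r x.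
    (#) x ` cyclic_arrangements (P - {x}) (quotient_order P r x z) z)"
proof (intro subset_antisym subsetI)
  fix xs assume "xs \<in> cyclic_arrangements P r x"
  then obtain us vs where xs: "xs = us @ vs" "xs \<noteq> []" "hd xs = x"
    and la: "vs @ us \<in> linear_arrangements P r"
    unfolding cyclic_arrangements_def by blast
  have d: "distinct (vs @ us)" and P: "set (vs @ us) = P"
    and s: "sorted_wrt (\<lambda>a b. (b, a) \<notin> r) (vs @ us)"
    using la by (auto simp: linear_arrangements_def)
  have "length xs = card P"
    using distinct_card[OF d] P xs(1) by simp
  then obtain z ws where ws: "xs = x # z # ws"
    using assms xs(2,3) by (cases xs; cases "tl xs") auto
  have zx: "z \<noteq> x" using d ws xs(1) by (metis distinct_append distinct_length_2_or_more inf_commute)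
  obtain us' vs' where us': "ws = us' @ vs'" "vs' @ x # z # us' \<in> linear_arrangements P r"
  proof (cases us)
    case Nil
    then show thesis using la xs ws by (intro that[of ws "[]"]) auto
  next
    case (Cons a us1)
    then have a: "a = x" using xs by simp
    show thesis
    proof (cases us1)
      case Nil
      then have vs: "vs = z # ws" using Cons xs(1) ws by simp
      have "x # z # ws \<in> linear_arrangements P r"
      proof -
        have "(b, x) \<notin> r" if "b \<in> set (z # ws)" for b
          using that min d unfolding vs Cons Nil a by auto
        then show ?thesis
          using d P s unfolding vs Cons Nil a linear_arrangements_def by (auto simp: sorted_wrt_append)
      qed
      then show thesis by (intro that[of ws "[]"]) auto
    next
      case (Cons b us2)
      then have "us = x # z # us2" "ws = us2 @ vs"
        using \<open>us = a # us1\<close> a xs(1) ws by auto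
      with la show thesis by (intro that[of us2 vs]) auto
    qed
  qed
  have z: "z \<in> mergeable P r x"
    and la': "vs' @ z # us' \<in> linear_arrangements (P - {x}) (quotient_order P r x z)"
    using linear_arrangement_split[OF zx, of vs' us'] us'(2) by auto
  have "z # ws \<in> cyclic_arrangements (P - {x}) (quotient_order P r x z) z"
    unfolding us'(1) by (rule cyclic_arrangementsI[OF la'])
  with z ws show "xs \<in> (\<Union>z\<in>mergeable P r x.
      (#) x ` cyclic_arrangements (P - {x}) (quotient_order P r x z) z)" by blast
next
  fix xs assume "xs \<in> (\<Union>z\<in>mergeable P r x.
      (#) x ` cyclic_arrangements (P - {x}) (quotient_order P r x z) z)"
  then obtain z ws where z: "z \<in> mergeable P r x" and xs: "xs = x # ws"
    and ws: "ws \<in> cyclic_arrangements (P - {x}) (quotient_order P r x z) z"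
    by blast
  have zx: "z \<noteq> x" using z by (auto simp: mergeable_def)
  obtain us vs where us: "ws = us @ vs" "ws \<noteq> []" "hd ws = z"
    and la: "vs @ us \<in> linear_arrangements (P - {x}) (quotient_order P r x z)"
    using ws unfolding cyclic_arrangements_def by blast
  obtain us' vs' where ws': "ws = z # us' @ vs'"
    and la':  "vs' @ z # us' \<in> linear_arrangements (P - {x}) (quotient_order P r x z)"
  proof (cases us)
    case Nil
    then show thesis using us la by (intro that[of "tl ws" "[]"]) (auto simp: neq_Nil_conv)
  next
    case (Cons a us1)
    then show thesis using us la by (intro that[of us1 vs]) auto
  qed
  have "vs' @ x # z # us' \<in> linear_arrangements P r"
    using linear_arrangement_split[OF zx, of vs' us'] z la' by simp
  from cyclic_arrangementsI[OF this] show "xs \<in> cyclic_arrangements P r x"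
    unfolding xs ws' by simp
qed

text \<open>The second entry of a list is the cyclic successor \<open>z\<close> of \<open>x\<close>,
  so the pieces of the recursion are disjoint.\<close>

lemma card_cyclic_arrangements_rec:
  assumes "finite P" "card P \<ge> 2"
  shows "card (cyclic_arrangements P r x) =
    (\<Sum>z\<in>mergeable P r x. num_cyclic_extensions (P - {x}) (quotient_order P r x z))"
proof -
  let ?C = "\<lambda>z. cyclic_arrangements (P - {x}) (quotient_order P r x z) z"
  have disj: "(#) x ` ?C z \<inter> (#) x ` ?C z' = {}" if "z \<noteq> z'" for z z'
    using that unfolding cyclic_arrangements_def by auto
  have "card (cyclic_arrangements P r x) = (\<Sum>z\<in>mergeable P r x. card ((#) x ` ?C z))"
    unfolding cyclic_arrangements_rec[OF assms(2)]
  proof (rule card_UN_disjoint)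
    show "finite (mergeable P r x)"
      using assms(1) by (simp add: mergeable_def)
    show "\<forall>z\<in>mergeable P r x. finite ((#) x ` ?C z)"
      using assms(1) by (intro ballI finite_imageI finite_cyclic_arrangements) simp
    show "\<forall>z\<in>mergeable P r x. \<forall>z'\<in>mergeable P r x. z \<noteq> z' \<longrightarrow>
        (#) x ` ?C z \<inter> (#) x ` ?C z' = {}"
      by (intro ballI impI disj)
  qed
  also have "\<dots> = (\<Sum>z\<in>mergeable P r x. card (?C z))"
    by (intro sum.cong refl card_image) simp
  also have "\<dots> = (\<Sum>z\<in>mergeable P r x. num_cyclic_extensions (P - {x}) (quotient_order P r x z))"
  proof (rule sum.cong[OF refl])
    fix z assume "z \<in> mergeable P r x"
    then have "z \<in> P - {x}" by (simp add: mergeable_def)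
    then show "card (?C z) = num_cyclic_extensions (P - {x}) (quotient_order P r x z)"
      by (simp add: num_cyclic_extensions_eq)
  qed
  finally show ?thesis .
qed

end

section \<open>Critical chains\<close>

lemma exists_minimal:
  assumes "finite P" "partial_order_on P r" "P \<noteq> {}"
  obtains x where "x \<in> P" "\<And>a. (a, x) \<in> r \<Longrightarrow> a = x"
proof -
  have rP: "r \<subseteq> P \<times> P" by (rule partial_order_onD(4)[OF assms(2)])
  have "finite r" by (rule finite_subset[OF rP]) (simp add: assms(1))
  then have "wf (r - Id)"
    using assms(2) by (rule partial_order_on_well_order_on)
  moreover obtain p where "p \<in> P" using assms(3) by blast
  ultimately obtain x where "x \<in> P" "\<And>y. (y, x) \<in> r - Id \<Longrightarrow> y \<notin> P"
    by (rule wfE_min) blast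
  with rP show thesis by (intro that[of x]) blast+
qed

context minimal_element
begin

lemma singleton_coatom_proper:
  assumes "card P \<ge> 3"
  shows "singleton_coatom \<in> proper_congruences P r"
proof -
  have "\<not> P \<subseteq> {x}" using assms card_mono[of "{x}" P] by auto
  then obtain a where a: "a \<in> P" "a \<noteq> x" by blast
  have "card {x, a} \<le> 2" by (simp add: card_insert_if)
  then have "\<not> P \<subseteq> {x, a}" using assms card_mono[of "{x, a}" P] by auto
  then obtain b where b: "b \<in> P" "b \<noteq> x" "b \<noteq> a" by blast
  have "(a, b) \<in> singleton_coatom" "(x, a) \<notin> singleton_coatom"
    using a b by (auto simp: singleton_coatom_def)
  then have "singleton_coatom \<noteq> Id_on P" "singleton_coatom \<noteq> P \<times> P"
    using a b x by auto
  then show ?thesis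
    using singleton_coatom_congruence by (simp add: proper_congruences_def)
qed

lemma least_merge_proper:
  assumes "card P \<ge> 3" "z \<in> mergeable P r x"
  shows "least_merge P x z \<in> proper_congruences P r"
proof -
  have z: "z \<in> P - {x}" using assms(2) by (simp add: mergeable_def)
  have "card {x, z} \<le> 2" by (simp add: card_insert_if)
  then have "\<not> P \<subseteq> {x, z}" using assms card_mono[of "{x, z}" P] by auto
  then obtain b where b: "b \<in> P" "b \<noteq> x" "b \<noteq> z" by blast
  have "(x, b) \<notin> least_merge P x z" "(x, z) \<in> least_merge P x z"
    using z b by (auto simp: least_merge_def)
  then have "least_merge P x z \<noteq> Id_on P" "least_merge P x z \<noteq> P \<times> P"
    using z b x by auto
  then show ?thesis
    using least_merge_congruence[OF z] assms(2) by (simp add: proper_congruences_def)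
qed

text \<open>If the meet were the bottom, \<open>w\<close> would merge \<open>x\<close> with a single
  \<open>z\<close>, and this \<open>z\<close> would be mergeable because \<open>w\<close> is a
  congruence.\<close>

lemma meet_coatom_proper:
  assumes s: "singleton_coatom \<noteq> P \<times> P" and w: "w \<in> proper_congruences P r"
    and n: "w \<notin> least_merge P x ` mergeable P r x"
  shows "w \<inter> singleton_coatom \<in> proper_congruences P r"
proof -
  have wc: "w \<in> congruences P r" "w \<noteq> Id_on P"
    using w by (auto simp: proper_congruences_def)
  have "singleton_coatom \<subseteq> P \<times> P" using x by (auto simp: singleton_coatom_def)
  then have "w \<inter> singleton_coatom \<noteq> P \<times> P" using s by blast
  moreover have "w \<inter> singleton_coatom \<noteq> Id_on P"
  proof
    assume "w \<inter> singleton_coatom = Id_on P"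
    then obtain z where "z \<in> P - {x}" "w = least_merge P x z"
      using meet_coatom_Id[OF congruences_equiv[OF wc(1)] wc(2)] by blast
    then show False
      using n wc(1) least_merge_congruence[of z] by blast
  qed
  ultimately show ?thesis
    using congruences_Int[OF wc(1) singleton_coatom_congruence] by (simp add: proper_congruences_def)
qed

lemma inj_on_least_merge: "inj_on (least_merge P x) (P - {x})"
proof (rule inj_onI)
  fix z z' assume z: "z \<in> P - {x}" and eq: "least_merge P x z = least_merge P x z'"
  have "(x, z) \<in> least_merge P x z" by (simp add: least_merge_def)
  then have "(x, z) \<in> least_merge P x z'" by (simp only: eq)
  then show "z = z'" using z by (auto simp: least_merge_def)
qed

end

text \<open>Critical cells in the sense of discrete Morse theory. For a simplicial complex,
  maximality makes \<open>K - \<F>\<close> a subcomplex. The size \<open>k\<close> corresponds to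
  dimension \<open>k - 1\<close>; \<open>k = 0\<close> occurs in the base case, with the empty
  face.\<close>

definition critical_faces :: "'v set set \<Rightarrow> nat \<Rightarrow> nat \<Rightarrow> 'v set set \<Rightarrow> bool" where
  "critical_faces K k m \<F> \<longleftrightarrow> \<F> \<subseteq> K \<and> card \<F> = m \<and>
     (\<forall>F\<in>\<F>. card F = k \<and> (\<forall>T\<in>K. F \<subseteq> T \<longrightarrow> T = F)) \<and> collapsible (K - \<F>)"

lemma critical_faces_image:
  assumes inj: "inj_on \<phi> V" and V: "\<Union>K \<subseteq> V" and crit: "critical_faces K k m \<F>"
  shows "critical_faces ((`) \<phi> ` K) k m ((`) \<phi> ` \<F>)"
proof -
  have sub: "T \<subseteq> V" if "T \<in> K" for T
    using that V by blast
  have sF: "\<F> \<subseteq> K" and mF: "card \<F> = m" and coll: "collapsible (K - \<F>)"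
    and kF: "\<And>F. F \<in> \<F> \<Longrightarrow> card F = k"
    and max: "\<And>F T. F \<in> \<F> \<Longrightarrow> T \<in> K \<Longrightarrow> F \<subseteq> T \<Longrightarrow> T = F"
    using crit unfolding critical_faces_def by blast+
  have injf: "inj_on ((`) \<phi>) K"
    by (rule inj_on_subset[OF inj_on_image_Pow[OF inj]]) (use sub in blast)
  have 1: "(`) \<phi> ` \<F> \<subseteq> (`) \<phi> ` K"
    using sF by blast
  have 2: "card ((`) \<phi> ` \<F>) = m"
    using card_image[OF inj_on_subset[OF injf sF]] mF by simp
  have 3: "card F' = k \<and> (\<forall>T'\<in>(`) \<phi> ` K. F' \<subseteq> T' \<longrightarrow> T' = F')" if F': "F' \<in> (`) \<phi> ` \<F>" for F'
  proof -
    obtain F where F: "F \<in> \<F>" "F' = \<phi> ` F" using F' by blast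
    have FV: "F \<subseteq> V" using F(1) sF sub by blast
    have "card F' = k"
      unfolding F(2) using card_image[OF inj_on_subset[OF inj FV]] kF[OF F(1)] by simp
    moreover have "T' = F'" if T': "T' \<in> (`) \<phi> ` K" "F' \<subseteq> T'" for T'
    proof -
      obtain T where T: "T \<in> K" "T' = \<phi> ` T" using T'(1) by blast
      have "F \<subseteq> T"
        using T'(2) inj_on_image_subset_iff[OF inj FV sub[OF T(1)]] unfolding F(2) T(2) by simp
      then have "T = F" by (rule max[OF F(1) T(1)])
      then show ?thesis unfolding F(2) T(2) by simp
    qed
    ultimately show ?thesis by blast
  qed
  have 4: "collapsible ((`) \<phi> ` K - (`) \<phi> ` \<F>)"
  proof -
    have "(`) \<phi> ` K - (`) \<phi> ` \<F> = (`) \<phi> ` (K - \<F>)"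
      by (rule inj_on_image_set_diff[OF injf, symmetric]) (use sF in auto)
    moreover have "\<Union>(K - \<F>) \<subseteq> V" using sub by blast
    ultimately show ?thesis
      using collapsible_image[OF coll inj] by simp
  qed
  show ?thesis
    unfolding critical_faces_def by (intro conjI 1 2 4 ballI[OF 3])
qed

text \<open>The complements of the coatom and the summands of the recursion for cyclic extensions
  are indexed by the same set \<open>mergeable P r x\<close>, so the counts agree. For two elements
  there are no proper congruences and one cyclic extension, matching the single empty chain.\<close>

lemma exists_critical_flags:
  assumes "finite P" "partial_order_on P r" "card P = Suc (Suc k)"
  shows "\<exists>\<F>. critical_faces (flags (proper_congruences P r)) k (num_cyclic_extensions P r) \<F>"
  using assms
proof (induction k arbitrary: P r)
  case 0
  then have "P \<noteq> {}" by auto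
  then obtain x where x: "x \<in> P" and min: "\<And>a. (a, x) \<in> r \<Longrightarrow> a = x"
    using exists_minimal[OF 0(1,2)] by blast
  have "card (P - {x}) = 1" using 0 x by simp
  then obtain b where "P - {x} = {b}" by (auto simp: card_1_singleton_iff)
  then have P: "P = {x, b}" and b: "b \<noteq> x" using x by auto
  have "w = Id_on P \<or> w = P \<times> P" if w: "w \<in> congruences P r" for w
  proof -
    have e: "w \<subseteq> P \<times> P" "(x, x) \<in> w" "(b, b) \<in> w" "(x, b) \<in> w \<longleftrightarrow> (b, x) \<in> w"
      using congruences_equiv[OF w] unfolding P equiv_def refl_on_def sym_def by blast+
    show ?thesis
    proof (cases "(x, b) \<in> w")
      case True
      then have "w = P \<times> P" using e unfolding P by auto
      then show ?thesis by simp
    next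
      case False
      then have "w = Id_on P" using e unfolding P by auto
      then show ?thesis by simp
    qed
  qed
  then have "proper_congruences P r = {}" by (auto simp: proper_congruences_def)
  then have fl: "flags (proper_congruences P r) = {{}}" by (auto simp: flags_def)
  have "cyclic_arrangements P r x = {[x, b]}"
  proof (intro subset_antisym subsetI)
    fix xs assume "xs \<in> cyclic_arrangements P r x"
    then obtain us vs where "xs = us @ vs" "xs \<noteq> []" and hd: "hd xs = x"
      and "vs @ us \<in> linear_arrangements P r"
      unfolding cyclic_arrangements_def by blast
    then have d: "distinct xs" "set xs = P" by (auto simp: linear_arrangements_def)
    then have "length xs = 2" using distinct_card[OF d(1)] 0(3) by simp
    then obtain a c where "xs = [a, c]" by (auto simp: length_Suc_conv numeral_2_eq_2)
    then show "xs \<in> {[x, b]}" using d hd b unfolding P by auto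
  next
    fix xs assume "xs \<in> {[x, b]}"
    moreover have "[] @ x # [b] \<in> linear_arrangements P r"
      using b min[of b] unfolding P linear_arrangements_def by auto
    ultimately show "xs \<in> cyclic_arrangements P r x"
      using cyclic_arrangementsI[of "[]" x "[b]" P r] by simp
  qed
  then have "num_cyclic_extensions P r = 1"
    using num_cyclic_extensions_eq[OF x] by simp
  then have "critical_faces (flags (proper_congruences P r)) 0 (num_cyclic_extensions P r) {{}}"
    unfolding critical_faces_def fl by (simp add: collapsible.void)
  then show ?case by blast
next
  case (Suc k)
  then have "P \<noteq> {}" by auto
  then obtain x where x: "x \<in> P" and min: "\<And>a. (a, x) \<in> r \<Longrightarrow> a = x"
    using exists_minimal[OF Suc.prems(1,2)] by blast
  interpret minimal_element P r x
    by unfold_locales (fact Suc.prems x min)+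
  have c3: "card P \<ge> 3" using Suc.prems by simp
  let ?L = "proper_congruences P r"
  let ?Q = "\<lambda>z. proper_congruences (P - {x}) (quotient_order P r x z)"
  let ?y = "least_merge P x"
  let ?Z = "mergeable P r x"
  let ?m = "\<lambda>z. num_cyclic_extensions (P - {x}) (quotient_order P r x z)"
  have ZP: "z \<in> P - {x}" if "z \<in> ?Z" for z
    using that by (simp add: mergeable_def)
  have "\<exists>\<F>. critical_faces (flags (?Q z)) k (?m z) \<F>" if z: "z \<in> ?Z" for z
    using Suc.IH[OF _ partial_order_quotient_order[OF z]] Suc.prems x by simp
  then obtain H where H: "critical_faces (flags (?Q z)) k (?m z) (H z)" if "z \<in> ?Z" for z
    by metis
  have above: "critical_faces (flags {w \<in> ?L. ?y z \<subset> w}) k (?m z) ((`) (pull_rel P x z) ` H z)" if z: "z \<in> ?Z" for z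
  proof -
    have emb: "pull_rel P x z a \<subseteq> pull_rel P x z b \<longleftrightarrow> a \<subseteq> b" if "a \<in> ?Q z" "b \<in> ?Q z" for a b
    proof (rule pull_rel_subset_iff)
      show "a \<subseteq> (P - {x}) \<times> (P - {x})"
        using congruences_equiv[of a "P - {x}" "quotient_order P r x z"] that(1)
        by (simp add: proper_congruences_def equiv_def)
    qed
    have inj: "inj_on (pull_rel P x z) (?Q z)"
    proof (rule inj_onI)
      fix a b assume ab: "a \<in> ?Q z" "b \<in> ?Q z" "pull_rel P x z a = pull_rel P x z b"
      show "a = b" using emb[OF ab(1,2)] emb[OF ab(2,1)] ab(3) by simp
    qed
    have sub: "\<Union>(flags (?Q z)) \<subseteq> ?Q z" by (auto simp: flags_def)
    have "flags {w \<in> ?L. ?y z \<subset> w} = (`) (pull_rel P x z) ` flags (?Q z)"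
      unfolding proper_congruences_above_merge[OF ZP[OF z]] by (rule flags_embedding[OF emb])
    then show ?thesis
      using critical_faces_image[OF inj sub H[OF z]] by (simp only:)
  qed
  have injy: "inj_on ?y ?Z"
    by (rule inj_on_subset[OF inj_on_least_merge]) (use ZP in blast)
  \<comment> \<open>The complementation lemma is indexed by atoms, the recursion by
    \<open>z\<close>; \<open>\<zeta>\<close> translates between them.\<close>
  define \<zeta> where "\<zeta> = the_inv_into ?Z ?y"
  define G where "G y = (`) (pull_rel P x (\<zeta> y)) ` H (\<zeta> y)" for y
  have G: "critical_faces (flags {w \<in> ?L. y \<subset> w}) k (?m (\<zeta> y)) (G y)" if y: "y \<in> ?y ` ?Z" for y
  proof -
    obtain z where z: "z \<in> ?Z" "y = ?y z" using y by blast
    have "\<zeta> y = z" unfolding z(2) \<zeta>_def by (rule the_inv_into_f_f[OF injy z(1)])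
    then show ?thesis using above[OF z(1)] unfolding G_def z(2) by simp
  qed
  note G = G[unfolded critical_faces_def]
  have "\<exists>\<F>. \<F> \<subseteq> flags ?L \<and> card \<F> = (\<Sum>y\<in>?y ` ?Z. card (G y)) \<and>
      (\<forall>F\<in>\<F>. card F = Suc k \<and> (\<forall>T\<in>flags ?L. F \<subseteq> T \<longrightarrow> T = F)) \<and> collapsible (flags ?L - \<F>)"
  proof (rule collapsible_flags_complements)
    show "finite ?L"
      using finite_congruences[OF Suc.prems(1)] by (simp add: proper_congruences_def)
    show s: "singleton_coatom \<in> ?L" by (rule singleton_coatom_proper[OF c3])
    show "?y ` ?Z \<subseteq> ?L" using least_merge_proper[OF c3] by blast
    show "w \<inter> singleton_coatom \<in> ?L" if "w \<in> ?L" "w \<notin> ?y ` ?Z" for w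
      using s that by (intro meet_coatom_proper) (auto simp: proper_congruences_def)
    show "\<not> y \<subseteq> singleton_coatom" if y: "y \<in> ?y ` ?Z" for y
    proof -
      obtain z where z: "z \<in> ?Z" "y = ?y z" using y by blast
      have "(x, z) \<in> y" "(x, z) \<notin> singleton_coatom"
        using ZP[OF z(1)] by (auto simp: z(2) least_merge_def singleton_coatom_def)
      then show ?thesis by blast
    qed
    show "w = y" if "y \<in> ?y ` ?Z" "w \<in> ?L" "w \<subseteq> y" for y w
    proof -
      obtain z where z: "y = ?y z" using \<open>y \<in> ?y ` ?Z\<close> by blast
      have "w \<in> congruences P r" "w \<noteq> Id_on P"
        using \<open>w \<in> ?L\<close> by (auto simp: proper_congruences_def)
      then show ?thesis
        using subset_least_merge[OF congruences_equiv] \<open>w \<subseteq> y\<close> unfolding z by blast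
    qed
    show "G y \<subseteq> flags {w \<in> ?L. y \<subset> w}" "collapsible (flags {w \<in> ?L. y \<subset> w} - G y)"
      if "y \<in> ?y ` ?Z" for y
      using G[OF that] by blast+
    show "card F = k" if "y \<in> ?y ` ?Z" "F \<in> G y" for y F
      using G[OF that(1)] that(2) by blast
    show "T = F" if "y \<in> ?y ` ?Z" "F \<in> G y" "T \<in> flags {w \<in> ?L. y \<subset> w}" "F \<subseteq> T" for y F T
      using G[OF that(1)] that(2-4) by blast
  qed
  moreover have "(\<Sum>y\<in>?y ` ?Z. card (G y)) = num_cyclic_extensions P r"
  proof -
    have "(\<Sum>y\<in>?y ` ?Z. card (G y)) = (\<Sum>y\<in>?y ` ?Z. ?m (\<zeta> y))"
      using G by (intro sum.cong refl) blast
    also have "\<dots> = (\<Sum>z\<in>?Z. ?m (\<zeta> (?y z)))"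
      by (rule sum.reindex_cong[OF injy refl refl])
    also have "\<dots> = (\<Sum>z\<in>?Z. ?m z)"
      by (intro sum.cong refl) (simp add: \<zeta>_def the_inv_into_f_f[OF injy])
    also have "\<dots> = num_cyclic_extensions P r"
      using card_cyclic_arrangements_rec Suc.prems num_cyclic_extensions_eq[OF x, of r] by simp
    finally show ?thesis .
  qed
  ultimately show ?case
    unfolding critical_faces_def by metis
qed

section \<open>From congruences back to partitions\<close>

lemma refines_quotient_iff:
  assumes a: "equiv P a" and b: "equiv P b"
  shows "refines P (P // a) (P // b) \<longleftrightarrow> a \<subseteq> b"
proof
  assume R: "refines P (P // a) (P // b)"
  show "a \<subseteq> b"
  proof (rule subrelI)
    fix u v assume uv: "(u, v) \<in> a"
    then have u: "u \<in> P" using a by (auto simp: equiv_def)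
    then have "a `` {u} \<in> P // a" by (rule quotientI)
    then obtain Y where Y: "Y \<in> P // b" "a `` {u} \<subseteq> Y"
      using R by (auto simp: refines_def)
    have "u \<in> Y" "v \<in> Y" using Y(2) uv equiv_class_self[OF a u] by auto
    then show "(u, v) \<in> b"
      using Y(1) quotient_eq_iff[OF b] by blast
  qed
next
  assume sub: "a \<subseteq> b"
  have "\<exists>Y\<in>P // b. X \<subseteq> Y" if "X \<in> P // a" for X
    using that sub by (auto simp: quotient_def)
  then show "refines P (P // a) (P // b)"
    using partition_on_quotient[OF a] partition_on_quotient[OF b] by (simp add: refines_def)
qed

lemma proper_op_partitions_eq:
  assumes "r \<subseteq> P \<times> P" "P \<noteq> {}"
  shows "proper_op_partitions P r = (//) P ` proper_congruences P r"
proof -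
  have "inj_on ((//) P) {w. equiv P w}"
  proof (rule inj_onI)
    fix a b assume ab: "a \<in> {w. equiv P w}" "b \<in> {w. equiv P w}" "P // a = P // b"
    then have e: "equiv P a" "equiv P b" by simp_all
    have "refines P (P // a) (P // a)"
      by (rule refines_refl[OF partition_on_quotient[OF e(1)]])
    then show "a = b"
      using refines_quotient_iff[OF e] refines_quotient_iff[OF e(2,1)] unfolding ab(3) by blast
  qed
  moreover have "congruences P r \<union> {Id_on P, P \<times> P} \<subseteq> {w. equiv P w}"
  proof -
    have "equiv P (Id_on P)" "equiv P (P \<times> P)"
      by (simp_all add: equiv_def refl_on_def sym_def trans_def Id_on_iff subset_iff)
    then show ?thesis using congruences_equiv[of _ P r] by blast
  qed
  ultimately have "inj_on ((//) P) (congruences P r \<union> {Id_on P, P \<times> P})"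
    by (rule inj_on_subset)
  then have "(//) P ` proper_congruences P r =
      (//) P ` congruences P r - (//) P ` {Id_on P, P \<times> P}"
    unfolding proper_congruences_def by (rule inj_on_image_set_diff) auto
  moreover have "P // Id_on P = (\<lambda>x. {x}) ` P" "P // (P \<times> P) = {P}"
    using assms(2) by (auto simp: quotient_def)
  moreover have "op_partitions P r = (//) P ` congruences P r"
    unfolding op_partitions_def order_congruence_iff[OF assms(1)] by auto
  ultimately show ?thesis
    by (simp add: proper_op_partitions_def)
qed

lemma order_complex_partitions_eq:
  assumes "r \<subseteq> P \<times> P" "P \<noteq> {}"
  shows "order_complex (proper_op_partitions P r) (refinement_order P) =
    (`) ((//) P) ` flags (proper_congruences P r)"
proof -
  have eq: "equiv P w" if "w \<in> proper_congruences P r" for w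
    using that congruences_equiv by (auto simp: proper_congruences_def)
  have iff: "(P // a, P // b) \<in> refinement_order P \<longleftrightarrow> a \<subseteq> b"
    if "a \<in> proper_congruences P r" "b \<in> proper_congruences P r" for a b
    using refines_quotient_iff[OF eq eq] that by (simp add: refinement_order_def)
  have chain: "(//) P ` D \<in> Chains (refinement_order P) \<longleftrightarrow> (\<forall>a\<in>D. \<forall>b\<in>D. a \<subseteq> b \<or> b \<subseteq> a)"
    if "D \<subseteq> proper_congruences P r" for D
  proof -
    have "(//) P ` D \<in> Chains (refinement_order P) \<longleftrightarrow> (\<forall>a\<in>D. \<forall>b\<in>D.
        (P // a, P // b) \<in> refinement_order P \<or> (P // b, P // a) \<in> refinement_order P)"
      by (simp add: Chains_def)
    also have "\<dots> \<longleftrightarrow> (\<forall>a\<in>D. \<forall>b\<in>D. a \<subseteq> b \<or> b \<subseteq> a)"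
      using iff that by (intro ball_cong refl) (simp add: subset_iff)
    finally show ?thesis .
  qed
  show ?thesis
  proof (intro subset_antisym subsetI)
    fix C assume C: "C \<in> order_complex (proper_op_partitions P r) (refinement_order P)"
    then have "C \<subseteq> (//) P ` proper_congruences P r" "finite C"
      unfolding order_complex_def proper_op_partitions_eq[OF assms] by auto
    then obtain D where D: "D \<subseteq> proper_congruences P r" "finite D" "C = (//) P ` D"
      using finite_subset_image by metis
    then have "D \<in> flags (proper_congruences P r)"
      using C chain[OF D(1)] by (simp add: order_complex_def flags_def)
    with D(3) show "C \<in> (`) ((//) P) ` flags (proper_congruences P r)" by blast
  next
    fix C assume "C \<in> (`) ((//) P) ` flags (proper_congruences P r)"
    then obtain D where D: "D \<in> flags (proper_congruences P r)" "C = (//) P ` D" by blast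
    then show "C \<in> order_complex (proper_op_partitions P r) (refinement_order P)"
      using chain[of D] by (auto simp: order_complex_def flags_def proper_op_partitions_eq[OF assms])
  qed
qed

lemma exists_critical_faces:
  assumes "finite P" "partial_order_on P r" "card P = Suc (Suc k)"
  shows "\<exists>\<F>. critical_faces (order_complex (proper_op_partitions P r) (refinement_order P))
    k (num_cyclic_extensions P r) \<F>"
proof -
  have ne: "P \<noteq> {}" using assms(3) by auto
  obtain \<F> where \<F>: "critical_faces (flags (proper_congruences P r)) k (num_cyclic_extensions P r) \<F>"
    using exists_critical_flags[OF assms] by blast
  have inj: "inj_on ((//) P) (proper_congruences P r)"
  proof (rule inj_onI)
    fix a b assume ab: "a \<in> proper_congruences P r" "b \<in> proper_congruences P r" "P // a = P // b"
    then have e: "equiv P a" "equiv P b"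
      using congruences_equiv by (auto simp: proper_congruences_def)
    have "refines P (P // a) (P // a)"
      by (rule refines_refl[OF partition_on_quotient[OF e(1)]])
    then show "a = b"
      using refines_quotient_iff[OF e] refines_quotient_iff[OF e(2,1)] unfolding ab(3) by blast
  qed
  have "\<Union>(flags (proper_congruences P r)) \<subseteq> proper_congruences P r"
    by (auto simp: flags_def)
  from critical_faces_image[OF inj this \<F>] show ?thesis
    unfolding order_complex_partitions_eq[OF partial_order_onD(4)[OF assms(2)] ne] by (rule exI)
qed

section \<open>Realizations of collapsible complexes\<close>

definition simplicial_complex :: "'v set set \<Rightarrow> bool" where
  "simplicial_complex K \<longleftrightarrow> (\<forall>T\<in>K. finite T \<and> (\<forall>S\<subseteq>T. S \<in> K))"

abbreviation support :: "('v \<Rightarrow> real) \<Rightarrow> 'v set" where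
  "support t \<equiv> {v. t v \<noteq> 0}"

abbreviation realization_points :: "'v set set \<Rightarrow> ('v \<Rightarrow> real) set" where
  "realization_points K \<equiv> topspace (geometric_realization K)"

lemma simplicial_complexD:
  assumes "simplicial_complex K" "T \<in> K"
  shows "finite T" and "S \<subseteq> T \<Longrightarrow> S \<in> K"
  using assms by (auto simp: simplicial_complex_def)

lemma simplicial_complex_delete_star:
  "simplicial_complex K \<Longrightarrow> simplicial_complex {T \<in> K. \<not> R \<subseteq> T}"
  unfolding simplicial_complex_def by blast

lemma realization_points_eq:
  "realization_points K = {t. (\<forall>v. 0 \<le> t v) \<and> support t \<in> K \<and> sum t (support t) = 1}"
  by (simp add: geometric_realization_def)

lemma realization_pointsD:
  assumes "t \<in> realization_points K"
  shows "0 \<le> t v" and "support t \<in> K" and "sum t (support t) = 1"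
  using assms by (auto simp: realization_points_eq)

lemma sum_support_superset:
  assumes "t \<in> realization_points K" "finite T" "support t \<subseteq> T"
  shows "sum t T = 1"
proof -
  have "sum t (support t) = sum t T"
    by (rule sum.mono_neutral_left) (use assms in auto)
  then show ?thesis using realization_pointsD(3)[OF assms(1)] by simp
qed

lemma realization_pointsI:
  assumes "simplicial_complex K" "T \<in> K" "\<And>v. 0 \<le> t v" "support t \<subseteq> T" "sum t T = 1"
  shows "t \<in> realization_points K"
proof -
  have "finite T" "support t \<in> K"
    using simplicial_complexD[OF assms(1,2)] assms(4) by auto
  moreover have "sum t (support t) = sum t T"
    by (rule sum.mono_neutral_left) (use assms(4) \<open>finite T\<close> in auto)
  ultimately show ?thesis
    using assms(3,5) by (simp add: realization_points_eq)
qed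

lemma realization_points_mono: "K \<subseteq> L \<Longrightarrow> realization_points K \<subseteq> realization_points L"
  by (auto simp: realization_points_eq)

lemma continuous_map_realization:
  "continuous_map X (geometric_realization K) f \<longleftrightarrow>
    (\<forall>v. continuous_map X euclideanreal (\<lambda>x. f x v)) \<and> f \<in> topspace X \<rightarrow> realization_points K"
  unfolding realization_points_eq unfolding geometric_realization_def
  by (simp add: continuous_map_in_subtopology continuous_map_componentwise_UNIV)

lemma continuous_map_coordinate:
  "continuous_map (geometric_realization K) euclideanreal (\<lambda>t. t v)"
  using continuous_map_realization[of "geometric_realization K" K id] by simp

lemma continuous_map_realization_mono:
  "K \<subseteq> L \<Longrightarrow> continuous_map (geometric_realization K) (geometric_realization L) id"
  using realization_points_mono[of K L]
  by (auto simp: continuous_map_realization continuous_map_coordinate)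

lemma subtopology_realization:
  assumes "K \<subseteq> L"
  shows "subtopology (geometric_realization L) (realization_points K) = geometric_realization K"
proof -
  have "{t. (\<forall>v. 0 \<le> t v) \<and> support t \<in> L \<and> sum t (support t) = 1} \<inter> realization_points K =
      {t. (\<forall>v. 0 \<le> t v) \<and> support t \<in> K \<and> sum t (support t) = 1}"
    using assms unfolding realization_points_eq by auto
  then show ?thesis
    unfolding geometric_realization_def[of L] geometric_realization_def[of K] subtopology_subtopology
    by (simp add: geometric_realization_def)
qed

lemma continuous_map_unit_interval_coordinate:
  "continuous_map (prod_topology (top_of_set {0..1}) X) euclideanreal fst"
  using continuous_map_fst[of "top_of_set {0..1::real}" X]
  by (simp add: continuous_map_in_subtopology)

text \<open>The segment from \<open>f x\<close> to \<open>g x\<close> stays inside a common simplex.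
  The predicate records that the homotopy is stationary where both maps agree, which later keeps a
  subcomplex invariant.\<close>

lemma homotopic_contiguous:
  assumes K: "simplicial_complex K"
    and f: "continuous_map X (geometric_realization K) f"
    and g: "continuous_map X (geometric_realization K) g"
    and T: "\<And>x. x \<in> topspace X \<Longrightarrow> \<exists>T\<in>K. support (f x) \<subseteq> T \<and> support (g x) \<subseteq> T"
  shows "homotopic_with (\<lambda>h. \<forall>x\<in>topspace X. f x = g x \<longrightarrow> h x = f x) X (geometric_realization K) f g"
proof -
  define h where "h = (\<lambda>p v. (1 - fst p) * f (snd p) v + fst p * g (snd p) v)"
  let ?I = "prod_topology (top_of_set {0..1::real}) X"
  have cont: "continuous_map ?I euclideanreal (\<lambda>p. h p v)" for v
  proof -
    have fv: "continuous_map X euclideanreal (\<lambda>x. f x v)" "continuous_map X euclideanreal (\<lambda>x. g x v)"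
      using f g by (auto simp: continuous_map_realization)
    have "continuous_map ?I euclideanreal (\<lambda>p. f (snd p) v)" "continuous_map ?I euclideanreal (\<lambda>p. g (snd p) v)"
      using continuous_map_compose[OF continuous_map_snd fv(1)]
        continuous_map_compose[OF continuous_map_snd fv(2)] by (simp_all add: o_def)
    then show ?thesis
      unfolding h_def by (intro continuous_intros continuous_map_unit_interval_coordinate) auto
  qed
  have "h (u, x) \<in> realization_points K" if u: "0 \<le> u" "u \<le> 1" and x: "x \<in> topspace X" for u x
  proof -
    obtain S where S: "S \<in> K" "support (f x) \<subseteq> S" "support (g x) \<subseteq> S" using T[OF x] by blast
    have fx: "f x \<in> realization_points K" "g x \<in> realization_points K"
      using f g x by (auto simp: continuous_map_realization)
    have "finite S" by (rule simplicial_complexD[OF K S(1)])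
    then have sums: "sum (f x) S = 1" "sum (g x) S = 1"
      using sum_support_superset fx S by blast+
    show ?thesis
    proof (rule realization_pointsI[OF K S(1)])
      show "0 \<le> h (u, x) v" for v
        using u realization_pointsD(1)[OF fx(1)] realization_pointsD(1)[OF fx(2)] by (simp add: h_def)
      show "support (h (u, x)) \<subseteq> S"
      proof
        fix v assume "v \<in> support (h (u, x))"
        then have "f x v \<noteq> 0 \<or> g x v \<noteq> 0" by (auto simp: h_def)
        then show "v \<in> S" using S by auto
      qed
      show "sum (h (u, x)) S = 1"
        using sums by (simp add: h_def sum.distrib flip: sum_distrib_left)
    qed
  qed
  then have "continuous_map ?I (geometric_realization K) h"
    unfolding continuous_map_realization using cont by auto
  moreover have "h (0, x) = f x" "h (1, x) = g x" for x
    by (simp_all add: h_def fun_eq_iff)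
  moreover have "h (u, x) = f x" if "f x = g x" for u x
    using that by (simp add: h_def fun_eq_iff algebra_simps)
  ultimately show ?thesis
    unfolding homotopic_with_def by (intro exI[of _ h]) simp
qed

lemma continuous_map_Min:
  assumes "finite F" "F \<noteq> {}" and "\<And>v. v \<in> F \<Longrightarrow> continuous_map X euclideanreal (\<lambda>x. f x v)"
  shows "continuous_map X euclideanreal (\<lambda>x. Min (f x ` F))"
  using assms
proof (induction rule: finite_ne_induct)
  case (insert v F)
  have "Min (f x ` insert v F) = min (f x v) (Min (f x ` F))" for x
    using insert.hyps by simp
  then show ?case
    using insert by (auto intro!: continuous_map_real_min)
qed simp

lemma Min_coordinate_pos_iff:
  fixes t :: "'v \<Rightarrow> real"
  assumes "finite F" "F \<noteq> {}" "\<And>v. 0 \<le> t v"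
  shows "0 < Min (t ` F) \<longleftrightarrow> F \<subseteq> support t" and "0 \<le> Min (t ` F)"
    and "Min (t ` F) \<noteq> 0 \<longleftrightarrow> F \<subseteq> support t"
proof -
  show nn: "0 \<le> Min (t ` F)" using assms by simp
  show "0 < Min (t ` F) \<longleftrightarrow> F \<subseteq> support t"
  proof -
    have "0 < Min (t ` F) \<longleftrightarrow> (\<forall>v\<in>F. 0 < t v)" using assms(1,2) by simp
    also have "\<dots> \<longleftrightarrow> F \<subseteq> support t" using assms(3) by (auto simp: less_le)
    finally show ?thesis .
  qed
  with nn show "Min (t ` F) \<noteq> 0 \<longleftrightarrow> F \<subseteq> support t"
    by auto
qed

text \<open>Pushing the least barycentric coordinate in \<open>R\<close> over to the apex \<open>s\<close> retracts the
  realization onto the subcomplex of faces not containing \<open>R\<close>.\<close>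

lemma realization_delete_star:
  fixes K :: "'v set set"
  assumes K: "simplicial_complex K" and R: "R \<noteq> {}" and s: "s \<notin> R"
    and apex: "\<And>T. T \<in> K \<Longrightarrow> R \<subseteq> T \<Longrightarrow> insert s T \<in> K"
  shows "geometric_realization K homotopy_equivalent_space geometric_realization {T \<in> K. \<not> R \<subseteq> T}"
    (is "?X homotopy_equivalent_space geometric_realization ?K")
proof (cases "\<exists>T\<in>K. R \<subseteq> T")
  case False
  then have "?K = K" by blast
  then show ?thesis by (simp add: homotopy_equivalent_space_refl)
next
  case True
  then have fR: "finite R"
    using simplicial_complexD(1)[OF K] finite_subset by blast
  have K': "simplicial_complex ?K" by (rule simplicial_complex_delete_star[OF K])
  \<comment> \<open>The least coordinate is taken from each vertex in \<open>R\<close>, and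
    \<open>card R\<close> times that amount goes to \<open>s\<close>, so the total stays 1. If
    \<open>R\<close> is not contained in the support, the amount is 0.\<close>
  define f where "f = (\<lambda>(t :: 'v \<Rightarrow> real) v. t v - Min (t ` R) * (if v \<in> R then 1 else 0)
      + Min (t ` R) * real (card R) * (if v = s then 1 else 0))"
  have f0: "f t = t" if "t \<in> realization_points K" "\<not> R \<subseteq> support t" for t
  proof -
    have "Min (t ` R) = 0"
      using Min_coordinate_pos_iff(3)[OF fR R, of t] realization_pointsD(1)[OF that(1)] that(2) by blast
    then show ?thesis by (simp add: f_def fun_eq_iff)
  qed
  have f1: "insert s (support t) \<in> K \<and> support (f t) \<subseteq> insert s (support t) \<and> f t \<in> realization_points K
      \<and> \<not> R \<subseteq> support (f t)"
    if t: "t \<in> realization_points K" "R \<subseteq> support t" for t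
  proof -
    let ?m = "Min (t ` R)" and ?T = "insert s (support t)"
    note nn = realization_pointsD(1)[OF t(1)]
    have T: "?T \<in> K" using apex[OF realization_pointsD(2)[OF t(1)] t(2)] .
    have fT: "finite ?T" by (rule simplicial_complexD[OF K T])
    have m: "0 \<le> ?m" by (rule Min_coordinate_pos_iff(2)[OF fR R, of t]) (rule nn)
    have le: "?m \<le> t v" if "v \<in> R" for v
      using that fR by simp
    have sub: "support (f t) \<subseteq> ?T"
      using t(2) by (auto simp: f_def)
    have "f t \<in> realization_points K"
    proof (rule realization_pointsI[OF K T])
      show "0 \<le> f t v" for v
        using nn[of v] m le[of v] s by (auto simp: f_def)
      have "(\<Sum>v\<in>?T. if v \<in> R then 1 else 0 :: real) = card R"
      proof -
        have "R \<subseteq> ?T" using t(2) by blast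
        then show ?thesis using fT by (simp add: sum.If_cases Int_absorb1)
      qed
      moreover have "(\<Sum>v\<in>?T. if v = s then 1 else 0 :: real) = 1"
        using fT by (simp add: sum.delta)
      moreover have "sum t ?T = 1"
        using sum_support_superset[OF t(1) fT] by blast
      ultimately show "sum (f t) ?T = 1"
        unfolding f_def by (simp add: sum.distrib sum_subtractf flip: sum_distrib_left)
    qed (rule sub)
    moreover have "\<not> R \<subseteq> support (f t)"
    proof -
      have "?m \<in> t ` R" using fR R by simp
      then obtain v where v: "v \<in> R" "t v = ?m" by auto
      then have "f t v = 0" using s by (auto simp: f_def)
      with v show ?thesis by auto
    qed
    ultimately show ?thesis using T sub by blast
  qed
  have fK: "f t \<in> realization_points ?K" if t: "t \<in> realization_points K" for t
  proof (cases "R \<subseteq> support t")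
    case True
    then show ?thesis using f1[OF t] by (simp add: realization_points_eq)
  next
    case False
    then show ?thesis using f0[OF t] t by (simp add: realization_points_eq)
  qed
  have "continuous_map ?X euclideanreal (\<lambda>t. f t v)" for v
    unfolding f_def
    by (intro continuous_intros continuous_map_Min continuous_map_coordinate fR R) auto
  then have f: "continuous_map ?X (geometric_realization ?K) f"
    unfolding continuous_map_realization using fK by auto
  have i: "continuous_map (geometric_realization ?K) ?X id"
    by (rule continuous_map_realization_mono) blast
  have "\<exists>T\<in>K. support (f t) \<subseteq> T \<and> support (id t) \<subseteq> T" if t: "t \<in> realization_points K" for t
  proof (cases "R \<subseteq> support t")
    case True
    then show ?thesis using f1[OF t] by auto
  next
    case False
    then show ?thesis using f0[OF t] realization_pointsD(2)[OF t] by auto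
  qed
  moreover have "continuous_map ?X ?X f"
    using continuous_map_compose[OF f i] by simp
  ultimately have "homotopic_with (\<lambda>x. True) ?X ?X f id"
    using homotopic_with_mono[OF homotopic_contiguous[OF K, of ?X f id]] by simp
  moreover have "homotopic_with (\<lambda>x. True) (geometric_realization ?K) (geometric_realization ?K) (f \<circ> id) id"
  proof (rule homotopic_with_equal)
    show "(f \<circ> id) t = id t" if "t \<in> realization_points ?K" for t
      using that f0[of t] by (simp add: realization_points_eq)
    show "continuous_map (geometric_realization ?K) (geometric_realization ?K) (f \<circ> id)"
      by (rule continuous_map_compose[OF i f])
  qed auto
  ultimately show ?thesis
    unfolding homotopy_equivalent_space_def using f i
    by (intro exI[of _ f] exI[of _ id]) simp
qed

lemma vertex_point:
  assumes "{s} \<in> K"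
  shows "(\<lambda>v. if v = s then 1 else 0) \<in> realization_points K"
proof -
  have "{v. (if v = s then 1 else 0 :: real) \<noteq> 0} = {s}" by auto
  then show ?thesis using assms by (simp add: realization_points_eq)
qed

lemma contractible_cone:
  assumes K: "simplicial_complex K" and "{} \<in> K" and apex: "\<And>T. T \<in> K \<Longrightarrow> insert s T \<in> K"
  shows "contractible_space (geometric_realization K)"
proof -
  let ?e = "(\<lambda>v. if v = s then 1 else 0) :: _ \<Rightarrow> real"
  have e: "?e \<in> realization_points K"
    by (rule vertex_point) (use apex[OF assms(2)] in simp)
  have "\<exists>T\<in>K. support (id t) \<subseteq> T \<and> support ?e \<subseteq> T" if "t \<in> realization_points K" for t
    using apex[OF realization_pointsD(2)[OF that]] by (intro bexI[of _ "insert s (support t)"]) auto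
  then have "homotopic_with (\<lambda>x. True) (geometric_realization K) (geometric_realization K) id (\<lambda>_. ?e)"
    using homotopic_with_mono[OF homotopic_contiguous[OF K, of "geometric_realization K" id "\<lambda>_. ?e"]] e
    by simp
  then show ?thesis unfolding contractible_space_def by blast
qed

text \<open>The empty face survives every step with nonempty \<open>R\<close>. The void complex is
  therefore reached only through a step with \<open>R = {}\<close>, at which the complex is a cone;
  the steps before it are homotopy equivalences.\<close>

lemma collapsible_contractible:
  assumes "collapsible K" "simplicial_complex K" "{} \<in> K"
  shows "contractible_space (geometric_realization K) \<and> realization_points K \<noteq> {}"
  using assms
proof (induction rule: collapsible.induct)
  case (step s R K)
  show ?case
  proof (cases "R = {}")
    case True
    then have apex: "\<And>T. T \<in> K \<Longrightarrow> insert s T \<in> K" using step.hyps(2) by simp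
    show ?thesis
      using contractible_cone[OF step.prems apex] vertex_point[of s K] apex[OF step.prems(2)] by auto
  next
    case False
    let ?K = "{T \<in> K. \<not> R \<subseteq> T}"
    have "contractible_space (geometric_realization ?K) \<and> realization_points ?K \<noteq> {}"
      by (rule step.IH) (use step.prems False simplicial_complex_delete_star in auto)
    moreover have "geometric_realization K homotopy_equivalent_space geometric_realization ?K"
      by (rule realization_delete_star[OF step.prems(1) False step.hyps(1,2)])
    moreover have "realization_points ?K \<subseteq> realization_points K"
      by (rule realization_points_mono) blast
    ultimately show ?thesis
      using homotopy_equivalent_space_contractibility by blast
  qed
qed simp

section \<open>Quotients and wedges\<close>

lemma continuous_imp_quotient_map_compact:
  assumes "compact_space X" "Hausdorff_space Y" "continuous_map X Y q" "q ` topspace X = topspace Y"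
  shows "quotient_map X Y q"
  using assms by (intro continuous_closed_imp_quotient_map continuous_imp_closed_map_gen Hausdorff_imp_kc_space)

text \<open>A homotopy that contracts \<open>A\<close> inside \<open>A\<close> descends along the quotient map collapsing \<open>A\<close>.\<close>

lemma homotopy_equivalent_collapse:
  assumes X: "compact_space X" and W: "Hausdorff_space W"
    and q: "continuous_map X W q" "q ` topspace X = topspace W"
    and fib: "\<And>x y. x \<in> topspace X \<Longrightarrow> y \<in> topspace X \<Longrightarrow> q x = q y \<longleftrightarrow> x = y \<or> x \<in> A \<and> y \<in> A"
    and f: "homotopic_with (\<lambda>f. f ` A \<subseteq> A) X X id f" and a: "\<And>x. x \<in> A \<Longrightarrow> f x = a"
    and A: "A \<subseteq> topspace X"
  shows "X homotopy_equivalent_space W"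
proof -
  let ?I = "top_of_set {0..1::real}"
  have quo: "quotient_map X W q"
    by (rule continuous_imp_quotient_map_compact[OF X W q])
  have cf: "continuous_map X X f"
    using homotopic_with_imp_continuous_maps[OF f] by simp
  have ff: "f x = f y" if "x \<in> topspace X" "y \<in> topspace X" "q x = q y" for x y
    using fib[OF that(1,2)] that(3) a by auto
  \<comment> \<open>\<open>f\<close> is constant on \<open>A\<close>, the only fibre that may have
    several points, so it factors through \<open>q\<close>; the factor is the homotopy
    inverse.\<close>
  obtain g where g: "continuous_map W X g" and gq: "\<And>x. x \<in> topspace X \<Longrightarrow> g (q x) = f x"
  proof (rule quotient_map_lift_exists[OF quo cf])
    show "f x = f y" if "x \<in> topspace X" "y \<in> topspace X" "q x = q y" for x y
      using that by (rule ff)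
  qed (rule that)
  obtain h where h: "continuous_map (prod_topology ?I X) X h" "\<And>x. h (0, x) = x" "\<And>x. h (1, x) = f x"
    and hA: "\<And>u. u \<in> {0..1} \<Longrightarrow> (\<lambda>x. h (u, x)) ` A \<subseteq> A"
    using f unfolding homotopic_with_def by auto
  \<comment> \<open>The homotopy descends if \<open>Q\<close> is a quotient map, which again follows
    from a compact source and a Hausdorff target.\<close>
  define Q where "Q = (\<lambda>p :: real \<times> _. (fst p, q (snd p)))"
  have Q: "continuous_map (prod_topology ?I X) (prod_topology ?I W) Q"
    unfolding Q_def using continuous_map_compose[OF continuous_map_snd q(1)]
    by (intro continuous_map_pairedI continuous_map_fst) (simp add: o_def)
  have "Q ` topspace (prod_topology ?I X) = topspace (prod_topology ?I W)"
    using q(2) by (force simp: Q_def image_iff)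
  moreover have "compact_space (prod_topology ?I X)"
    using X by (simp add: compact_space_prod_topology compact_space_subtopology)
  moreover have "Hausdorff_space (prod_topology ?I W)"
    using W by (simp add: Hausdorff_space_prod_topology Hausdorff_space_subtopology)
  ultimately have quoQ: "quotient_map (prod_topology ?I X) (prod_topology ?I W) Q"
    using Q continuous_imp_quotient_map_compact by blast
  have qh: "continuous_map (prod_topology ?I X) W (q \<circ> h)"
    by (rule continuous_map_compose[OF h(1) q(1)])
  have qhQ: "(q \<circ> h) x = (q \<circ> h) y"
    if x: "x \<in> topspace (prod_topology ?I X)" and y: "y \<in> topspace (prod_topology ?I X)" and Qxy: "Q x = Q y" for x y
  proof -
    obtain u x' where x': "x = (u, x')" "u \<in> {0..1}" "x' \<in> topspace X" using x by auto
    obtain y' where y': "y = (u, y')" "y' \<in> topspace X" using y Qxy x' by (auto simp: Q_def)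
    have "q x' = q y'" using Qxy x' y' by (simp add: Q_def)
    then consider "x' = y'" | "x' \<in> A" "y' \<in> A" using fib[OF x'(3) y'(2)] by blast
    then show ?thesis
    proof cases
      case 2
      \<comment> \<open>Points of \<open>A\<close> may move during the homotopy, but only within
        \<open>A\<close>, so \<open>q\<close> still identifies them.\<close>
      then have "h (u, x') \<in> A" "h (u, y') \<in> A" using hA[OF x'(2)] by auto
      moreover from this have "h (u, x') \<in> topspace X" "h (u, y') \<in> topspace X" using A by auto
      ultimately show ?thesis using fib[of "h (u, x')" "h (u, y')"] x' y' by simp
    qed (simp add: x' y')
  qed
  obtain G where G: "continuous_map (prod_topology ?I W) W G"
    and GQ: "\<And>x. x \<in> topspace (prod_topology ?I X) \<Longrightarrow> G (Q x) = (q \<circ> h) x"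
  proof (rule quotient_map_lift_exists[OF quoQ qh])
    show "(q \<circ> h) x = (q \<circ> h) y"
      if "x \<in> topspace (prod_topology ?I X)" "y \<in> topspace (prod_topology ?I X)" "Q x = Q y" for x y
      using that by (rule qhQ)
  qed (rule that)
  have Gq: "G (u, q x) = q (h (u, x))" if "u \<in> {0..1}" "x \<in> topspace X" for u x
    using GQ[of "(u, x)"] that by (simp add: Q_def)
  have "homotopic_with (\<lambda>x. True) W W id (q \<circ> g)"
  proof -
    have "G (0, w) = id w \<and> G (1, w) = (q \<circ> g) w" if w: "w \<in> topspace W" for w
    proof -
      obtain x where x: "x \<in> topspace X" "w = q x"
        using w unfolding q(2)[symmetric] by blast
      show ?thesis
        using Gq[of 0 x] Gq[of 1 x] x h gq[OF x(1)] by simp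
    qed
    with G show ?thesis by (subst homotopic_with) auto
  qed
  moreover have "homotopic_with (\<lambda>x. True) X X id (g \<circ> q)"
  proof -
    have "homotopic_with (\<lambda>x. True) X X id f"
      using homotopic_with_mono[OF f] by simp
    moreover have "homotopic_with (\<lambda>x. True) X X f (g \<circ> q)"
      by (rule homotopic_with_equal) (use cf gq in auto)
    ultimately show ?thesis by (rule homotopic_with_trans)
  qed
  ultimately show ?thesis
    unfolding homotopy_equivalent_space_def using q(1) g
    by (intro exI[of _ q] exI[of _ g]) (simp add: homotopic_with_symD)
qed

section \<open>Maps out of sums and wedges\<close>

lemma continuous_map_from_sum_topology:
  assumes "\<And>i. i \<in> I \<Longrightarrow> continuous_map (X i) Y (\<lambda>x. f (i, x))"
  shows "continuous_map (sum_topology X I) Y f"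
proof -
  have "f p \<in> topspace Y" if p: "p \<in> topspace (sum_topology X I)" for p
  proof -
    obtain i x where "p = (i, x)" "i \<in> I" "x \<in> topspace (X i)" using p by auto
    then show ?thesis using continuous_map_funspace[OF assms] by blast
  qed
  moreover have "openin (sum_topology X I) {p \<in> topspace (sum_topology X I). f p \<in> U}" if U: "openin Y U" for U
    unfolding openin_sum_topology
  proof (intro conjI ballI)
    fix i assume i: "i \<in> I"
    have "{x. (i, x) \<in> {p \<in> topspace (sum_topology X I). f p \<in> U}} = {x \<in> topspace (X i). f (i, x) \<in> U}"
      using i by auto
    then show "openin (X i) {x. (i, x) \<in> {p \<in> topspace (sum_topology X I). f p \<in> U}}"
      using openin_continuous_map_preimage[OF assms[OF i] U] by simp
  qed auto
  ultimately show ?thesis by (auto simp: continuous_map_def)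
qed

lemma continuous_map_wedge_proj:
  "continuous_map (sum_topology X I) (wedge_sum I X b) (wedge_proj b)"
  unfolding continuous_map_def topspace_wedge_sum openin_wedge_sum by blast

text \<open>With no summands the base point is not in the image of \<open>wedge_proj\<close>, hence
  the separate condition on \<open>g None\<close>.\<close>

lemma continuous_map_from_wedge:
  assumes g: "continuous_map (sum_topology X I) Z (g \<circ> wedge_proj b)" and "g None \<in> topspace Z"
  shows "continuous_map (wedge_sum I X b) Z g"
proof -
  have "g w \<in> topspace Z" if "w \<in> topspace (wedge_sum I X b)" for w
    using that continuous_map_funspace[OF g] assms(2) unfolding topspace_wedge_sum by auto
  moreover have "openin (wedge_sum I X b) {w \<in> topspace (wedge_sum I X b). g w \<in> U}" if U: "openin Z U" for U
    unfolding openin_wedge_sum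
  proof
    have "{p \<in> topspace (sum_topology X I). wedge_proj b p \<in> {w \<in> topspace (wedge_sum I X b). g w \<in> U}} =
      {p \<in> topspace (sum_topology X I). (g \<circ> wedge_proj b) p \<in> U}"
      unfolding topspace_wedge_sum by auto
    then show "openin (sum_topology X I)
      {p \<in> topspace (sum_topology X I). wedge_proj b p \<in> {w \<in> topspace (wedge_sum I X b). g w \<in> U}}"
      using openin_continuous_map_preimage[OF g U] by simp
  qed (auto simp: topspace_wedge_sum)
  ultimately show ?thesis by (auto simp: continuous_map_def)
qed

abbreviation sphere_base :: "nat \<Rightarrow> real" where
  "sphere_base \<equiv> \<lambda>j. if j = 0 then 1 else 0"

text \<open>Collapsing all summands but the one with index \<open>i\<close> is continuous, and these
  maps together separate points; \<open>\<Phi>\<close> collects their coordinates.\<close>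

lemma Hausdorff_wedge_of_spheres: "Hausdorff_space (wedge_of_spheres k d)"
proof -
  define \<Phi> where "\<Phi> = (\<lambda>(w :: (nat \<times> (nat \<Rightarrow> real)) option) (i, j). case w of None \<Rightarrow> sphere_base j
      | Some (i', y) \<Rightarrow> if i = i' then y j else sphere_base j)"
  let ?b = "\<lambda>_ :: nat. sphere_base"
  have "continuous_map (wedge_of_spheres k d) (powertop_real UNIV) \<Phi>"
    unfolding wedge_of_spheres_def
  proof (rule continuous_map_from_wedge)
    show "continuous_map (sum_topology (\<lambda>_. nsphere d) {..<k}) (powertop_real UNIV) (\<Phi> \<circ> wedge_proj ?b)"
    proof (rule continuous_map_from_sum_topology)
      fix i' :: nat
      show "continuous_map (nsphere d) (powertop_real UNIV) (\<lambda>y. (\<Phi> \<circ> wedge_proj ?b) (i', y))"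
        unfolding continuous_map_componentwise_UNIV
      proof
        fix ij :: "nat \<times> nat"
        obtain i j where ij: "ij = (i, j)" by (cases ij)
        have "(\<Phi> \<circ> wedge_proj ?b) (i', y) ij = (if i = i' then y j else sphere_base j)" for y
          by (auto simp: \<Phi>_def ij wedge_proj_def)
        moreover have "continuous_map (nsphere d) euclideanreal (\<lambda>y. y j)"
          unfolding nsphere by (intro continuous_map_from_subtopology continuous_map_product_coordinates) simp
        ultimately show "continuous_map (nsphere d) euclideanreal (\<lambda>y. (\<Phi> \<circ> wedge_proj ?b) (i', y) ij)"
          by (cases "i = i'") auto
      qed
    qed
  qed simp
  moreover have "Hausdorff_space (powertop_real (UNIV :: (nat \<times> nat) set))"
    by (simp add: Hausdorff_space_product_topology)
  moreover have "inj_on \<Phi> (topspace (wedge_of_spheres k d))"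
  proof (rule inj_onI)
    fix w w' assume w: "w \<in> topspace (wedge_of_spheres k d)" "w' \<in> topspace (wedge_of_spheres k d)"
      and eq: "\<Phi> w = \<Phi> w'"
    have ne: "y \<noteq> sphere_base" if "Some (i, y) \<in> topspace (wedge_of_spheres k d)" for i y
      using that unfolding wedge_of_spheres_def topspace_wedge_sum by (auto simp: wedge_proj_def split: if_splits)
    have val: "\<Phi> None (i, j) = sphere_base j" "\<Phi> (Some (i', y)) (i, j) = (if i = i' then y j else sphere_base j)" for i i' y j
      by (simp_all add: \<Phi>_def)
    have eq': "\<Phi> w (i, j) = \<Phi> w' (i, j)" for i j by (simp only: eq)
    show "w = w'"
    proof (cases w)
      case None
      show ?thesis
      proof (cases w')
        case (Some p)
        then obtain i y where p: "w' = Some (i, y)" by (cases p) auto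
        have "y j = sphere_base j" for j
          using eq'[of i j] unfolding None p val by simp
        then have "y = sphere_base" by (rule ext)
        then show ?thesis using ne w(2) p by blast
      qed (simp add: None)
    next
      case (Some p)
      then obtain i y where p: "w = Some (i, y)" by (cases p) auto
      have ny: "y \<noteq> sphere_base" using ne w(1) p by blast
      show ?thesis
      proof (cases w')
        case None
        have "y j = sphere_base j" for j
          using eq'[of i j] unfolding None p val by simp
        then have "y = sphere_base" by (rule ext)
        then show ?thesis using ny by blast
      next
        case (Some p')
        then obtain i' y' where p': "w' = Some (i', y')" by (cases p') auto
        have vv: "y j = (if i = i' then y' j else sphere_base j)" for j
          using eq'[of i j] unfolding p p' val by simp
        have "i = i'"
        proof (rule ccontr)
          assume "i \<noteq> i'"
          then have "y = sphere_base" using vv by (intro ext) simp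
          then show False using ny by blast
        qed
        moreover have "y = y'" by (rule ext) (use vv \<open>i = i'\<close> in simp)
        ultimately show ?thesis by (simp add: p p')
      qed
    qed
  qed
  ultimately show ?thesis
    by (meson Hausdorff_space_injective_preimage)
qed

section \<open>Collapsing the boundary of a simplex\<close>

lemma Min_affine_image:
  fixes A :: "real set"
  assumes "finite A" "A \<noteq> {}" "0 \<le> m"
  shows "Min ((\<lambda>t. c + m * t) ` A) = c + m * Min A"
  by (rule mono_Min_commute[symmetric]) (use assms in \<open>auto intro!: monoI mult_left_mono\<close>)

text \<open>The inverse stereographic projection of the point with coordinates
  \<open>(x j - x 0) / m\<close>, where \<open>m\<close> is the least barycentric coordinate; the boundary \<open>m = 0\<close> is sent
  to the pole.\<close>

definition simplex_to_sphere :: "nat \<Rightarrow> (nat \<Rightarrow> real) \<Rightarrow> nat \<Rightarrow> real" where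
  "simplex_to_sphere d x = (let m = Min (x ` {..d}); N = (\<Sum>i\<in>{1..d}. (x i - x 0)\<^sup>2)
     in (\<lambda>j. if j = 0 then (N - m\<^sup>2) / (N + m\<^sup>2)
             else if j \<le> d then 2 * m * (x j - x 0) / (N + m\<^sup>2) else 0))"

locale standard_simplex =
  fixes d :: nat and x :: "nat \<Rightarrow> real"
  assumes nonneg: "\<And>i. i \<le> d \<Longrightarrow> 0 \<le> x i" and total: "(\<Sum>i\<le>d. x i) = 1"
begin

definition least :: real where "least = Min (x ` {..d})"

definition spread :: real where "spread = (\<Sum>i\<in>{1..d}. (x i - x 0)\<^sup>2)"

lemma least_nonneg: "0 \<le> least"
  using nonneg by (simp add: least_def)

lemma spread_nonneg: "0 \<le> spread"
  by (simp add: spread_def sum_nonneg)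

text \<open>Spread 0 makes all coordinates equal and least coordinate 0 makes them vanish,
  contradicting total 1.\<close>

lemma denominator_pos: "0 < spread + least\<^sup>2"
proof (rule ccontr)
  assume "\<not> 0 < spread + least\<^sup>2"
  then have s0: "spread = 0" and l0: "least = 0"
    using spread_nonneg by (smt (verit) zero_le_power2 power2_eq_square mult_eq_0_iff)+
  define c where "c = x 0"
  have eq: "x i = c" if "i \<le> d" for i
  proof (cases "i = 0")
    case False
    then show ?thesis
      using s0 that unfolding spread_def c_def by (subst (asm) sum_nonneg_eq_0_iff) auto
  qed (simp add: c_def)
  have "x ` {..d} = {c}" using eq by auto
  then have "c = 0" using l0 by (simp add: least_def)
  then have "(\<Sum>i\<le>d. x i) = 0" using eq by simp
  then show False using total by simp
qed

lemma sphere_0: "simplex_to_sphere d x 0 = (spread - least\<^sup>2) / (spread + least\<^sup>2)"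
  by (simp add: simplex_to_sphere_def Let_def least_def spread_def)

lemma sphere_Suc: "1 \<le> j \<Longrightarrow> j \<le> d \<Longrightarrow>
    simplex_to_sphere d x j = 2 * least * (x j - x 0) / (spread + least\<^sup>2)"
  by (simp add: simplex_to_sphere_def Let_def least_def spread_def)

lemma sphere_beyond: "d < j \<Longrightarrow> simplex_to_sphere d x j = 0"
  by (simp add: simplex_to_sphere_def Let_def)

lemma sphere_mem: "simplex_to_sphere d x \<in> topspace (nsphere d)"
proof -
  let ?y = "simplex_to_sphere d x" and ?D = "spread + least\<^sup>2"
  have "(\<Sum>i\<le>d. (?y i)\<^sup>2) = (?y 0)\<^sup>2 + (\<Sum>i\<in>{1..d}. (?y i)\<^sup>2)"
    by (simp add: sum.atLeast_Suc_atMost flip: atLeast0AtMost)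
  also have "(\<Sum>i\<in>{1..d}. (?y i)\<^sup>2) = (\<Sum>i\<in>{1..d}. (4 * least\<^sup>2 / ?D\<^sup>2) * (x i - x 0)\<^sup>2)"
    by (intro sum.cong refl) (simp add: sphere_Suc power_divide power_mult_distrib)
  also have "\<dots> = (4 * least\<^sup>2 / ?D\<^sup>2) * spread"
    by (simp only: spread_def sum_distrib_left)
  also have "(?y 0)\<^sup>2 + \<dots> = ((spread - least\<^sup>2)\<^sup>2 + 4 * least\<^sup>2 * spread) / ?D\<^sup>2"
    by (simp add: sphere_0 power_divide add_divide_distrib)
  also have "(spread - least\<^sup>2)\<^sup>2 + 4 * least\<^sup>2 * spread = ?D\<^sup>2"
    by (simp add: power2_eq_square algebra_simps)
  finally have "(\<Sum>i\<le>d. (?y i)\<^sup>2) = 1" using denominator_pos by simp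
  then show ?thesis by (simp add: nsphere sphere_beyond)
qed

lemma one_minus_sphere_0: "1 - simplex_to_sphere d x 0 = 2 * least\<^sup>2 / (spread + least\<^sup>2)"
  using denominator_pos by (simp add: sphere_0 field_simps)

lemma sphere_eq_base_iff: "simplex_to_sphere d x = sphere_base \<longleftrightarrow> least = 0"
proof
  assume "simplex_to_sphere d x = sphere_base"
  then have "1 - simplex_to_sphere d x 0 = 0" by simp
  then show "least = 0"
    using denominator_pos unfolding one_minus_sphere_0 by auto
next
  assume l: "least = 0"
  show "simplex_to_sphere d x = sphere_base"
  proof
    fix j
    consider "j = 0" | "1 \<le> j" "j \<le> d" | "d < j" by linarith
    then show "simplex_to_sphere d x j = sphere_base j"
    proof cases
      case 1
      then show ?thesis using l denominator_pos by (simp add: sphere_0)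
    next
      case 2
      then show ?thesis using l sphere_Suc[OF 2] by simp
    next
      case 3
      then show ?thesis by (simp add: sphere_beyond)
    qed
  qed
qed

lemma stereographic:
  assumes "least \<noteq> 0" "i \<le> d"
  shows "x i = x 0 + least * (if i = 0 then 0 else simplex_to_sphere d x i / (1 - simplex_to_sphere d x 0))"
proof (cases "i = 0")
  case False
  have D: "spread + least\<^sup>2 \<noteq> 0" using denominator_pos by simp
  have "simplex_to_sphere d x i / (1 - simplex_to_sphere d x 0) = (x i - x 0) / least"
    using False assms D unfolding one_minus_sphere_0
    by (simp add: sphere_Suc power2_eq_square)
  then show ?thesis using False assms(1) by simp
qed simp

end

text \<open>A point \<open>x\<close> with \<open>x i = x 0 + m * p i\<close> and least coordinate \<open>m\<close> is
  determined by \<open>p\<close>: its coordinates are proportional to \<open>p i + 1 - Min p\<close>.\<close>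

lemma simplex_to_sphere_inj:
  assumes x: "standard_simplex d x" and y: "standard_simplex d y"
    and lx: "standard_simplex.least d x \<noteq> 0"
    and eq: "simplex_to_sphere d x = simplex_to_sphere d y" and i: "i \<le> d"
  shows "x i = y i"
proof -
  interpret X: standard_simplex d x by (rule x)
  interpret Y: standard_simplex d y by (rule y)
  have ly: "Y.least \<noteq> 0"
    using X.sphere_eq_base_iff Y.sphere_eq_base_iff eq lx by simp
  define p where "p i = (if i = 0 then 0 else simplex_to_sphere d x i / (1 - simplex_to_sphere d x 0))" for i
  define \<mu> where "\<mu> = Min (p ` {..d})"
  define w where "w i = p i + 1 - \<mu>" for i
  have key: "z i = m * w i"
    if z: "\<And>i. i \<le> d \<Longrightarrow> z i = z 0 + m * p i" and m: "m = Min (z ` {..d})" "0 \<le> m" and i: "i \<le> d" for z :: "nat \<Rightarrow> real" and m i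
  proof -
    have "z ` {..d} = (\<lambda>t. z 0 + m * t) ` (p ` {..d})"
      unfolding image_image by (intro image_cong refl z) simp
    then have "Min (z ` {..d}) = z 0 + m * \<mu>"
      unfolding \<mu>_def using m(2) Min_affine_image[of "p ` {..d}" m "z 0"] by simp
    then have "z 0 = m - m * \<mu>" using m(1) by simp
    then show ?thesis using z[OF i] by (simp add: w_def algebra_simps)
  qed
  have xw: "x i = X.least * w i" if "i \<le> d" for i
  proof (rule key[OF _ _ X.least_nonneg that])
    show "x j = x 0 + X.least * p j" if "j \<le> d" for j
      using X.stereographic[OF lx that] by (simp only: p_def)
  qed (rule X.least_def)
  have yw: "y i = Y.least * w i" if "i \<le> d" for i
  proof (rule key[OF _ _ Y.least_nonneg that])
    show "y j = y 0 + Y.least * p j" if "j \<le> d" for j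
      using Y.stereographic[OF ly that] by (simp only: p_def eq)
  qed (rule Y.least_def)
  \<comment> \<open>Both totals are 1, so both least coordinates are the reciprocal of the same
    sum.\<close>
  have "X.least * (\<Sum>i\<le>d. w i) = 1" "Y.least * (\<Sum>i\<le>d. w i) = 1"
    using X.total Y.total xw yw by (simp_all add: sum_distrib_left)
  then have "X.least = Y.least" by (metis mult_cancel_right mult_zero_right zero_neq_one)
  then show ?thesis using xw[OF i] yw[OF i] by simp
qed

text \<open>The stereographic projection \<open>p\<close> of \<open>y\<close> is shifted to least
  entry 1 and divided by its total \<open>S\<close>. The result has least coordinate
  \<open>1 / S\<close> and differences \<open>p i / S\<close>, whose quotient is \<open>p i\<close>
  again.\<close>

lemma simplex_to_sphere_surj:
  assumes y: "y \<in> topspace (nsphere d)" and ne: "y \<noteq> sphere_base"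
  obtains x where "standard_simplex d x" "\<And>i. i \<le> d \<Longrightarrow> 0 < x i" "simplex_to_sphere d x = y"
proof -
  have sq: "(\<Sum>i\<le>d. (y i)\<^sup>2) = 1" and beyond: "\<And>i. d < i \<Longrightarrow> y i = 0"
    using y by (auto simp: nsphere)
  have split: "(\<Sum>i\<le>d. (y i)\<^sup>2) = (y 0)\<^sup>2 + (\<Sum>i\<in>{1..d}. (y i)\<^sup>2)"
    by (simp add: sum.atLeast_Suc_atMost flip: atLeast0AtMost)
  have y0: "y 0 < 1"
  proof (rule ccontr)
    assume "\<not> y 0 < 1"
    then have "1 \<le> (y 0)\<^sup>2" by (simp add: one_le_power)
    moreover have nn: "0 \<le> (\<Sum>i\<in>{1..d}. (y i)\<^sup>2)" by (simp add: sum_nonneg)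
    ultimately have z: "(\<Sum>i\<in>{1..d}. (y i)\<^sup>2) = 0" and "(y 0)\<^sup>2 = 1"
      using sq split by linarith+
    then have "y 0 = 1" using \<open>\<not> y 0 < 1\<close> by (auto simp: power2_eq_1_iff)
    moreover have "y i = 0" if "i \<noteq> 0" for i
    proof (cases "i \<le> d")
      case True
      then show ?thesis
        using z that by (subst (asm) sum_nonneg_eq_0_iff) auto
    qed (simp add: beyond)
    ultimately have "y = sphere_base" by auto
    then show False using ne by blast
  qed
  define p where "p i = (if i = 0 then 0 else y i / (1 - y 0))" for i
  define \<mu> where "\<mu> = Min (p ` {..d})"
  define w where "w i = p i + 1 - \<mu>" for i
  have w1: "1 \<le> w i" if "i \<le> d" for i
  proof -
    have "\<mu> \<le> p i" unfolding \<mu>_def using that by (intro Min_le) auto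
    then show ?thesis unfolding w_def by linarith
  qed
  have wmin: "Min (w ` {..d}) = 1"
  proof -
    have "\<mu> \<in> p ` {..d}" unfolding \<mu>_def by (intro Min_in) auto
    then obtain i where "i \<le> d" "p i = \<mu>" by auto
    then have "1 \<in> w ` {..d}" by (auto simp: w_def image_iff intro!: bexI[of _ i])
    then show ?thesis using w1 by (intro Min_eqI) auto
  qed
  define S where "S = (\<Sum>i\<le>d. w i)"
  have S: "0 < S" unfolding S_def using w1 by (intro sum_pos) (auto intro: less_le_trans[OF zero_less_one])
  define x where "x i = w i / S" for i
  have pos: "0 < x i" if "i \<le> d" for i
    using w1[OF that] S by (simp add: x_def)
  have std: "standard_simplex d x"
    by unfold_locales (use pos S in \<open>auto simp: x_def S_def less_imp_le simp flip: sum_divide_distrib\<close>)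
  interpret standard_simplex d x by (rule std)
  have l: "least = 1 / S"
  proof -
    have "x ` {..d} = (\<lambda>t. 0 + 1 / S * t) ` (w ` {..d})"
      by (simp add: image_image x_def)
    then have "least = 0 + 1 / S * Min (w ` {..d})"
      unfolding least_def using S Min_affine_image[of "w ` {..d}" "1 / S" 0] by simp
    then show ?thesis by (simp add: wmin)
  qed
  have diff: "x i - x 0 = p i / S" for i
    by (simp add: x_def w_def p_def diff_divide_distrib add_divide_distrib)
  define q where "q = (\<Sum>i\<in>{1..d}. (p i)\<^sup>2)"
  have spr: "spread = q / S\<^sup>2"
    by (simp add: spread_def diff q_def power_divide flip: sum_divide_distrib)
  \<comment> \<open>As \<open>y\<close> has norm 1, the squares of its other coordinates add up to
    \<open>(1 - y 0) * (1 + y 0)\<close>.\<close>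
  have q: "q = (1 + y 0) / (1 - y 0)"
  proof -
    have "q = (\<Sum>i\<in>{1..d}. (y i)\<^sup>2 / (1 - y 0)\<^sup>2)"
      unfolding q_def by (intro sum.cong refl) (simp add: p_def power_divide)
    also have "\<dots> = (1 - (y 0)\<^sup>2) / (1 - y 0)\<^sup>2"
      using sq split by (simp flip: sum_divide_distrib)
    also have "1 - (y 0)\<^sup>2 = (1 - y 0) * (1 + y 0)" by (simp add: power2_eq_square algebra_simps)
    finally show ?thesis using y0 by (simp add: power2_eq_square)
  qed
  have D: "spread + least\<^sup>2 = (q + 1) / S\<^sup>2"
    by (simp add: spr l power_divide add_divide_distrib)
  have q1: "q + 1 = 2 / (1 - y 0)" using y0 by (simp add: q field_simps)
  have om: "1 - simplex_to_sphere d x 0 = 1 - y 0"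
    unfolding one_minus_sphere_0 D unfolding l q1 using S y0 by (simp add: power_divide)
  have "simplex_to_sphere d x = y"
  proof
    fix j
    consider "j = 0" | "1 \<le> j" "j \<le> d" | "d < j" by linarith
    then show "simplex_to_sphere d x j = y j"
    proof cases
      case 1
      then show ?thesis using om by simp
    next
      case 2
      have "simplex_to_sphere d x j = 2 * (1 / S) * (p j / S) / ((2 / (1 - y 0)) / S\<^sup>2)"
        using sphere_Suc[OF 2] unfolding D unfolding l diff q1 .
      also have "\<dots> = p j * (1 - y 0)" using S y0 by (simp add: power2_eq_square)
      also have "\<dots> = y j" using 2 y0 by (simp add: p_def)
      finally show ?thesis .
    next
      case 3
      then show ?thesis by (simp add: sphere_beyond beyond)
    qed
  qed
  with std pos show thesis by (rule that)
qed

lemma simplex_to_sphere_cong: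
  assumes "\<And>i. i \<le> d \<Longrightarrow> x i = y i"
  shows "simplex_to_sphere d x = simplex_to_sphere d y"
proof -
  have "x ` {..d} = y ` {..d}" using assms by (intro image_cong) auto
  moreover have "(\<Sum>i\<in>{1..d}. (x i - x 0)\<^sup>2) = (\<Sum>i\<in>{1..d}. (y i - y 0)\<^sup>2)"
    using assms by (intro sum.cong) auto
  ultimately show ?thesis
    using assms unfolding simplex_to_sphere_def Let_def by (intro ext) auto
qed

lemma continuous_map_simplex_to_sphere:
  assumes g: "\<And>i. i \<le> d \<Longrightarrow> continuous_map Y euclideanreal (\<lambda>y. g y i)"
    and std: "\<And>y. y \<in> topspace Y \<Longrightarrow> standard_simplex d (g y)"
  shows "continuous_map Y (nsphere d) (\<lambda>y. simplex_to_sphere d (g y))"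
proof -
  have m: "continuous_map Y euclideanreal (\<lambda>y. Min (g y ` {..d}))"
    by (rule continuous_map_Min) (use g in auto)
  have N: "continuous_map Y euclideanreal (\<lambda>y. \<Sum>i\<in>{1..d}. (g y i - g y 0)\<^sup>2)"
    unfolding power2_eq_square by (intro continuous_intros g) auto
  have D: "(\<Sum>i\<in>{1..d}. (g y i - g y 0)\<^sup>2) + (Min (g y ` {..d}))\<^sup>2 \<noteq> 0" if "y \<in> topspace Y" for y
  proof -
    interpret standard_simplex d "g y" by (rule std[OF that])
    show ?thesis using denominator_pos unfolding least_def spread_def by simp
  qed
  have "continuous_map Y euclideanreal (\<lambda>y. simplex_to_sphere d (g y) j)" for j
  proof -
    have m2: "continuous_map Y euclideanreal (\<lambda>y. (Min (g y ` {..d}))\<^sup>2)"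
      unfolding power2_eq_square by (intro continuous_intros m)
    consider "j = 0" | "j \<noteq> 0" "j \<le> d" | "j \<noteq> 0" "\<not> j \<le> d" by blast
    then show ?thesis
    proof cases
      case 1
      then have eq: "(\<lambda>y. simplex_to_sphere d (g y) j) = (\<lambda>y. ((\<Sum>i\<in>{1..d}. (g y i - g y 0)\<^sup>2) - (Min (g y ` {..d}))\<^sup>2) /
          ((\<Sum>i\<in>{1..d}. (g y i - g y 0)\<^sup>2) + (Min (g y ` {..d}))\<^sup>2))"
        by (simp add: simplex_to_sphere_def Let_def)
      show ?thesis
        unfolding eq by (rule continuous_map_real_divide[OF _ _ D]) (intro continuous_intros N m2)+
    next
      case 2
      then have eq: "(\<lambda>y. simplex_to_sphere d (g y) j) = (\<lambda>y. (2 * Min (g y ` {..d}) * (g y j - g y 0)) /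
          ((\<Sum>i\<in>{1..d}. (g y i - g y 0)\<^sup>2) + (Min (g y ` {..d}))\<^sup>2))"
        by (simp add: simplex_to_sphere_def Let_def)
      have c2: "continuous_map Y euclideanreal (\<lambda>y. 2 * Min (g y ` {..d}) * (g y j - g y 0))"
        using 2 by (intro continuous_intros m g continuous_map_real_mult_left) auto
      show ?thesis
        unfolding eq by (rule continuous_map_real_divide[OF c2 _ D]) (intro continuous_intros N m2)
    next
      case 3
      then show ?thesis by (simp add: simplex_to_sphere_def Let_def)
    qed
  qed
  moreover have "simplex_to_sphere d (g y) \<in> topspace (nsphere d)" if "y \<in> topspace Y" for y
    by (rule standard_simplex.sphere_mem[OF std[OF that]])
  ultimately show ?thesis
    unfolding nsphere by (auto simp: continuous_map_in_subtopology continuous_map_componentwise_UNIV)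
qed

section \<open>Collapsing a contractible subcomplex\<close>

locale critical_complex =
  fixes K :: "'v set set" and \<F> :: "'v set set" and d :: nat
  assumes complex: "simplicial_complex K" and finite_complex: "finite K" and critical: "\<F> \<subseteq> K"
    and card_critical: "F \<in> \<F> \<Longrightarrow> card F = Suc d"
    and maximal: "F \<in> \<F> \<Longrightarrow> T \<in> K \<Longrightarrow> F \<subseteq> T \<Longrightarrow> T = F"
begin

abbreviation "X \<equiv> geometric_realization K"

abbreviation "A \<equiv> K - \<F>"

lemma simplicial_A: "simplicial_complex A"
  unfolding simplicial_complex_def
proof (intro ballI conjI allI impI)
  fix T assume T: "T \<in> A"
  then show "finite T" using simplicial_complexD(1)[OF complex] by blast
  fix S assume S: "S \<subseteq> T"
  then have "S \<in> K" using simplicial_complexD(2)[OF complex] T by blast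
  moreover have "S \<notin> \<F>" using maximal[of S T] S T by blast
  ultimately show "S \<in> A" by blast
qed

lemma critical_finite:
  assumes "F \<in> \<F>"
  shows "finite F" "F \<noteq> {}"
proof -
  show "finite F" using assms critical simplicial_complexD(1)[OF complex] by blast
  show "F \<noteq> {}" using card_critical[OF assms] by auto
qed

lemma finite_critical: "finite \<F>"
  using critical finite_complex by (rule finite_subset)

lemma points_A: "t \<in> realization_points A \<longleftrightarrow> t \<in> realization_points K \<and> support t \<notin> \<F>"
  by (auto simp: realization_points_eq)

lemma Min_nonneg: "t \<in> realization_points K \<Longrightarrow> F \<in> \<F> \<Longrightarrow> 0 \<le> Min (t ` F)"
  by (intro Min_coordinate_pos_iff(2) critical_finite realization_pointsD(1))

lemma Min_support:
  assumes "t \<in> realization_points K" "F \<in> \<F>"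
  shows "Min (t ` F) \<noteq> 0 \<longleftrightarrow> support t = F"
proof -
  have "Min (t ` F) \<noteq> 0 \<longleftrightarrow> F \<subseteq> support t"
    using Min_coordinate_pos_iff(3)[of F t] critical_finite[OF assms(2)] realization_pointsD(1)[OF assms(1)]
    by blast
  also have "\<dots> \<longleftrightarrow> support t = F"
    using maximal[OF assms(2) realization_pointsD(2)[OF assms(1)]] by blast
  finally show ?thesis .
qed

text \<open>
  On a critical simplex, \<open>core t\<close> is the component of \<open>t\<close> along the barycenter and \<open>depth t\<close> is
  its mass, which is 0 on the boundary and 1 at the barycenter; both vanish off the critical simplices.
\<close>

definition depth :: "('v \<Rightarrow> real) \<Rightarrow> real" where
  "depth t = (\<Sum>F\<in>\<F>. real (Suc d) * Min (t ` F))"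

definition core :: "('v \<Rightarrow> real) \<Rightarrow> 'v \<Rightarrow> real" where
  "core t v = (\<Sum>F\<in>\<F>. if v \<in> F then Min (t ` F) else 0)"

lemma outside:
  assumes "t \<in> realization_points K" "support t \<notin> \<F>"
  shows "depth t = 0" "core t v = 0"
proof -
  have "Min (t ` F) = 0" if "F \<in> \<F>" for F
    using Min_support[OF assms(1) that] assms(2) that by blast
  then show "depth t = 0" "core t v = 0"
    unfolding depth_def core_def by (intro sum.neutral; simp)+
qed

lemma inside:
  assumes t: "t \<in> realization_points K" and F: "support t = F" "F \<in> \<F>"
  shows "depth t = real (Suc d) * Min (t ` F)" "core t v = (if v \<in> F then Min (t ` F) else 0)"
    and "0 < Min (t ` F)"
proof -
  have zero: "Min (t ` G) = 0" if "G \<in> \<F>" "G \<noteq> F" for G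
    using Min_support[OF t that(1)] F(1) that(2) by blast
  have "depth t = (\<Sum>G\<in>\<F>. if G = F then real (Suc d) * Min (t ` F) else 0)"
    unfolding depth_def by (intro sum.cong refl) (auto simp: zero)
  then show "depth t = real (Suc d) * Min (t ` F)"
    using F(2) finite_critical by simp
  have "core t v = (\<Sum>G\<in>\<F>. if G = F then (if v \<in> F then Min (t ` F) else 0) else 0)"
    unfolding core_def by (intro sum.cong refl) (auto simp: zero)
  then show "core t v = (if v \<in> F then Min (t ` F) else 0)"
    using F(2) finite_critical by simp
  show "0 < Min (t ` F)"
    using Min_support[OF t F(2)] Min_nonneg[OF t F(2)] F(1) by linarith
qed

lemma depth_bounds:
  assumes t: "t \<in> realization_points K"
  shows "0 \<le> depth t" "depth t \<le> 1"
proof -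
  show "0 \<le> depth t"
    unfolding depth_def by (intro sum_nonneg mult_nonneg_nonneg Min_nonneg[OF t]) simp_all
  show "depth t \<le> 1"
  proof (cases "support t \<in> \<F>")
    case True
    let ?F = "support t"
    have "depth t = (\<Sum>v\<in>?F. Min (t ` ?F))"
      using inside(1)[OF t refl True] card_critical[OF True] by simp
    also have "\<dots> \<le> sum t ?F"
      using critical_finite(1)[OF True] by (intro sum_mono Min_le) auto
    finally show ?thesis using realization_pointsD(3)[OF t] by simp
  next
    case False
    then show ?thesis using outside[OF t] by simp
  qed
qed

lemma depth_zero_iff:
  assumes t: "t \<in> realization_points K"
  shows "depth t = 0 \<longleftrightarrow> t \<in> realization_points A"
proof (cases "support t \<in> \<F>")
  case True
  then show ?thesis using inside[OF t refl True] by (simp add: points_A)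
next
  case False
  then show ?thesis using outside[OF t] t by (simp add: points_A)
qed

lemma continuous_map_depth: "continuous_map X euclideanreal depth"
  unfolding depth_def
  by (intro continuous_intros continuous_map_Min continuous_map_coordinate finite_critical critical_finite) auto

lemma continuous_map_core: "continuous_map X euclideanreal (\<lambda>t. core t v)"
proof -
  have "continuous_map X euclideanreal (\<lambda>t. if v \<in> F then Min (t ` F) else 0)" if "F \<in> \<F>" for F
  proof (cases "v \<in> F")
    case True
    then show ?thesis
      using critical_finite[OF that] by (simp add: continuous_map_Min continuous_map_coordinate)
  qed simp
  then show ?thesis
    unfolding core_def by (intro continuous_map_sum finite_critical)
qed

text \<open>Pushing the part of each critical simplex of depth at most \<open>1/2\<close> radially onto the boundary.\<close>

definition rate :: "('v \<Rightarrow> real) \<Rightarrow> real" where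
  "rate t = min 1 (2 * (1 - depth t))"

definition push :: "('v \<Rightarrow> real) \<Rightarrow> 'v \<Rightarrow> real" where
  "push t v = (t v - rate t * core t v) / (1 - rate t * depth t)"

text \<open>With rate 1 throughout, the denominator of \<open>push\<close> would vanish at the
  barycenter, where the depth is 1; therefore the rate falls to 0 there. As
  \<open>2 * (1 - u) * u \<le> 1 / 2\<close> for every depth \<open>u\<close>, the denominator is at
  least \<open>1 / 2\<close>.\<close>

lemma rate_bounds:
  assumes t: "t \<in> realization_points K"
  shows "0 \<le> rate t" "rate t \<le> 1" "0 < 1 - rate t * depth t"
proof -
  note b = depth_bounds[OF t]
  show "0 \<le> rate t" "rate t \<le> 1" using b by (auto simp: rate_def)
  have "0 \<le> (2 * depth t - 1)\<^sup>2" by simp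
  then have "2 * (1 - depth t) * depth t \<le> 1 / 2"
    by (simp add: power2_eq_square algebra_simps)
  moreover have "rate t * depth t \<le> 2 * (1 - depth t) * depth t"
    using b(1) by (intro mult_right_mono) (simp_all add: rate_def)
  ultimately show "0 < 1 - rate t * depth t" by linarith
qed

lemma push_A:
  assumes "t \<in> realization_points A"
  shows "push t = t"
proof -
  have t: "t \<in> realization_points K" "support t \<notin> \<F>" using assms by (simp_all add: points_A)
  show ?thesis by (simp add: push_def outside[OF t] fun_eq_iff)
qed

lemma push_inside:
  assumes t: "t \<in> realization_points K" and F: "support t = F" "F \<in> \<F>"
  shows "push t \<in> realization_points K" "support (push t) \<subseteq> F"
    and "depth t \<le> 1 / 2 \<Longrightarrow> push t \<in> realization_points A"
proof -
  let ?m = "Min (t ` F)"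
  note b = rate_bounds[OF t] and i = inside[OF t F]
  have fF: "finite F" using critical_finite F by blast
  have le: "?m \<le> t v" if "v \<in> F" for v
    using that fF by (intro Min_le) auto
  have pv: "push t v = (t v - rate t * (if v \<in> F then ?m else 0)) / (1 - rate t * depth t)" for v
    unfolding push_def i(2) ..
  show sub: "support (push t) \<subseteq> F"
  proof
    fix v assume "v \<in> support (push t)"
    then have "v \<in> F \<or> t v \<noteq> 0" unfolding pv by auto
    then show "v \<in> F" using F(1) by auto
  qed
  have nn: "0 \<le> push t v" for v
  proof -
    have "rate t * (if v \<in> F then ?m else 0) \<le> t v"
    proof (cases "v \<in> F")
      case True
      have "rate t * ?m \<le> 1 * ?m" using b(2) i(3) by (intro mult_right_mono) auto
      then show ?thesis using le[OF True] True by simp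
    next
      case False
      then show ?thesis using realization_pointsD(1)[OF t] by simp
    qed
    then show ?thesis unfolding pv using b(3) by simp
  qed
  have FK: "F \<in> K" using F(2) critical by blast
  have "sum (push t) F = 1"
  proof -
    have "sum (push t) F = (\<Sum>v\<in>F. t v - rate t * ?m) / (1 - rate t * depth t)"
      unfolding pv by (simp add: sum_divide_distrib)
    also have "(\<Sum>v\<in>F. t v - rate t * ?m) = 1 - rate t * depth t"
      using realization_pointsD(3)[OF t] card_critical[OF F(2)] F(1) i(1) by (simp add: sum_subtractf)
    finally show ?thesis using b(3) by simp
  qed
  then show pK: "push t \<in> realization_points K"
    using realization_pointsI[OF complex FK nn sub] by simp
  show "push t \<in> realization_points A" if "depth t \<le> 1 / 2"
  proof -
    \<comment> \<open>At rate 1 the vertex with the least coordinate loses all its mass, so the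
      image lies on the boundary of \<open>F\<close>.\<close>
    have r: "rate t = 1" using that by (simp add: rate_def)
    have "?m \<in> t ` F" using fF critical_finite[OF F(2)] by (intro Min_in) auto
    then obtain v where v: "v \<in> F" "t v = ?m" by auto
    then have "push t v = 0" unfolding pv r by simp
    then have ne: "v \<notin> support (push t)" by simp
    have "support (push t) \<notin> \<F>"
    proof
      assume "support (push t) \<in> \<F>"
      from maximal[OF this FK sub] show False using ne v(1) by blast
    qed
    with pK show ?thesis by (simp add: points_A)
  qed
qed

lemma push_points:
  assumes t: "t \<in> realization_points K"
  shows "push t \<in> realization_points K" "support (push t) \<subseteq> support t"
    and "depth t \<le> 1 / 2 \<Longrightarrow> push t \<in> realization_points A"
proof -
  have "push t \<in> realization_points K \<and> support (push t) \<subseteq> support t \<and>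
      (depth t \<le> 1 / 2 \<longrightarrow> push t \<in> realization_points A)"
  proof (cases "support t \<in> \<F>")
    case True
    then show ?thesis using push_inside[OF t refl] by blast
  next
    case False
    then have "t \<in> realization_points A" using t by (simp add: points_A)
    then show ?thesis using push_A t by simp
  qed
  then show "push t \<in> realization_points K" "support (push t) \<subseteq> support t"
    "depth t \<le> 1 / 2 \<Longrightarrow> push t \<in> realization_points A" by blast+
qed

lemma continuous_map_push: "continuous_map X X push"
proof -
  have "continuous_map X euclideanreal rate"
    unfolding rate_def by (intro continuous_intros continuous_map_depth) auto
  then have "continuous_map X euclideanreal (\<lambda>t. push t v)" for v
    unfolding push_def
    using rate_bounds(3)
    by (intro continuous_intros continuous_map_depth continuous_map_core continuous_map_coordinate)
      (auto simp: less_le)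
  then show ?thesis
    unfolding continuous_map_realization using push_points(1) by auto
qed

text \<open>The homotopy extension property of the pair, applied to a contraction of the subcomplex.\<close>

lemma extend_contraction:
  assumes contr: "contractible_space (geometric_realization A)" and a: "a \<in> realization_points A"
  obtains f where "homotopic_with (\<lambda>f. f ` realization_points A \<subseteq> realization_points A) X X id f"
    and "\<And>t. t \<in> realization_points A \<Longrightarrow> f t = a"
proof -
  let ?A = "realization_points A" and ?I = "top_of_set {0..1::real}"
  let ?P = "\<lambda>f. f ` ?A \<subseteq> ?A"
  let ?IX = "prod_topology ?I X"
  have AK: "A \<subseteq> K" by blast
  have "homotopic_with ?P X X id push"
  proof (rule homotopic_with_mono[OF homotopic_contiguous[OF complex]])
    show "\<exists>T\<in>K. support (id t) \<subseteq> T \<and> support (push t) \<subseteq> T" if "t \<in> realization_points K" for t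
      using push_points(2)[OF that] realization_pointsD(2)[OF that] by auto
    \<comment> \<open>\<open>push\<close> fixes the subcomplex pointwise, so the straight-line
      homotopy is stationary there.\<close>
    fix h assume h: "\<forall>t\<in>realization_points K. id t = push t \<longrightarrow> h t = id t"
    show "h ` ?A \<subseteq> ?A"
    proof
      fix y assume "y \<in> h ` ?A"
      then obtain t where t: "t \<in> ?A" "y = h t" by blast
      then have "h t = t" using h push_A[OF t(1)] realization_points_mono[OF AK] by auto
      with t show "y \<in> ?A" by simp
    qed
  qed (use continuous_map_push in auto)
  moreover
  have "homotopic_with (\<lambda>x. True) (geometric_realization A) (geometric_realization A) id (\<lambda>_. a)"
    using contr a unfolding contractible_space_alt by blast
  then obtain h where h: "continuous_map (prod_topology ?I (geometric_realization A)) (geometric_realization A) h"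
    and h0: "\<And>t. h (0, t) = t" and h1: "\<And>t. h (1, t) = a"
    unfolding homotopic_with_def by auto
  have hA: "h (u, t) \<in> ?A" if "u \<in> {0..1}" "t \<in> ?A" for u t
    using continuous_map_funspace[OF h] that by auto
  \<comment> \<open>\<open>push\<close> carries the points of depth at most \<open>1/2\<close> into
    the subcomplex, where \<open>h\<close> is available. The factor \<open>1 - 2 * depth\<close>
    lets \<open>h\<close> run in full on the subcomplex (depth 0) and not at all at depth
    \<open>1/2\<close>; there both formulas agree because \<open>h (0, t) = t\<close>.\<close>
  define H where "H = (\<lambda>p. if depth (snd p) \<le> 1 / 2
    then h (fst p * (1 - 2 * depth (snd p)), push (snd p)) else push (snd p))"
  have cd: "continuous_map ?IX euclideanreal (\<lambda>p. depth (snd p))"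
    using continuous_map_compose[OF continuous_map_snd continuous_map_depth] by (simp add: o_def)
  have cp: "continuous_map ?IX X (\<lambda>p. push (snd p))"
    using continuous_map_compose[OF continuous_map_snd continuous_map_push] by (simp add: o_def)
  have "continuous_map ?IX X H"
    unfolding H_def
  proof (rule continuous_map_cases_le[OF cd])
    let ?S = "{p \<in> topspace ?IX. depth (snd p) \<le> 1 / 2}"
    have "continuous_map (subtopology ?IX ?S) (prod_topology ?I (geometric_realization A))
        (\<lambda>p. (fst p * (1 - 2 * depth (snd p)), push (snd p)))"
    proof (rule continuous_map_pairedI)
      have "continuous_map ?IX euclideanreal (\<lambda>p. fst p * (1 - 2 * depth (snd p)))"
        by (intro continuous_intros continuous_map_unit_interval_coordinate cd) auto
      moreover have "fst p * (1 - 2 * depth (snd p)) \<in> {0..1}" if p: "p \<in> ?S" for p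
      proof -
        have "0 \<le> fst p" "fst p \<le> 1" "0 \<le> 1 - 2 * depth (snd p)" "1 - 2 * depth (snd p) \<le> 1"
          using p depth_bounds(1)[of "snd p"] by auto
        then show ?thesis by (simp add: mult_le_one)
      qed
      ultimately show "continuous_map (subtopology ?IX ?S) ?I (\<lambda>p. fst p * (1 - 2 * depth (snd p)))"
        by (auto simp: continuous_map_in_subtopology continuous_map_from_subtopology)
      have "continuous_map (subtopology ?IX ?S) X (\<lambda>p. push (snd p))"
        by (rule continuous_map_from_subtopology[OF cp])
      moreover have "push (snd p) \<in> ?A" if "p \<in> ?S" for p
        using that push_points(3)[of "snd p"] by auto
      ultimately have "continuous_map (subtopology ?IX ?S) (subtopology X ?A) (\<lambda>p. push (snd p))"
        by (intro continuous_map_into_subtopology) auto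
      then show "continuous_map (subtopology ?IX ?S) (geometric_realization A) (\<lambda>p. push (snd p))"
        unfolding subtopology_realization[OF AK] .
    qed
    then have "continuous_map (subtopology ?IX ?S) (geometric_realization A)
        (h \<circ> (\<lambda>p. (fst p * (1 - 2 * depth (snd p)), push (snd p))))"
      by (rule continuous_map_compose[OF _ h])
    then have "continuous_map (subtopology ?IX ?S) X
        (id \<circ> (h \<circ> (\<lambda>p. (fst p * (1 - 2 * depth (snd p)), push (snd p)))))"
      by (rule continuous_map_compose[OF _ continuous_map_realization_mono[OF AK]])
    then show "continuous_map (subtopology ?IX ?S) X
        (\<lambda>p. h (fst p * (1 - 2 * depth (snd p)), push (snd p)))"
      by (simp add: o_def)
    show "continuous_map (subtopology ?IX {p \<in> topspace ?IX. 1 / 2 \<le> depth (snd p)}) X (\<lambda>p. push (snd p))"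
      by (rule continuous_map_from_subtopology[OF cp])
    show "h (fst p * (1 - 2 * depth (snd p)), push (snd p)) = push (snd p)"
      if "p \<in> topspace ?IX" "depth (snd p) = 1 / 2" for p
      unfolding that(2) by (simp add: h0)
  qed simp
  moreover have HA: "H (u, t) = h (u, t)" if "t \<in> ?A" for u t
  proof -
    have "t \<in> realization_points K" using realization_points_mono[OF AK] that by blast
    then have "depth t = 0" using that depth_zero_iff by blast
    then show ?thesis by (simp add: H_def push_A[OF that])
  qed
  moreover have "H (0, t) = push t" for t by (simp add: H_def h0)
  ultimately have "homotopic_with ?P X X id push" "homotopic_with ?P X X push (\<lambda>t. H (1, t))"
    unfolding homotopic_with_def[of ?P X X push] using hA by (auto intro!: exI[of _ H])
  then have "homotopic_with ?P X X id (\<lambda>t. H (1, t))" by (rule homotopic_with_trans)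
  then show thesis
    by (rule that) (simp add: HA h1)
qed

text \<open>Points have coordinates over the whole vertex type, so compactness comes from a product
  of unit intervals. Closedness holds because the realization is a finite union of simplices, each
  cut out by closed coordinate conditions.\<close>

lemma compact_realization: "compact_space X"
proof -
  let ?U = "powertop_real (UNIV :: 'v set)"
  let ?D = "\<lambda>T. {t :: 'v \<Rightarrow> real. (\<forall>v. 0 \<le> t v) \<and> (\<forall>v. v \<notin> T \<longrightarrow> t v = 0) \<and> sum t T = 1}"
  have cc: "continuous_map ?U euclideanreal (\<lambda>t. t v)" for v
    by (rule continuous_map_product_coordinates) simp
  have cl: "closedin ?U (?D T)" if "T \<in> K" for T
  proof -
    have fT: "finite T" using simplicial_complexD(1)[OF complex that] .
    have 1: "closedin ?U {t \<in> topspace ?U. t v \<in> {0..}}" for v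
      by (rule closedin_continuous_map_preimage[OF cc]) simp
    have 2: "closedin ?U {t \<in> topspace ?U. t v \<in> {0}}" for v
      by (rule closedin_continuous_map_preimage[OF cc]) simp
    have "continuous_map ?U euclideanreal (\<lambda>t. sum t T)"
      by (intro continuous_map_sum fT cc)
    then have 3: "closedin ?U {t \<in> topspace ?U. sum t T \<in> {1}}"
      by (rule closedin_continuous_map_preimage) simp
    have "?D T =
      (\<Inter>v. {t \<in> topspace ?U. t v \<in> (if v \<in> T then {0..} else {0})}) \<inter> {t \<in> topspace ?U. sum t T \<in> {1}}"
    proof (intro subset_antisym subsetI)
      fix t assume t: "t \<in> (\<Inter>v. {t \<in> topspace ?U. t v \<in> (if v \<in> T then {0..} else {0})}) \<inter> {t \<in> topspace ?U. sum t T \<in> {1}}"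
      then have "t v \<in> (if v \<in> T then {0..} else {0})" for v by blast
      then have "0 \<le> t v \<and> (v \<notin> T \<longrightarrow> t v = 0)" for v by (metis atLeast_iff order_refl singletonD)
      with t show "t \<in> ?D T" by simp
    qed auto
    moreover have "closedin ?U {t \<in> topspace ?U. t v \<in> (if v \<in> T then {0..} else {0})}" for v
      using 1[of v] 2[of v] by (cases "v \<in> T") simp_all
    ultimately show ?thesis
      using 3 by (simp only:) (intro closedin_Int closedin_INT, auto)
  qed
  have "realization_points K = (\<Union>T\<in>K. ?D T)"
  proof (intro subset_antisym subsetI)
    fix t assume t: "t \<in> realization_points K"
    show "t \<in> (\<Union>T\<in>K. ?D T)"
      using realization_pointsD[OF t] by (intro UN_I[of "support t"]) auto
  next
    fix t assume "t \<in> (\<Union>T\<in>K. ?D T)"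
    then obtain T where T: "T \<in> K" and t: "\<And>v. 0 \<le> t v" "\<And>v. v \<notin> T \<Longrightarrow> t v = 0" "sum t T = 1"
      by auto
    then have "support t \<subseteq> T" by auto
    with t show "t \<in> realization_points K"
      by (intro realization_pointsI[OF complex T])
  qed
  then have "closedin ?U (realization_points K)"
    using cl finite_complex by (simp only:) (intro closedin_Union finite_imageI, auto)
  moreover have "realization_points K \<subseteq> PiE UNIV (\<lambda>_. {0..1})"
  proof
    fix t assume t: "t \<in> realization_points K"
    have "t v \<le> 1" for v
    proof (cases "t v = 0")
      case False
      have "finite (support t)" using simplicial_complexD(1)[OF complex realization_pointsD(2)[OF t]] .
      then have "t v \<le> sum t (support t)"
        using False realization_pointsD(1)[OF t] by (intro member_le_sum) auto
      then show ?thesis using realization_pointsD(3)[OF t] by simp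
    qed simp
    then show "t \<in> PiE UNIV (\<lambda>_. {0..1})"
      using realization_pointsD(1)[OF t] by (auto simp: PiE_def)
  qed
  moreover have "compactin ?U (PiE UNIV (\<lambda>_. {0..1}))"
    by (simp add: compactin_PiE)
  ultimately have "compactin ?U (realization_points K)"
    by (metis closed_compactin)
  then show ?thesis
    unfolding realization_points_eq unfolding geometric_realization_def by (rule compact_space_subtopology)
qed


text \<open>Each closed critical simplex is mapped onto its own sphere, its boundary going to the
  base point together with the rest of the subcomplex. Hence the preimage of the base point is the
  subcomplex and all other fibres are single points.\<close>

lemma homotopy_equivalent_wedge:
  assumes contr: "contractible_space (geometric_realization A)" and a: "a \<in> realization_points A"
  shows "X homotopy_equivalent_space wedge_of_spheres (card \<F>) d"
proof -
  let ?W = "wedge_of_spheres (card \<F>) d" and ?b = "\<lambda>_ :: nat. sphere_base"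
  let ?A = "realization_points A"
  obtain idx where idx: "bij_betw idx \<F> {..<card \<F>}"
    using ex_bij_betw_finite_nat[OF finite_critical] by (auto simp: atLeast0LessThan)
  have "\<exists>e. bij_betw e {..d} F" if "F \<in> \<F>" for F
    using ex_bij_betw_nat_finite[OF critical_finite(1)[OF that]] card_critical[OF that]
    by (simp add: atLeast0LessThan lessThan_Suc_atMost)
  then obtain e where e: "\<And>F. F \<in> \<F> \<Longrightarrow> bij_betw (e F) {..d} F"
    by metis
  define sph where "sph F t = simplex_to_sphere d (\<lambda>i. t (e F i))" for F and t :: "'v \<Rightarrow> real"
  define q where "q t = (if support t \<in> \<F> then Some (idx (support t), sph (support t) t) else None)"
    for t :: "'v \<Rightarrow> real"
  have q_None: "q t = None \<longleftrightarrow> support t \<notin> \<F>" for t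
    by (simp add: q_def)
  have AK: "?A \<subseteq> realization_points K" by (rule realization_points_mono) blast
  have std: "standard_simplex d (\<lambda>i. t (e F i))"
    if "t \<in> realization_points K" "F \<in> \<F>" "support t \<subseteq> F" for t F
  proof
    show "0 \<le> t (e F i)" for i by (rule realization_pointsD(1)[OF that(1)])
    have "(\<Sum>i\<le>d. t (e F i)) = sum t F"
      by (rule sum.reindex_bij_betw[OF e[OF that(2)]])
    also have "\<dots> = 1"
      by (rule sum_support_superset[OF that(1) critical_finite(1)[OF that(2)] that(3)])
    finally show "(\<Sum>i\<le>d. t (e F i)) = 1" .
  qed
  have least: "standard_simplex.least d (\<lambda>i. t (e F i)) = Min (t ` F)"
    if "t \<in> realization_points K" "F \<in> \<F>" "support t \<subseteq> F" for t F
  proof -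
    have "(\<lambda>i. t (e F i)) ` {..d} = t ` F"
      using e[OF that(2)] by (simp add: bij_betw_def image_image[symmetric] del: image_image)
    then show ?thesis
      by (simp add: standard_simplex.least_def[OF std[OF that]])
  qed
  have base_iff: "sph F t = sphere_base \<longleftrightarrow> support t \<noteq> F"
    if "t \<in> realization_points K" "F \<in> \<F>" "support t \<subseteq> F" for t F
    unfolding sph_def standard_simplex.sphere_eq_base_iff[OF std[OF that]] least[OF that]
    using Min_support[OF that(1,2)] by blast
  have q_proj: "wedge_proj ?b (idx F, sph F t) = q t"
    if t: "t \<in> realization_points K" and F: "F \<in> \<F>" and sub: "support t \<subseteq> F" for t F
  proof (cases "support t = F")
    case True
    then have "sph F t \<noteq> sphere_base" using base_iff[OF that] by blast
    then show ?thesis using True F by (simp add: q_def wedge_proj_def)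
  next
    case False
    \<comment> \<open>A proper face of \<open>F\<close> is not maximal in \<open>K\<close> and so
      not critical.\<close>
    then have "support t \<notin> \<F>" using maximal[of "support t" F] F critical sub by blast
    moreover have "sph F t = sphere_base" using base_iff[OF that] False by blast
    ultimately show ?thesis by (simp add: q_def wedge_proj_def)
  qed
  have qA: "q t = None" if "t \<in> ?A" for t
    using that by (simp add: points_A q_def)
  have qW: "continuous_map X ?W q"
  \<comment> \<open>The finite closed cover consists of the subcomplex, with index
    \<open>None\<close>, and the closed critical simplices.\<close>
  proof (rule pasting_lemma_closed[where I = "insert None (Some ` \<F>)"
        and T = "\<lambda>i. case i of None \<Rightarrow> ?A | Some F \<Rightarrow> {t \<in> realization_points K. support t \<subseteq> F}"
        and f = "\<lambda>i. case i of None \<Rightarrow> (\<lambda>_. None) | Some F \<Rightarrow> (\<lambda>t. wedge_proj ?b (idx F, sph F t))"])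
    let ?T = "\<lambda>i. case i of None \<Rightarrow> ?A | Some F \<Rightarrow> {t \<in> realization_points K. support t \<subseteq> F}"
    let ?f = "\<lambda>i. case i of None \<Rightarrow> (\<lambda>_. None) | Some F \<Rightarrow> (\<lambda>t. wedge_proj ?b (idx F, sph F t))"
    have fq: "?f i t = q t" if "i \<in> insert None (Some ` \<F>)" "t \<in> ?T i" for i t
    proof (cases i)
      case None
      then show ?thesis using that(2) qA by simp
    next
      case (Some F)
      then show ?thesis using that q_proj by auto
    qed
    show "finite (insert None (Some ` \<F>))" using finite_critical by simp
    show "closedin X (?T i)" if "i \<in> insert None (Some ` \<F>)" for i
    proof (cases i)
      case None
      have "?A = {t \<in> realization_points K. depth t \<in> {0}}"
        using depth_zero_iff AK by blast
      moreover have "closedin X {t \<in> realization_points K. depth t \<in> {0}}"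
        by (rule closedin_continuous_map_preimage[OF continuous_map_depth]) simp
      ultimately show ?thesis using None by simp
    next
      case (Some F)
      have "{t \<in> realization_points K. support t \<subseteq> F} =
          (\<Inter>v. {t \<in> realization_points K. t v \<in> (if v \<in> F then UNIV else {0})})"
        by (auto split: if_splits)
      moreover have "closedin X {t \<in> realization_points K. t v \<in> (if v \<in> F then UNIV else {0})}" for v
        by (rule closedin_continuous_map_preimage[OF continuous_map_coordinate]) simp
      ultimately show ?thesis using Some by (simp only: option.case) (intro closedin_INT, auto)
    qed
    show "continuous_map (subtopology X (?T i)) ?W (?f i)" if i: "i \<in> insert None (Some ` \<F>)" for i
    proof (cases i)
      case None
      then show ?thesis by (simp add: wedge_of_spheres_def topspace_wedge_sum)
    next
      case (Some F)
      then have F: "F \<in> \<F>" using i by auto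
      let ?Y = "subtopology X {t \<in> realization_points K. support t \<subseteq> F}"
      have "continuous_map ?Y (nsphere d) (sph F)"
        unfolding sph_def
      proof (rule continuous_map_simplex_to_sphere)
        show "continuous_map ?Y euclideanreal (\<lambda>t. t (e F i))" for i
          by (intro continuous_map_from_subtopology continuous_map_coordinate)
        show "standard_simplex d (\<lambda>i. t (e F i))" if "t \<in> topspace ?Y" for t
          using that std F by auto
      qed
      moreover have "continuous_map (nsphere d) (sum_topology (\<lambda>_. nsphere d) {..<card \<F>}) (\<lambda>y. (idx F, y))"
        using bij_betwE[OF idx] F by (intro continuous_map_component_injection) auto
      ultimately have "continuous_map ?Y (sum_topology (\<lambda>_. nsphere d) {..<card \<F>}) ((\<lambda>y. (idx F, y)) \<circ> sph F)"
        by (rule continuous_map_compose)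
      from continuous_map_compose[OF this continuous_map_wedge_proj[where b = ?b]]
      show ?thesis
        unfolding wedge_of_spheres_def Some by (simp add: o_def)
    qed
    show "?f i t = ?f j t" if "i \<in> insert None (Some ` \<F>)" "j \<in> insert None (Some ` \<F>)"
      "t \<in> topspace X \<inter> ?T i \<inter> ?T j" for i j t
      using fq[OF that(1), of t] fq[OF that(2), of t] that(3) by simp
    show "\<exists>j. j \<in> insert None (Some ` \<F>) \<and> t \<in> ?T j \<and> q t = ?f j t" if t: "t \<in> topspace X" for t
    proof (cases "support t \<in> \<F>")
      case True
      then show ?thesis using t fq[of "Some (support t)" t] by (intro exI[of _ "Some (support t)"]) simp
    next
      case False
      then have "t \<in> ?A" using t by (simp add: points_A)
      then show ?thesis using qA by (intro exI[of _ None]) simp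
    qed
  qed
  have surj: "q ` topspace X = topspace ?W"
  proof (intro subset_antisym subsetI)
    show "w \<in> topspace ?W" if "w \<in> q ` topspace X" for w
      using that continuous_map_image_subset_topspace[OF qW] by blast
    fix w assume w: "w \<in> topspace ?W"
    show "w \<in> q ` topspace X"
    proof (cases w)
      case None
      then have "w = q a" using qA[OF a] by simp
      then show ?thesis using a AK by blast
    next
      case (Some p)
      then obtain i y where p: "w = Some (i, y)" by (cases p) auto
      have i: "i < card \<F>" and y: "y \<in> topspace (nsphere d)" and ne: "y \<noteq> sphere_base"
        using w unfolding p wedge_of_spheres_def topspace_wedge_sum
        by (auto simp: wedge_proj_def split: if_splits)
      have "i \<in> idx ` \<F>" using idx i by (simp add: bij_betw_def)
      then obtain F where F: "F \<in> \<F>" "idx F = i" by blast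
      obtain x where x: "standard_simplex d x" and pos: "\<And>i. i \<le> d \<Longrightarrow> 0 < x i"
        and xy: "simplex_to_sphere d x = y"
        using simplex_to_sphere_surj[OF y ne] by blast
      note eF = e[OF F(1)]
      \<comment> \<open>The point \<open>x\<close> is carried over to the vertices of
        \<open>F\<close>; its strictly positive coordinates make the support all of
        \<open>F\<close>.\<close>
      define t where "t v = (if v \<in> F then x (inv_into {..d} (e F) v) else 0)" for v
      have te: "t (e F j) = x j" if "j \<le> d" for j
        using that eF by (auto simp: t_def bij_betw_def)
      have tpos: "0 < t v" if v: "v \<in> F" for v
      proof -
        obtain j where "j \<le> d" "v = e F j" using eF v unfolding bij_betw_def by blast
        then show ?thesis using te pos by simp
      qed
      have supp: "support t = F"
      proof (intro subset_antisym subsetI)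
        show "v \<in> F" if "v \<in> support t" for v using that by (auto simp: t_def split: if_splits)
        show "v \<in> support t" if "v \<in> F" for v using tpos[OF that] by simp
      qed
      have "t \<in> realization_points K"
      proof (rule realization_pointsI[OF complex])
        show "F \<in> K" using F critical by blast
        show "0 \<le> t v" for v using tpos[of v] by (cases "v \<in> F") (auto simp: t_def)
        show "support t \<subseteq> F" using supp by simp
        have "sum t F = (\<Sum>j\<le>d. t (e F j))" by (rule sum.reindex_bij_betw[OF eF, symmetric])
        also have "\<dots> = (\<Sum>j\<le>d. x j)" using te by (intro sum.cong) auto
        finally show "sum t F = 1" using standard_simplex.total[OF x] by simp
      qed
      moreover have "sph F t = y"
        unfolding sph_def xy[symmetric] by (rule simplex_to_sphere_cong) (rule te)
      then have "q t = w" using supp F p by (simp add: q_def)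
      ultimately show ?thesis by blast
    qed
  qed
  have fib: "q t = q t' \<longleftrightarrow> t = t' \<or> t \<in> ?A \<and> t' \<in> ?A"
    if t: "t \<in> topspace X" and t': "t' \<in> topspace X" for t t'
  proof
    assume eq: "q t = q t'"
    then have "q t = None \<longleftrightarrow> q t' = None" by (simp only:)
    then have same: "support t \<in> \<F> \<longleftrightarrow> support t' \<in> \<F>"
      by (simp only: q_None simp_thms)
    show "t = t' \<or> t \<in> ?A \<and> t' \<in> ?A"
    proof (cases "support t \<in> \<F>")
      case True
      then have t'F: "support t' \<in> \<F>" by (simp only: same)
      have "idx (support t) = idx (support t')" and s: "sph (support t) t = sph (support t') t'"
        using eq True t'F by (simp_all add: q_def)
      then have supp: "support t' = support t"
        using idx True t'F by (metis bij_betw_imp_inj_on inj_onD)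
      let ?F = "support t"
      have sub': "support t' \<subseteq> ?F" by (simp only: supp)
      have l0: "standard_simplex.least d (\<lambda>i. t (e ?F i)) \<noteq> 0"
        using least[OF t True order_refl] Min_support[OF t True] by simp
      have s': "simplex_to_sphere d (\<lambda>i. t (e ?F i)) = simplex_to_sphere d (\<lambda>i. t' (e ?F i))"
        using s unfolding supp sph_def .
      have on: "t (e ?F i) = t' (e ?F i)" if "i \<le> d" for i
        using simplex_to_sphere_inj[OF std[OF t True order_refl] std[OF t' True sub'] l0 s' that] .
      have "t v = t' v" for v
      proof (cases "v \<in> ?F")
        case v: True
        then obtain i where "i \<le> d" "v = e ?F i"
          using e[OF True] unfolding bij_betw_def by blast
        then show ?thesis using on by simp
      next
        case False
        then have "v \<notin> support t'" by (simp only: supp not_False_eq_True)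
        with False show ?thesis by simp
      qed
      then show ?thesis by blast
    next
      case False
      then have "support t' \<notin> \<F>" by (simp only: same not_False_eq_True)
      then show ?thesis using False t t' by (simp add: points_A)
    qed
  qed (use qA in auto)
  obtain f where f: "homotopic_with (\<lambda>f. f ` ?A \<subseteq> ?A) X X id f" "\<And>t. t \<in> ?A \<Longrightarrow> f t = a"
    using extend_contraction[OF contr a] by blast
  show ?thesis
    using homotopy_equivalent_collapse[OF compact_realization Hausdorff_wedge_of_spheres qW surj fib f AK] .
qed

end

theorem theorem21:
  fixes P :: "'a set" and r :: "'a rel" and n :: nat
  assumes "finite P" and "partial_order_on P r" and "card P = n" and "n \<ge> 3"
  shows "geometric_realization (order_complex (proper_op_partitions P r) (refinement_order P))
           homotopy_equivalent_space
         wedge_of_spheres (num_cyclic_extensions P r) (n - 3)"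
proof -
  let ?K = "order_complex (proper_op_partitions P r) (refinement_order P)"
  \<comment> \<open>Critical chains with \<open>n - 2\<close> elements span simplices of dimension
    \<open>n - 3\<close>.\<close>
  have n: "card P = Suc (Suc (Suc (n - 3)))" using assms(3,4) by simp
  obtain \<F> where \<F>: "critical_faces ?K (Suc (n - 3)) (num_cyclic_extensions P r) \<F>"
    using exists_critical_faces[OF assms(1,2) n] by blast
  have "finite (proper_congruences P r)"
    using finite_congruences[OF assms(1)] by (simp add: proper_congruences_def)
  moreover have "P \<noteq> {}" using n by auto
  ultimately have fin: "finite (proper_op_partitions P r)"
    using proper_op_partitions_eq[OF partial_order_onD(4)[OF assms(2)]] by simp
  have sc: "simplicial_complex ?K"
    unfolding simplicial_complex_def order_complex_def Chains_def
    by (auto intro: finite_subset)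
  interpret critical_complex ?K \<F> "n - 3"
  proof
    show "finite ?K"
      by (rule finite_subset[of _ "Pow (proper_op_partitions P r)"]) (use fin in \<open>auto simp: order_complex_def\<close>)
    show "\<F> \<subseteq> ?K" using \<F> unfolding critical_faces_def by blast
    show "card F = Suc (n - 3)" if "F \<in> \<F>" for F
      using \<F> that unfolding critical_faces_def by blast
    show "T = F" if "F \<in> \<F>" "T \<in> ?K" "F \<subseteq> T" for F T
      using \<F> that unfolding critical_faces_def by blast
  qed (rule sc)
  have "{} \<in> ?K" by (simp add: order_complex_def Chains_def)
  \<comment> \<open>The empty face must remain in \<open>A\<close>, since a collapsible complex
    without it could be void.\<close>
  moreover have "{} \<notin> \<F>" using card_critical[of "{}"] by auto
  moreover have "collapsible A" using \<F> unfolding critical_faces_def by blast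
  ultimately have "contractible_space (geometric_realization A)" "realization_points A \<noteq> {}"
    using collapsible_contractible[OF _ simplicial_A] by auto
  moreover have "card \<F> = num_cyclic_extensions P r"
    using \<F> unfolding critical_faces_def by blast
  ultimately show ?thesis
    using homotopy_equivalent_wedge by fastforce
qed

end
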